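(* Every planar graph has track number at most $225$.
   Context: A $t$-track assignment of a graph $G$ is a partition of $V(G)$ into $t$ sets $V_1,\dots,V_t$ (tracks), each an independent set of $G$, together with a total order $<_i$ on each $V_i$. An X-crossing consists of two edges $(u,v)$ and $(x,y)$ with $u,x\in V_i$, $v,y\in V_j$ ($i\neq j$), $u<_i x$ and $y<_j v$. A $t$-track layout is a $t$-track assignment with no X-crossing; the track number $\mathrm{tn}(G)$ is the minimum $t$ for which $G$ has a $t$-track layout. *)

theory Defs
  imports "HOL-Analysis.Analysis"
begin

definition simple_graph :: "'a set \<Rightarrow> 'a set set \<Rightarrow> bool" where
  "simple_graph V E \<longleftrightarrow> finite V \<and> (\<forall>e\<in>E. e \<subseteq> V \<and> card e = 2)"

definition planar :: "'a set \<Rightarrow> 'a set set \<Rightarrow> bool" where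
  "planar V E \<longleftrightarrow>
     (\<exists>(pos :: 'a \<Rightarrow> real^2) (curve :: 'a set \<Rightarrow> real \<Rightarrow> real^2).
        inj_on pos V \<and>
        (\<forall>e\<in>E. arc (curve e) \<and> {pathstart (curve e), pathfinish (curve e)} = pos ` e
               \<and> path_image (curve e) \<inter> pos ` V = pos ` e) \<and>
        (\<forall>e\<in>E. \<forall>e'\<in>E. e \<noteq> e' \<longrightarrow>
               path_image (curve e) \<inter> path_image (curve e') \<subseteq> pos ` (e \<inter> e')))"

definition track_assignment ::
  "'a set \<Rightarrow> 'a set set \<Rightarrow> nat \<Rightarrow> ('a \<Rightarrow> nat) \<Rightarrow> (nat \<Rightarrow> ('a \<times> 'a) set) \<Rightarrow> bool" where
  "track_assignment V E t tr ord \<longleftrightarrow>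
     (\<forall>v\<in>V. tr v < t) \<and>
     (\<forall>e\<in>E. \<forall>u\<in>e. \<forall>v\<in>e. u \<noteq> v \<longrightarrow> tr u \<noteq> tr v) \<and>
     (\<forall>i<t. ord i \<subseteq> {v\<in>V. tr v = i} \<times> {v\<in>V. tr v = i}
            \<and> strict_linear_order_on {v\<in>V. tr v = i} (ord i))"

definition has_X_crossing ::
  "'a set set \<Rightarrow> ('a \<Rightarrow> nat) \<Rightarrow> (nat \<Rightarrow> ('a \<times> 'a) set) \<Rightarrow> bool" where
  "has_X_crossing E tr ord \<longleftrightarrow>
     (\<exists>u v x y. {u, v} \<in> E \<and> {x, y} \<in> E \<and> tr u = tr x \<and> tr v = tr y \<and> tr u \<noteq> tr v
        \<and> (u, x) \<in> ord (tr u) \<and> (y, v) \<in> ord (tr v))"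

definition track_layout ::
  "'a set \<Rightarrow> 'a set set \<Rightarrow> nat \<Rightarrow> ('a \<Rightarrow> nat) \<Rightarrow> (nat \<Rightarrow> ('a \<times> 'a) set) \<Rightarrow> bool" where
  "track_layout V E t tr ord \<longleftrightarrow> track_assignment V E t tr ord \<and> \<not> has_X_crossing E tr ord"

definition track_number :: "'a set \<Rightarrow> 'a set set \<Rightarrow> nat" where
  "track_number V E = (LEAST t. \<exists>tr ord. track_layout V E t tr ord)"

end

theory Submission
  imports Defs
begin

text \<open>Overlay the drawing with a fine triangular lattice and let each vertex own a connected set of cells, the
outside of the drawing being one extra vertex.  Planarity then reduces to parity of edge sets of the lattice.  Split
the vertices into the layers of a breadth-first search from the outside vertex.  A Sperner-type argument finds, in any
region bounded by at most three earlier parts, a tripod (a connected union of at most three vertical paths) that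
separates the region into smaller ones of the same kind.  Contracting the tripods embeds the graph into a universal
Apollonian network.  Its vertices are nested outerplane components; a 5-colouring by component type (parent types differ
from child types by one or two) and by level mod 5 is a track layout with 25 tracks.  Together with
the leg of the tripod and the layer mod 3 this gives \<open>25 * 3 * 3 = 225\<close> tracks.\<close>

section \<open>Parity in the triangular lattice\<close>

text \<open>No embedding, rotation system or Jordan curve is ever stored. Only three cells meet at a
  lattice face, so the single planar fact needed is modulo 2: an edge set with even degrees bounds a
  set of faces. It implies that two connected cell sets with connected complement have at most two
  faces that meet both of them and something else; the configurations excluded later all produce a
  third such face. Regions are therefore described only by which connected sets touch which. A
  vertical path has one vertex per layer, so leg and layer identify a vertex of a tripod, and edges
  change the layer by at most one, so residues mod 3 suffice. The two fives have separate origins. A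
  triangle spans three consecutive levels, so triangles whose lowest levels share a window of three
  reach just \<open>3 + 2 = 5\<close> levels. To keep neighbouring windows apart, the type has to
  reveal the parity of the window, hence the two possible steps 1 and 2; five is the least modulus
  in which 0, these steps and their negatives are all distinct.\<close>

definition restr :: "('v \<Rightarrow> 'v \<Rightarrow> bool) \<Rightarrow> 'v set \<Rightarrow> 'v \<Rightarrow> 'v \<Rightarrow> bool" where
  "restr r S a b \<longleftrightarrow> r a b \<and> a \<in> S \<and> b \<in> S"

definition conn :: "('v \<Rightarrow> 'v \<Rightarrow> bool) \<Rightarrow> 'v set \<Rightarrow> bool" where
  "conn r S \<longleftrightarrow> (\<forall>x\<in>S. \<forall>y\<in>S. (restr r S)\<^sup>*\<^sup>* x y)"

definition touch :: "('v \<Rightarrow> 'v \<Rightarrow> bool) \<Rightarrow> 'v set \<Rightarrow> 'v set \<Rightarrow> bool" where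
  "touch r S T \<longleftrightarrow> (\<exists>s\<in>S. \<exists>t\<in>T. r s t)"

lemma conn_empty [simp]: "conn r {}" and conn_singleton [simp]: "conn r {a}"
  by (auto simp: conn_def)

lemma restr_mono: "S \<subseteq> T \<Longrightarrow> (restr r S)\<^sup>*\<^sup>* x y \<Longrightarrow> (restr r T)\<^sup>*\<^sup>* x y"
  by (erule rtranclp_mono[THEN predicate2D, rotated]) (auto simp: restr_def)

lemma restr_sym:
  assumes "symp r" shows "(restr r S)\<^sup>*\<^sup>* x y \<Longrightarrow> (restr r S)\<^sup>*\<^sup>* y x"
proof -
  have "symp (restr r S)" using assms by (auto simp: symp_def restr_def)
  thus "(restr r S)\<^sup>*\<^sup>* x y \<Longrightarrow> (restr r S)\<^sup>*\<^sup>* y x"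
    by (metis symp_rtranclp sympD)
qed

lemma conn_star:
  assumes "symp r" "a \<in> S" "\<And>x. x \<in> S \<Longrightarrow> (restr r S)\<^sup>*\<^sup>* a x"
  shows "conn r S"
  unfolding conn_def using assms restr_sym by (meson rtranclp_trans)

lemma conn_Un:
  assumes "symp r" "conn r S" "conn r T" "touch r S T"
  shows "conn r (S \<union> T)"
proof -
  obtain s t where st: "s \<in> S" "t \<in> T" "r s t" using assms(4) by (auto simp: touch_def)
  show ?thesis
  proof (rule conn_star[OF assms(1)])
    show "s \<in> S \<union> T" using st by auto
    fix x assume "x \<in> S \<union> T"
    thus "(restr r (S \<union> T))\<^sup>*\<^sup>* s x"
    proof
      assume "x \<in> S" thus ?thesis using assms(2) st restr_mono[of S "S \<union> T"]
        by (auto simp: conn_def)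
    next
      assume "x \<in> T"
      hence "(restr r (S \<union> T))\<^sup>*\<^sup>* t x" using assms(3) st restr_mono[of T "S \<union> T"]
        by (auto simp: conn_def)
      moreover have "restr r (S \<union> T) s t" using st by (auto simp: restr_def)
      ultimately show ?thesis by (rule converse_rtranclp_into_rtranclp[rotated])
    qed
  qed
qed

lemma rtranclp_leaves:
  assumes "r\<^sup>*\<^sup>* a b" "a \<in> S" "b \<notin> S"
  shows "\<exists>x y. r x y \<and> x \<in> S \<and> y \<notin> S"
  using assms by (induction rule: rtranclp_induct) auto

text \<open>A path inside \<open>S\<close> from \<open>T\<close> to its complement must step out of
  \<open>T\<close>. This serves as the boundary argument throughout.\<close>

lemma conn_leaves:
  assumes "conn r S" "a \<in> S" "b \<in> S" "a \<in> T" "b \<notin> T"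
  shows "\<exists>x\<in>S. \<exists>y\<in>S. r x y \<and> x \<in> T \<and> y \<notin> T"
  using rtranclp_leaves[of "restr r S" a b T] assms by (auto simp: conn_def restr_def)

text \<open>The triangular lattice: the square grid with one diagonal in each square.\<close>

type_synonym cell = "int \<times> int"
datatype edge = EH int int | EV int int | ED int int
datatype face = Up int int | Dn int int

fun ends :: "edge \<Rightarrow> cell set" where
  "ends (EH i j) = {(i,j),(i+1,j)}"
| "ends (EV i j) = {(i,j),(i,j+1)}"
| "ends (ED i j) = {(i+1,j),(i,j+1)}"

text \<open>Every edge lies between one upward and one downward triangle, so its two sides have
  names without any orientation.\<close>

fun fup :: "edge \<Rightarrow> face" where
  "fup (EH i j) = Up i j" | "fup (EV i j) = Up i j" | "fup (ED i j) = Up i j"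

fun fdn :: "edge \<Rightarrow> face" where
  "fdn (EH i j) = Dn i (j-1)" | "fdn (EV i j) = Dn (i-1) j" | "fdn (ED i j) = Dn i j"

fun fedges :: "face \<Rightarrow> edge set" where
  "fedges (Up i j) = {EH i j, EV i j, ED i j}"
| "fedges (Dn i j) = {ED i j, EV (i+1) j, EH i (j+1)}"

fun fv :: "face \<Rightarrow> cell set" where
  "fv (Up i j) = {(i,j),(i+1,j),(i,j+1)}"
| "fv (Dn i j) = {(i+1,j),(i,j+1),(i+1,j+1)}"

definition ladj :: "cell \<Rightarrow> cell \<Rightarrow> bool" where
  "ladj z z' \<longleftrightarrow> (\<exists>e. ends e = {z,z'})"

lemma symp_ladj: "symp ladj"
  by (auto simp: symp_def ladj_def insert_commute)

lemma ladj_neq: "ladj z z' \<Longrightarrow> z \<noteq> z'"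
proof -
  have "ends e \<noteq> {z}" for e by (cases e) auto
  thus "ladj z z' \<Longrightarrow> z \<noteq> z'" unfolding ladj_def by (metis insert_absorb2)
qed

lemma fedges_iff: "e \<in> fedges f \<longleftrightarrow> f = fup e \<or> f = fdn e"
  by (cases e; cases f) auto

lemma fup_neq_fdn: "fup e \<noteq> fdn e'"
  by (cases e; cases e') auto

lemma ends_subset_fv: "ends e \<subseteq> fv (fup e)" "ends e \<subseteq> fv (fdn e)"
  by (cases e; auto)+

text \<open>The mod 2 boundary of a 2-chain. \<open>M\<close> may be infinite, so passing to the
  complement is allowed.\<close>

definition boundary :: "face set \<Rightarrow> edge \<Rightarrow> bool" where
  "boundary M e \<longleftrightarrow> (fup e \<in> M) \<noteq> (fdn e \<in> M)"

text \<open>Double counting of incidences between \<open>W\<close> and \<open>M\<close>: a boundary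
  edge is counted once, any other edge twice or not at all.\<close>

lemma boundary_parity:
  assumes "finite W"
  shows "even (card {e\<in>W. boundary M e}) \<longleftrightarrow> even (card {f\<in>M. odd (card (W \<inter> fedges f))})"
proof -
  \<comment> \<open>Only faces next to \<open>W\<close> matter, which keeps the sum finite for
    infinite \<open>M\<close>.\<close>
  define F where "F = M \<inter> (fup ` W \<union> fdn ` W)"
  have fF: "finite F" using assms by (auto simp: F_def)
  have cnt: "card {f\<in>F. e \<in> fedges f} = of_bool (fup e \<in> M) + of_bool (fdn e \<in> M)" if "e \<in> W" for e
  proof -
    have "{f\<in>F. e \<in> fedges f} = {f. (f = fup e \<and> fup e \<in> M) \<or> (f = fdn e \<and> fdn e \<in> M)}"
      using that by (auto simp: F_def fedges_iff)
    also have "\<dots> = (if fup e \<in> M then {fup e} else {}) \<union> (if fdn e \<in> M then {fdn e} else {})"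
      by auto
    also have "card \<dots> = of_bool (fup e \<in> M) + of_bool (fdn e \<in> M)"
      using fup_neq_fdn[of e e] by auto
    finally show ?thesis .
  qed
  have "(\<Sum>f\<in>F. card (W \<inter> fedges f)) = (\<Sum>f\<in>F. \<Sum>e\<in>W. of_bool (e \<in> fedges f))"
    using assms by (intro sum.cong) (auto simp: sum.If_cases of_bool_def Int_def)
  also have "\<dots> = (\<Sum>e\<in>W. \<Sum>f\<in>F. of_bool (e \<in> fedges f))" by (rule sum.swap)
  also have "\<dots> = (\<Sum>e\<in>W. card {f\<in>F. e \<in> fedges f})"
    using fF by (intro sum.cong) (auto simp: sum.If_cases of_bool_def Int_def)
  also have "\<dots> = (\<Sum>e\<in>W. of_bool (fup e \<in> M) + of_bool (fdn e \<in> M))"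
    using cnt by (intro sum.cong) auto
  finally have eq: "(\<Sum>f\<in>F. card (W \<inter> fedges f)) = (\<Sum>e\<in>W. of_bool (fup e \<in> M) + of_bool (fdn e \<in> M))" .
  have "{f\<in>F. odd (card (W \<inter> fedges f))} = {f\<in>M. odd (card (W \<inter> fedges f))}"
  proof -
    have "f \<in> fup ` W \<union> fdn ` W" if "odd (card (W \<inter> fedges f))" for f
    proof -
      have "W \<inter> fedges f \<noteq> {}" using that by auto
      thus ?thesis by (auto simp: fedges_iff)
    qed
    thus ?thesis by (auto simp: F_def)
  qed
  moreover have "{e\<in>W. odd ((of_bool (fup e \<in> M) + of_bool (fdn e \<in> M))::nat)} = {e\<in>W. boundary M e}"
    by (auto simp: boundary_def of_bool_def split: if_splits)
  ultimately show ?thesis using eq even_sum_iff[OF fF, of "\<lambda>f. card (W \<inter> fedges f)"]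
      even_sum_iff[OF assms, of "\<lambda>e. (of_bool (fup e \<in> M) + of_bool (fdn e \<in> M))::nat"] by simp
qed

section \<open>Edge sets modulo 2: degrees, sums, paths and cycles\<close>

definition deg_in :: "edge set \<Rightarrow> cell \<Rightarrow> nat" where
  "deg_in p v = card {e\<in>p. v \<in> ends e}"

text \<open>Addition of 1-chains modulo 2; paths and single edges are glued to cycles with
  it.\<close>

definition sdiff :: "'e set \<Rightarrow> 'e set \<Rightarrow> 'e set" where
  "sdiff p q = (p - q) \<union> (q - p)"

lemma finite_sdiff [simp]: "finite p \<Longrightarrow> finite q \<Longrightarrow> finite (sdiff p q)" by (simp add: sdiff_def)

lemma odd_card_sdiff:
  assumes "finite p" "finite q"
  shows "odd (card (sdiff p q)) \<longleftrightarrow> odd (card p) \<noteq> odd (card q)"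
proof -
  have "card p = card (p - q) + card (p \<inter> q)" "card q = card (q - p) + card (p \<inter> q)"
    using assms by (metis Int_commute add.commute card_Int_Diff)+
  moreover have "card (sdiff p q) = card (p - q) + card (q - p)"
    unfolding sdiff_def using assms by (intro card_Un_disjoint) auto
  ultimately show ?thesis by auto
qed

lemma odd_dg_sdiff:
  assumes "finite p" "finite q"
  shows "odd (deg_in (sdiff p q) v) \<longleftrightarrow> odd (deg_in p v) \<noteq> odd (deg_in q v)"
proof -
  have "{e\<in>sdiff p q. v \<in> ends e} = sdiff {e\<in>p. v \<in> ends e} {e\<in>q. v \<in> ends e}"
    by (auto simp: sdiff_def)
  thus ?thesis unfolding deg_in_def using odd_card_sdiff[of "{e\<in>p. v \<in> ends e}" "{e\<in>q. v \<in> ends e}"] assms by simp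
qed

lemma odd_dg_single: "odd (deg_in {e} v) \<longleftrightarrow> v \<in> ends e"
proof -
  have "{e'\<in>{e}. v \<in> ends e'} = (if v \<in> ends e then {e} else {})" by auto
  thus ?thesis by (simp add: deg_in_def)
qed

text \<open>Each step of the walk is added modulo 2, which moves the odd end from \<open>y\<close>
  to \<open>z\<close>. Repeated edges cancel, so the walk need not be simple.\<close>

lemma path_edges:
  assumes "(restr ladj P)\<^sup>*\<^sup>* a b"
  shows "\<exists>p. finite p \<and> (\<forall>e\<in>p. ends e \<subseteq> P) \<and> (\<forall>v. odd (deg_in p v) \<longleftrightarrow> (v = a) \<noteq> (v = b))"
  using assms
proof (induction rule: rtranclp_induct)
  case base
  show ?case by (intro exI[of _ "{}"]) (auto simp: deg_in_def)
next
  case (step y z)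
  then obtain p where p: "finite p" "\<forall>e\<in>p. ends e \<subseteq> P" "\<And>v. odd (deg_in p v) \<longleftrightarrow> (v = a) \<noteq> (v = y)" by auto
  obtain e where e: "ends e = {y,z}" "y \<in> P" "z \<in> P" "y \<noteq> z"
    using step(2) ladj_neq by (auto simp: restr_def ladj_def)
  have "odd (deg_in (sdiff p {e}) v) \<longleftrightarrow> (v = a) \<noteq> (v = z)" for v
    using odd_dg_sdiff[OF p(1), of "{e}" v] p(3)[of v] odd_dg_single[of e v] e by auto
  moreover have "\<forall>e'\<in>sdiff p {e}. ends e' \<subseteq> P" using p(2) e by (auto simp: sdiff_def)
  ultimately show ?case using p(1) by (intro exI[of _ "sdiff p {e}"]) auto
qed

text \<open>A face is inside if the leftward ray from it, within its row, crosses the edge set an odd number of times.\<close>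

lemma even_edge_set_is_boundary:
  assumes fin: "finite c" and ev: "\<And>v. even (deg_in c v)"
  shows "\<exists>S. \<forall>e. boundary S e \<longleftrightarrow> e \<in> c"
proof -
  define v where "v i j = {k. k \<le> i \<and> EV k j \<in> c}" for i j
  define d where "d i j = {k. k \<le> i \<and> ED k j \<in> c}" for i j
  have fv: "finite (v i j)" for i j
  proof -
    have "(\<lambda>k. EV k j) ` v i j \<subseteq> c" by (auto simp: v_def)
    thus ?thesis using fin by (metis (no_types, lifting) edge.inject(2) finite_imageD finite_subset inj_onI)
  qed
  have fd: "finite (d i j)" for i j
  proof -
    have "(\<lambda>k. ED k j) ` d i j \<subseteq> c" by (auto simp: d_def)
    thus ?thesis using fin by (metis (no_types, lifting) edge.inject(3) finite_imageD finite_subset inj_onI)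
  qed
  have vs: "odd (card (v i j)) \<longleftrightarrow> (odd (card (v (i-1) j)) \<noteq> (EV i j \<in> c))" for i j
  proof -
    have "v i j = (if EV i j \<in> c then insert i (v (i-1) j) else v (i-1) j)"
      by (auto simp: v_def) (metis order_le_less zle_diff1_eq)+
    moreover have "i \<notin> v (i-1) j" by (auto simp: v_def)
    ultimately show ?thesis using fv[of "i-1" j] by auto
  qed
  have ds: "odd (card (d i j)) \<longleftrightarrow> (odd (card (d (i-1) j)) \<noteq> (ED i j \<in> c))" for i j
  proof -
    have "d i j = (if ED i j \<in> c then insert i (d (i-1) j) else d (i-1) j)"
      by (auto simp: d_def) (metis order_le_less zle_diff1_eq)+
    moreover have "i \<notin> d (i-1) j" by (auto simp: d_def)
    ultimately show ?thesis using fd[of "i-1" j] by auto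
  qed
  \<comment> \<open>From left to right, row \<open>j\<close> reads \<open>EV i j\<close>,
    \<open>Up i j\<close>, \<open>ED i j\<close>, \<open>Dn i j\<close>, \<open>EV (i+1) j\<close>.
    So the ray from \<open>Up i j\<close> meets vertical edges up to \<open>i\<close> but diagonals
    only up to \<open>i-1\<close>.\<close>
  define S where "S = {f. case f of Up i j \<Rightarrow> odd (card (v i j)) \<noteq> odd (card (d (i-1) j))
                               | Dn i j \<Rightarrow> odd (card (v i j)) \<noteq> odd (card (d i j))}"
  have Up: "Up i j \<in> S \<longleftrightarrow> odd (card (v i j)) \<noteq> odd (card (d (i-1) j))" for i j by (simp add: S_def)
  have Dn: "Dn i j \<in> S \<longleftrightarrow> odd (card (v i j)) \<noteq> odd (card (d i j))" for i j by (simp add: S_def)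
  \<comment> \<open>Even degree at \<open>(i,j)\<close> ties its two horizontal edges to the other
    four.\<close>
  have deg: "((EH i j \<in> c) \<noteq> (EH (i-1) j \<in> c)) = (((EV i j \<in> c) \<noteq> (EV i (j-1) \<in> c)) \<noteq> ((ED (i-1) j \<in> c) \<noteq> (ED i (j-1) \<in> c)))" for i j
  proof -
    have "{e\<in>c. (i,j) \<in> ends e} = c \<inter> {EH i j, EH (i-1) j, EV i j, EV i (j-1), ED (i-1) j, ED i (j-1)}"
    proof -
      have "(i,j) \<in> ends e \<longleftrightarrow> e \<in> {EH i j, EH (i-1) j, EV i j, EV i (j-1), ED (i-1) j, ED i (j-1)}" for e
        by (cases e) auto
      thus ?thesis by auto
    qed
    hence "even (card (c \<inter> {EH i j, EH (i-1) j, EV i j, EV i (j-1), ED (i-1) j, ED i (j-1)}))"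
      using ev[of "(i,j)"] by (simp add: deg_in_def)
    thus ?thesis by (auto simp: Int_insert_right split: if_splits)
  qed
  \<comment> \<open>\<open>g j i\<close> says that the criterion fails at \<open>EH i j\<close>, the
    only kind of edge not settled by construction. By the degree condition failure does not depend
    on \<open>i\<close>, and far to the left these rows contain nothing of \<open>c\<close>.\<close>
  define g where "g j i \<longleftrightarrow> (((Up i j \<in> S) \<noteq> (Dn i (j-1) \<in> S)) \<noteq> (EH i j \<in> c))" for i j
  have gs: "g j i \<longleftrightarrow> g j (i-1)" for i j
    unfolding g_def Up Dn using deg[of i j] vs[of i j] vs[of i "j-1"] ds[of "i-1" j] ds[of i "j-1"]
    by (auto simp: algebra_simps)
  have gF: "\<not> g j i" for i j
  proof -
    have inv: "finite {k. h k \<in> c}" if "inj h" for h :: "int \<Rightarrow> edge"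
      using finite_vimageI[OF fin that] by (simp add: vimage_def)
    have fH: "finite ({k. EH k j \<in> c} \<union> {k. EV k j \<in> c} \<union> {k. ED k j \<in> c} \<union> {k. EV k (j-1) \<in> c} \<union> {k. ED k (j-1) \<in> c})"
      (is "finite ?K")
      using inv[of "\<lambda>k. EH k j"] inv[of "\<lambda>k. EV k j"] inv[of "\<lambda>k. ED k j"] inv[of "\<lambda>k. EV k (j-1)"] inv[of "\<lambda>k. ED k (j-1)"]
      by (simp add: inj_def)
    obtain b where b: "b \<le> i" "\<And>k. k \<in> ?K \<Longrightarrow> b < k"
    proof -
      have *: "\<exists>b. b \<le> i \<and> (\<forall>k\<in>?K. b < k)"
      proof (cases "?K = {}")
        case True thus ?thesis by (metis empty_iff order_refl)
      next
        case False
        have "min i (Min ?K - 1) < k" if "k \<in> ?K" for k using Min_le[OF fH that] by linarith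
        thus ?thesis by (intro exI[of _ "min i (Min ?K - 1)"] conjI ballI) simp
      qed
      thus ?thesis using that by blast
    qed
    have none: "EH k j \<notin> c \<and> EV k j \<notin> c \<and> ED k j \<notin> c \<and> EV k (j-1) \<notin> c \<and> ED k (j-1) \<notin> c" if "k \<le> b" for k
      using b(2)[of k] that by auto
    have "v b j = {}" "d (b-1) j = {}" "v b (j-1) = {}" "d b (j-1) = {}"
      using none by (auto simp: v_def d_def)
    hence "\<not> g j b" using none[of b] by (simp add: g_def Up Dn)
    with b(1) show ?thesis
      by (induction rule: int_ge_induct) (use gs[of j "_ + 1"] in auto)
  qed
  have "boundary S e \<longleftrightarrow> e \<in> c" for e
  proof (cases e)
    case (EH i j) thus ?thesis using gF[of j i] by (auto simp: boundary_def g_def)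
  next
    case (EV i j) thus ?thesis using vs[of i j] by (auto simp: boundary_def Up Dn)
  next
    case (ED i j) thus ?thesis using ds[of i j] by (auto simp: boundary_def Up Dn)
  qed
  thus ?thesis by blast
qed

text \<open>The six faces around \<open>z\<close> form a ring whose neighbours share an edge at
  \<open>z\<close>, and membership cannot change across a non-boundary edge.\<close>

lemma star_constant:
  assumes "\<And>e. z \<in> ends e \<Longrightarrow> \<not> boundary S e" "z \<in> fv f" "z \<in> fv f'"
  shows "f \<in> S \<longleftrightarrow> f' \<in> S"
proof -
  obtain i j where z: "z = (i,j)" by (cases z)
  have 1: "(Up i j \<in> S) = (Dn i (j-1) \<in> S)" using assms(1)[of "EH i j"] z by (auto simp: boundary_def)
  have 2: "(Up i j \<in> S) = (Dn (i-1) j \<in> S)" using assms(1)[of "EV i j"] z by (auto simp: boundary_def)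
  have 3: "(Up (i-1) j \<in> S) = (Dn (i-1) (j-1) \<in> S)" using assms(1)[of "EH (i-1) j"] z by (auto simp: boundary_def)
  have 4: "(Up i (j-1) \<in> S) = (Dn (i-1) (j-1) \<in> S)" using assms(1)[of "EV i (j-1)"] z by (auto simp: boundary_def)
  have 5: "(Up (i-1) j \<in> S) = (Dn (i-1) j \<in> S)" using assms(1)[of "ED (i-1) j"] z by (auto simp: boundary_def)
  have 6: "(Up i (j-1) \<in> S) = (Dn i (j-1) \<in> S)" using assms(1)[of "ED i (j-1)"] z by (auto simp: boundary_def)
  have all: "g \<in> {Up i j, Up (i-1) j, Up i (j-1), Dn i (j-1), Dn (i-1) j, Dn (i-1) (j-1)}" if "z \<in> fv g" for g
    using that z by (cases g) auto
  have "g \<in> S \<longleftrightarrow> Up i j \<in> S" if "z \<in> fv g" for g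
    using all[OF that] 1 2 3 4 5 6 by auto
  from this[OF assms(2)] this[OF assms(3)] show ?thesis by simp
qed

text \<open>Membership in \<open>S\<close> spreads from star to star along paths in
  \<open>C\<close>, so all of \<open>C\<close> is on one side. If that is the inside, the complement
  has the same boundary and is taken instead.\<close>

lemma fill_avoiding:
  assumes fin: "finite c" and ev: "\<And>v. even (deg_in c v)"
    and C: "conn ladj C" "\<And>e. e \<in> c \<Longrightarrow> ends e \<inter> C = {}"
  shows "\<exists>S. (\<forall>e. boundary S e \<longleftrightarrow> e \<in> c) \<and> (\<forall>f\<in>S. fv f \<inter> C = {})"
proof -
  obtain S where S: "\<And>e. boundary S e \<longleftrightarrow> e \<in> c" using even_edge_set_is_boundary[OF fin ev] by auto
  have bdC: "\<not> boundary S e" if "z \<in> ends e" "z \<in> C" for e z using S C(2) that by auto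
  have same: "f \<in> S \<longleftrightarrow> f' \<in> S" if z: "z \<in> C" "z' \<in> C" "z \<in> fv f" "z' \<in> fv f'" for f f' z z'
  proof -
    have "(restr ladj C)\<^sup>*\<^sup>* z z'" using C(1) z by (auto simp: conn_def)
    hence "\<forall>f'. z' \<in> fv f' \<longrightarrow> (f \<in> S \<longleftrightarrow> f' \<in> S)"
    proof (induction rule: rtranclp_induct)
      case base
      show ?case using star_constant[of z S f] bdC z by blast
    next
      case (step x y)
      obtain e where e: "ends e = {x,y}" using step(2) by (auto simp: restr_def ladj_def)
      have xy: "x \<in> fv (fup e)" "y \<in> fv (fup e)" using ends_subset_fv(1)[of e] e by auto
      have yC: "y \<in> C" using step(2) by (auto simp: restr_def)
      show ?case
      proof (intro allI impI)
        fix f' assume "y \<in> fv f'"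
        hence "fup e \<in> S \<longleftrightarrow> f' \<in> S" using star_constant[of y S "fup e" f'] bdC yC xy by blast
        thus "f \<in> S \<longleftrightarrow> f' \<in> S" using step.IH xy by blast
      qed
    qed
    thus ?thesis using z by blast
  qed
  show ?thesis
  proof (cases "\<exists>f\<in>S. fv f \<inter> C \<noteq> {}")
    case False thus ?thesis using S by auto
  next
    case True
    hence "\<forall>f\<in>-S. fv f \<inter> C = {}" using same by blast
    moreover have "\<forall>e. boundary (-S) e \<longleftrightarrow> e \<in> c" using S by (auto simp: boundary_def)
    ultimately show ?thesis by blast
  qed
qed

section \<open>Faces that meet two given cell sets and something else\<close>

definition cross :: "cell set \<Rightarrow> cell set \<Rightarrow> edge set" where
  "cross P Q = {e. ends e \<inter> P \<noteq> {} \<and> ends e \<inter> Q \<noteq> {}}"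

definition tri :: "cell set \<Rightarrow> cell set \<Rightarrow> face \<Rightarrow> bool" where
  "tri P Q f \<longleftrightarrow> fv f \<inter> P \<noteq> {} \<and> fv f \<inter> Q \<noteq> {} \<and> \<not> fv f \<subseteq> P \<union> Q"

text \<open>Sperner's counting step: a face with all three classes has one
  \<open>P\<close>-\<open>Q\<close> edge, a face inside \<open>P \<union> Q\<close> that meets both
  has two, and any other face has none.\<close>

lemma odd_cross:
  assumes "P \<inter> Q = {}"
  shows "odd (card (cross P Q \<inter> fedges f)) \<longleftrightarrow> tri P Q f"
proof (cases f)
  case (Up i j)
  have "cross P Q \<inter> fedges f = 
     (if ((i,j) \<in> P \<and> (i+1,j) \<in> Q) \<or> ((i,j) \<in> Q \<and> (i+1,j) \<in> P) then {EH i j} else {}) \<union>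
     (if ((i,j) \<in> P \<and> (i,j+1) \<in> Q) \<or> ((i,j) \<in> Q \<and> (i,j+1) \<in> P) then {EV i j} else {}) \<union>
     (if ((i,j+1) \<in> P \<and> (i+1,j) \<in> Q) \<or> ((i,j+1) \<in> Q \<and> (i+1,j) \<in> P) then {ED i j} else {})"
    using assms Up by (auto simp: cross_def)
  thus ?thesis using assms Up by (auto simp: tri_def)
next
  case (Dn i j)
  have "cross P Q \<inter> fedges f = 
     (if ((i+1,j) \<in> P \<and> (i,j+1) \<in> Q) \<or> ((i+1,j) \<in> Q \<and> (i,j+1) \<in> P) then {ED i j} else {}) \<union>
     (if ((i+1,j) \<in> P \<and> (i+1,j+1) \<in> Q) \<or> ((i+1,j) \<in> Q \<and> (i+1,j+1) \<in> P) then {EV (i+1) j} else {}) \<union>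
     (if ((i,j+1) \<in> P \<and> (i+1,j+1) \<in> Q) \<or> ((i,j+1) \<in> Q \<and> (i+1,j+1) \<in> P) then {EH i (j+1)} else {})"
    using assms Dn by (auto simp: cross_def)
  thus ?thesis using assms Dn by (auto simp: tri_def)
qed

lemma face_edge:
  assumes "z \<in> fv t" "z' \<in> fv t" "z \<noteq> z'"
  shows "\<exists>e\<in>fedges t. ends e = {z,z'}"
  using assms by (cases t) (auto simp: doubleton_eq_iff)

lemma face_adj: "z \<in> fv t \<Longrightarrow> z' \<in> fv t \<Longrightarrow> z \<noteq> z' \<Longrightarrow> ladj z z'"
  using face_edge unfolding ladj_def by blast

lemma tri_in_odd_boundary:
  assumes "P \<inter> Q = {}" "finite (cross P Q)" "odd (card {e \<in> cross P Q. boundary M e})"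
  shows "\<exists>f\<in>M. tri P Q f"
proof -
  have "odd (card {f\<in>M. odd (card (cross P Q \<inter> fedges f))})"
    using boundary_parity[OF assms(2)] assms(3) by blast
  hence "{f\<in>M. tri P Q f} \<noteq> {}" unfolding odd_cross[OF assms(1)] by (metis card.empty even_zero)
  thus ?thesis by auto
qed

lemma even_tri:
  assumes "P \<inter> Q = {}" "finite (cross P Q)"
  shows "even (card {f. tri P Q f})"
  using boundary_parity[OF assms(2), of UNIV] odd_cross[OF assms(1)] by (simp add: boundary_def)

lemma finite_tri:
  assumes "P \<inter> Q = {}" "finite (cross P Q)"
  shows "finite {f. tri P Q f}"
proof -
  have "{f. tri P Q f} \<subseteq> fup ` cross P Q \<union> fdn ` cross P Q"
  proof
    fix f assume "f \<in> {f. tri P Q f}"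
    hence "odd (card (cross P Q \<inter> fedges f))" using odd_cross[OF assms(1)] by simp
    hence "cross P Q \<inter> fedges f \<noteq> {}" by auto
    thus "f \<in> fup ` cross P Q \<union> fdn ` cross P Q" by (auto simp: fedges_iff)
  qed
  thus ?thesis using assms(2) by (auto intro: finite_subset)
qed

text \<open>A closed walk through \<open>P\<close>, \<open>Q\<close> and \<open>R\<close> passes
  between \<open>P\<close> and \<open>Q\<close> just once. Filled on the side away from
  \<open>C\<close>, it has odd boundary in \<open>cross P Q\<close> and so contains a face of the
  required kind.\<close>

lemma tri_exists_avoiding:
  assumes conn: "conn ladj P" "conn ladj Q" "conn ladj R" "conn ladj C"
    and disj: "P \<inter> Q = {}" "P \<inter> R = {}" "Q \<inter> R = {}" "C \<inter> (P \<union> Q \<union> R) = {}"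
    and touching_parts: "touch ladj P Q" "touch ladj Q R" "touch ladj R P"
    and fin: "finite (cross P Q)"
  shows "\<exists>f. tri P Q f \<and> fv f \<inter> C = {}"
proof -
  obtain a b e1 where e1: "a \<in> P" "b \<in> Q" "ends e1 = {a,b}" using touching_parts(1) by (auto simp: touch_def ladj_def)
  obtain b' c e2 where e2: "b' \<in> Q" "c \<in> R" "ends e2 = {b',c}" using touching_parts(2) by (auto simp: touch_def ladj_def)
  obtain c' a' e3 where e3: "c' \<in> R" "a' \<in> P" "ends e3 = {c',a'}" using touching_parts(3) by (auto simp: touch_def ladj_def)
  obtain p where p: "finite p" "\<And>e. e\<in>p \<Longrightarrow> ends e \<subseteq> P" "\<And>v. odd (deg_in p v) \<longleftrightarrow> (v = a) \<noteq> (v = a')"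
    using path_edges[of P a a'] conn(1) e1 e3 by (auto simp: conn_def)
  obtain q where q: "finite q" "\<And>e. e\<in>q \<Longrightarrow> ends e \<subseteq> Q" "\<And>v. odd (deg_in q v) \<longleftrightarrow> (v = b) \<noteq> (v = b')"
    using path_edges[of Q b b'] conn(2) e1 e2 by (auto simp: conn_def)
  obtain r where r: "finite r" "\<And>e. e\<in>r \<Longrightarrow> ends e \<subseteq> R" "\<And>v. odd (deg_in r v) \<longleftrightarrow> (v = c) \<noteq> (v = c')"
    using path_edges[of R c c'] conn(3) e2 e3 by (auto simp: conn_def)
  \<comment> \<open>Three inner paths and three linking edges add up to a cycle whose only edge
    between \<open>P\<close> and \<open>Q\<close> is \<open>e1\<close>.\<close>
  define k where "k = sdiff (sdiff (sdiff p q) r) (sdiff (sdiff {e1} {e2}) {e3})"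
  have fk: "finite k" using p q r by (simp add: k_def)
  have ev: "even (deg_in k v)" for v
    using p(1) q(1) r(1) e1 e2 e3 disj p(3)[of v] q(3)[of v] r(3)[of v]
      odd_dg_single[of e1 v] odd_dg_single[of e2 v] odd_dg_single[of e3 v]
    unfolding k_def by (auto simp: odd_dg_sdiff)
  have sub: "ends e \<subseteq> P \<union> Q \<union> R" if "e \<in> k" for e
    using that p(2)[of e] q(2)[of e] r(2)[of e] e1 e2 e3 unfolding k_def sdiff_def by auto
  have ne: "ends e \<noteq> {}" for e by (cases e) auto
  have pq: "{e \<in> cross P Q. e \<in> k} = {e1}"
  proof -
    have x1: "e1 \<in> cross P Q" using e1 by (auto simp: cross_def)
    have x2: "e2 \<notin> cross P Q" "e3 \<notin> cross P Q" using e2 e3 disj by (auto simp: cross_def)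
    have x3: "e \<notin> cross P Q" if "e \<in> p \<union> q \<union> r" for e
      using that p(2)[of e] q(2)[of e] r(2)[of e] disj by (auto simp: cross_def)
    have "e1 \<noteq> e2" "e1 \<noteq> e3" "e1 \<notin> p \<union> q \<union> r" using x1 x2 x3 by auto
    hence "e1 \<in> k" unfolding k_def sdiff_def by auto
    moreover have "e = e1" if "e \<in> k" "e \<in> cross P Q" for e
      using that x2 x3 unfolding k_def sdiff_def by auto
    ultimately show ?thesis using x1 by blast
  qed
  have "ends e \<inter> C = {}" if "e \<in> k" for e using sub[OF that] disj(4) by auto
  from fill_avoiding[OF fk ev conn(4) this]
  obtain S where S: "\<And>e. boundary S e \<longleftrightarrow> e \<in> k" "\<And>f. f\<in>S \<Longrightarrow> fv f \<inter> C = {}" by auto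
  have "odd (card {e \<in> cross P Q. boundary S e})" using pq S(1) by simp
  from tri_in_odd_boundary[OF disj(1) fin this] S(2) show ?thesis by blast
qed

text \<open>Cycles inside \<open>P \<union> Q\<close> through \<open>e1\<close>, \<open>e2\<close>
  and through \<open>e1\<close>, \<open>e3\<close> can be filled with faces inside
  \<open>P \<union> Q\<close>, none of which satisfies \<open>tri\<close>. Yet the two fillings
  intersect in a set with just one boundary edge in \<open>cross P Q\<close>, an odd number, which
  forces such a face.\<close>

lemma at_most_two_tri:
  assumes conn: "conn ladj P" "conn ladj Q" "conn ladj (- (P \<union> Q))"
    and disj: "P \<inter> Q = {}" and fin: "finite (cross P Q)"
    and t: "tri P Q t1" "tri P Q t2" "tri P Q t3"
    and dist: "t1 \<noteq> t2" "t1 \<noteq> t3" "t2 \<noteq> t3"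
  shows False
proof -
  have ex: "\<exists>e a b. e \<in> fedges t \<and> a \<in> P \<and> b \<in> Q \<and> ends e = {a,b}" if "tri P Q t" for t
  proof -
    obtain a b where "a \<in> fv t" "a \<in> P" "b \<in> fv t" "b \<in> Q" using \<open>tri P Q t\<close> by (auto simp: tri_def)
    thus ?thesis using face_edge[of a t b] disj by blast
  qed
  text \<open>Close up the two crossing edges to a cycle by paths inside P and inside Q, and fill that cycle.\<close>
  have fill: "\<exists>S. (\<forall>e\<in>cross P Q. boundary S e \<longleftrightarrow> e = e1 \<or> e = e2) \<and> (\<forall>f\<in>S. fv f \<subseteq> P \<union> Q)"
    if e1: "a1 \<in> P" "b1 \<in> Q" "ends e1 = {a1,b1}" and e2: "a2 \<in> P" "b2 \<in> Q" "ends e2 = {a2,b2}" and ne: "e1 \<noteq> e2"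
    for e1 e2 a1 a2 b1 b2
  proof -
    obtain p where p: "finite p" "\<And>e. e\<in>p \<Longrightarrow> ends e \<subseteq> P" "\<And>v. odd (deg_in p v) \<longleftrightarrow> (v = a1) \<noteq> (v = a2)"
      using path_edges[of P a1 a2] conn(1) e1 e2 by (auto simp: conn_def)
    obtain q where q: "finite q" "\<And>e. e\<in>q \<Longrightarrow> ends e \<subseteq> Q" "\<And>v. odd (deg_in q v) \<longleftrightarrow> (v = b1) \<noteq> (v = b2)"
      using path_edges[of Q b1 b2] conn(2) e1 e2 by (auto simp: conn_def)
    define k where "k = sdiff (sdiff p q) (sdiff {e1} {e2})"
    have fk: "finite k" using p q by (simp add: k_def)
    have ev: "even (deg_in k v)" for v
      using p(1) q(1) e1 e2 disj p(3)[of v] q(3)[of v]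
        odd_dg_single[of e1 v] odd_dg_single[of e2 v]
      unfolding k_def by (auto simp: odd_dg_sdiff)
    have sub: "ends e \<inter> - (P \<union> Q) = {}" if "e \<in> k" for e
      using that p(2)[of e] q(2)[of e] e1 e2 unfolding k_def sdiff_def by auto
    from fill_avoiding[OF fk ev conn(3) sub]
    obtain S where S: "\<And>e. boundary S e \<longleftrightarrow> e \<in> k" "\<And>f. f\<in>S \<Longrightarrow> fv f \<subseteq> P \<union> Q" by auto
    have "e \<in> k \<longleftrightarrow> e = e1 \<or> e = e2" if "e \<in> cross P Q" for e
    proof -
      have "e \<notin> p" "e \<notin> q" using that p(2)[of e] q(2)[of e] disj by (auto simp: cross_def)
      thus ?thesis using ne by (auto simp: k_def sdiff_def)
    qed
    thus ?thesis using S by blast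
  qed
  obtain e1 a1 b1 where e1: "e1 \<in> fedges t1" "a1 \<in> P" "b1 \<in> Q" "ends e1 = {a1,b1}" using ex[OF t(1)] by blast
  obtain e2 a2 b2 where e2: "e2 \<in> fedges t2" "a2 \<in> P" "b2 \<in> Q" "ends e2 = {a2,b2}" using ex[OF t(2)] by blast
  obtain e3 a3 b3 where e3: "e3 \<in> fedges t3" "a3 \<in> P" "b3 \<in> Q" "ends e3 = {a3,b3}" using ex[OF t(3)] by blast
  have cr: "e1 \<in> cross P Q" "e2 \<in> cross P Q" "e3 \<in> cross P Q" using e1 e2 e3 by (auto simp: cross_def)
  have out: "t \<notin> S" if "tri P Q t" "\<forall>f\<in>S. fv f \<subseteq> P \<union> Q" for t S using that by (auto simp: tri_def)
  \<comment> \<open>Different triangles get different crossing edges. If \<open>s\<close> and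
    \<open>s'\<close> shared \<open>e\<close>, they would be its two sides; the filled cycle through
    \<open>e\<close> and \<open>e''\<close> has \<open>e\<close> on its boundary and would contain
    one of them.\<close>
  have other: "e \<noteq> e'" if "e \<in> fedges s" "e' \<in> fedges s'" "s \<noteq> s'" "s'' \<noteq> s" "s'' \<noteq> s'" 
      "e'' \<in> fedges s''" "a \<in> P" "b \<in> Q" "ends e = {a,b}" "a'' \<in> P" "b'' \<in> Q" "ends e'' = {a'',b''}" 
      "tri P Q s" "tri P Q s'" for e e' s s' s'' e'' a b a'' b''
  proof
    assume eq: "e = e'"
    hence ss: "{s, s'} = {fup e, fdn e}" using that(1-3) by (auto simp: fedges_iff)
    have "e \<noteq> e''" using that(4-6) ss by (auto simp: fedges_iff)
    from fill[OF that(7,8,9,10,11,12) this]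
    obtain S where S: "\<forall>x\<in>cross P Q. boundary S x \<longleftrightarrow> x = e \<or> x = e''" and S2: "\<forall>f\<in>S. fv f \<subseteq> P \<union> Q"
      by (elim exE conjE) 
    have "e \<in> cross P Q" using that(7-9) by (auto simp: cross_def)
    hence "boundary S e" using S by blast
    thus False using out[OF that(13) S2] out[OF that(14) S2] ss by (auto simp: boundary_def doubleton_eq_iff)
  qed
  have ne1: "e1 \<noteq> e2"
    by (rule other[OF e1(1) e2(1) dist(1) dist(2)[symmetric] dist(3)[symmetric] e3(1) e1(2-4) e3(2-4) t(1,2)])
  have ne2: "e1 \<noteq> e3"
    by (rule other[OF e1(1) e3(1) dist(2) dist(1)[symmetric] dist(3) e2(1) e1(2-4) e2(2-4) t(1,3)])
  have ne3: "e2 \<noteq> e3"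
    by (rule other[OF e2(1) e3(1) dist(3) dist(1) dist(2) e1(1) e2(2-4) e1(2-4) t(2,3)])
  note ne = ne1 ne2 ne3
  obtain S where S: "\<And>e. e\<in>cross P Q \<Longrightarrow> boundary S e \<longleftrightarrow> e = e1 \<or> e = e2" "\<forall>f\<in>S. fv f \<subseteq> P \<union> Q"
    using fill[OF e1(2-4) e2(2-4) ne(1)] by blast
  obtain S' where S': "\<And>e. e\<in>cross P Q \<Longrightarrow> boundary S' e \<longleftrightarrow> e = e1 \<or> e = e3" "\<forall>f\<in>S'. fv f \<subseteq> P \<union> Q"
    using fill[OF e1(2-4) e3(2-4) ne(2)] by blast
  have f1: "fup e1 = t1 \<or> fdn e1 = t1" and f2: "fup e2 = t2 \<or> fdn e2 = t2" and f3: "fup e3 = t3 \<or> fdn e3 = t3"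
    using e1 e2 e3 by (auto simp: fedges_iff)
  have o: "t1 \<notin> S" "t2 \<notin> S" "t3 \<notin> S" "t1 \<notin> S'" "t2 \<notin> S'" "t3 \<notin> S'" using out t S S' by blast+
  \<comment> \<open>The side of \<open>e1\<close> other than \<open>t1\<close> lies in both
    fillings. \<open>e2\<close> bounds \<open>S\<close> only and \<open>t2\<close> is outside
    \<open>S'\<close>, so both its sides miss \<open>S'\<close>; likewise for \<open>e3\<close> with
    the fillings exchanged.\<close>
  have "boundary (S \<inter> S') e \<longleftrightarrow> e = e1" if "e \<in> cross P Q" for e
  proof -
    have "boundary (S \<inter> S') e1" using S(1)[OF cr(1)] S'(1)[OF cr(1)] f1 o by (auto simp: boundary_def)
    moreover have "\<not> boundary (S \<inter> S') e2" using S'(1)[OF cr(2)] ne f2 o by (auto simp: boundary_def)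
    moreover have "\<not> boundary (S \<inter> S') e3" using S(1)[OF cr(3)] ne f3 o by (auto simp: boundary_def)
    moreover have "\<not> boundary (S \<inter> S') e" if "e \<noteq> e1" "e \<noteq> e2" "e \<noteq> e3" 
      using S(1)[OF \<open>e \<in> cross P Q\<close>] S'(1)[OF \<open>e \<in> cross P Q\<close>] that by (auto simp: boundary_def)
    ultimately show ?thesis by blast
  qed
  hence "{e \<in> cross P Q. boundary (S \<inter> S') e} = {e1}" using cr by auto
  hence "odd (card {e \<in> cross P Q. boundary (S \<inter> S') e})" by simp
  from tri_in_odd_boundary[OF disj fin this] S(2) out show False by blast
qed

section \<open>Track layout of a universal Apollonian network\<close>

type_synonym pt = "nat \<times> real"

text \<open>A component of the network is an outerplane triangulation grown by ears; a point is its level and its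
  position within that level, and the ends of an edge differ by one or two levels.  A block is a place where it still
  has to grow: to the right of a point (\<open>Arm\<close>), between the ends of an edge (\<open>Gap\<close>), or to the right of
  both ends (\<open>Out\<close>).  The block owns the positions in the interval \<open>(s,t)\<close>, and its triangles have their keys
  in \<open>(p,q)\<close>; keys order the triangles from left to right.\<close>

datatype blk = Arm pt real real real real
  | Gap pt pt real real real real
  | Out pt pt real real real real

text \<open>The level that completes two levels at distance one or two to three consecutive
  ones.\<close>

definition ear :: "nat \<Rightarrow> nat \<Rightarrow> nat" where
  "ear i j = (if max i j = min i j + 1 then min i j + 2 else min i j + 1)"

fun new_pt :: "blk \<Rightarrow> pt" where
  "new_pt (Arm v s t p q) = (fst v + 1, (2 * s+t)/3)"
| "new_pt (Gap a b s t p q) = (ear (fst a) (fst b), (s+t)/2)"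
| "new_pt (Out u v s t p q) = (ear (fst u) (fst v), (s+t)/2)"

text \<open>Positions and keys of an arm are cut into thirds in the same order; the new point sits
  at the first cut.\<close>

fun arm_gap arm_arm arm_out where
  "arm_gap (Arm v s t p q) = Gap v (new_pt (Arm v s t p q)) s ((2 * s+t)/3) p ((2*p+q)/3)"
| "arm_arm (Arm v s t p q) = Arm (new_pt (Arm v s t p q)) ((2 * s+t)/3) ((s+2*t)/3) ((2*p+q)/3) ((p+2*q)/3)"
| "arm_out (Arm v s t p q) = Out v (new_pt (Arm v s t p q)) ((s+2*t)/3) t ((p+2*q)/3) q"

text \<open>Two thirds of the keys go to the smaller gaps and one to the triangle itself. If
  \<open>a\<close> is two levels above \<open>b\<close>, the left gap can hold points on the level
  of \<open>a\<close> and right of \<open>a\<close>, so the triangle must come first; symmetrically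
  it comes last if \<open>b\<close> is two levels above \<open>a\<close>, and in the middle
  otherwise.\<close>

fun gap_left gap_right where
  "gap_left (Gap a b s t p q) = Gap a (new_pt (Gap a b s t p q)) s ((s+t)/2)
     (if fst a = fst b + 2 then (2*p+q)/3 else p) (if fst a = fst b + 2 then (p+2*q)/3 else (2*p+q)/3)"
| "gap_right (Gap a b s t p q) = Gap (new_pt (Gap a b s t p q)) b ((s+t)/2) t
     (if fst b = fst a + 2 then (2*p+q)/3 else (p+2*q)/3) (if fst b = fst a + 2 then (p+2*q)/3 else q)"

text \<open>A fan around the lower end \<open>u\<close>: the block moves on from \<open>v\<close> to
  the new point and leaves a gap behind. The keys follow the same rule as for gaps.\<close>

fun out_gap out_out where
  "out_gap (Out u v s t p q) = Gap v (new_pt (Out u v s t p q)) s ((s+t)/2)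
     (if fst v = fst u + 2 then (2*p+q)/3 else p) (if fst v = fst u + 2 then (p+2*q)/3 else (2*p+q)/3)"
| "out_out (Out u v s t p q) = Out u (new_pt (Out u v s t p q)) ((s+t)/2) t ((p+2*q)/3) q"

text \<open>The midpoint of the third that the smaller blocks leave free. An arm owns no triangle,
  so its \<open>0\<close> is a dummy.\<close>

fun key :: "blk \<Rightarrow> real" where
  "key (Gap a b s t p q) = (if fst a = fst b + 2 then (5*p+q)/6 else if fst b = fst a + 2 then (p+5*q)/6 else (p+q)/2)"
| "key (Out u v s t p q) = (if fst v = fst u + 2 then (5*p+q)/6 else (p+q)/2)"
| "key (Arm v s t p q) = 0"

fun corners :: "blk \<Rightarrow> pt set" where
  "corners (Arm v s t p q) = {v}" | "corners (Gap a b s t p q) = {a,b}" | "corners (Out u v s t p q) = {u,v}"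

fun lmin :: "blk \<Rightarrow> nat" where
  "lmin (Arm v s t p q) = fst v" | "lmin (Gap a b s t p q) = min (fst a) (fst b)" | "lmin (Out u v s t p q) = fst u"

fun xlo xhi klo khi where
  "xlo (Arm v s t p q) = s" | "xlo (Gap a b s t p q) = s" | "xlo (Out u v s t p q) = s"
| "xhi (Arm v s t p q) = t" | "xhi (Gap a b s t p q) = t" | "xhi (Out u v s t p q) = t"
| "klo (Arm v s t p q) = p" | "klo (Gap a b s t p q) = p" | "klo (Out u v s t p q) = p"
| "khi (Arm v s t p q) = q" | "khi (Gap a b s t p q) = q" | "khi (Out u v s t p q) = q"

fun valid :: "blk \<Rightarrow> bool" where
  "valid (Arm v s t p q) \<longleftrightarrow> snd v \<le> s \<and> s < t \<and> p < q"
| "valid (Gap a b s t p q) \<longleftrightarrow> snd a \<le> s \<and> s < t \<and> t \<le> snd b \<and> p < q \<and> 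
     fst a \<noteq> fst b \<and> fst a \<le> fst b + 2 \<and> fst b \<le> fst a + 2"
| "valid (Out u v s t p q) \<longleftrightarrow> snd u \<le> snd v \<and> snd v \<le> s \<and> s < t \<and> p < q \<and> fst u < fst v \<and> fst v \<le> fst u + 2"

inductive tr :: "blk \<Rightarrow> real \<Rightarrow> pt set \<Rightarrow> bool" where
  tr_gap: "B = Gap a b s t p q \<Longrightarrow> tr B (key B) {a, new_pt B, b}"
| tr_out: "B = Out u v s t p q \<Longrightarrow> tr B (key B) {u, v, new_pt B}"
| tr_arm_gap: "B = Arm v s t p q \<Longrightarrow> tr (arm_gap B) k T \<Longrightarrow> tr B k T"
| tr_arm_arm: "B = Arm v s t p q \<Longrightarrow> tr (arm_arm B) k T \<Longrightarrow> tr B k T"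
| tr_arm_out: "B = Arm v s t p q \<Longrightarrow> tr (arm_out B) k T \<Longrightarrow> tr B k T"
| tr_gap_left: "B = Gap a b s t p q \<Longrightarrow> tr (gap_left B) k T \<Longrightarrow> tr B k T"
| tr_gap_right: "B = Gap a b s t p q \<Longrightarrow> tr (gap_right B) k T \<Longrightarrow> tr B k T"
| tr_out_gap: "B = Out u v s t p q \<Longrightarrow> tr (out_gap B) k T \<Longrightarrow> tr B k T"
| tr_out_out: "B = Out u v s t p q \<Longrightarrow> tr (out_out B) k T \<Longrightarrow> tr B k T"

lemma valid_sub:
  "valid (Arm v s t p q) \<Longrightarrow> valid (arm_gap (Arm v s t p q))"
  "valid (Arm v s t p q) \<Longrightarrow> valid (arm_arm (Arm v s t p q))"
  "valid (Arm v s t p q) \<Longrightarrow> valid (arm_out (Arm v s t p q))"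
  "valid (Gap a b s t p q) \<Longrightarrow> valid (gap_left (Gap a b s t p q))"
  "valid (Gap a b s t p q) \<Longrightarrow> valid (gap_right (Gap a b s t p q))"
  "valid (Out a b s t p q) \<Longrightarrow> valid (out_gap (Out a b s t p q))"
  "valid (Out a b s t p q) \<Longrightarrow> valid (out_out (Out a b s t p q))"
  by (auto simp: ear_def max_def min_def split: if_splits)

text \<open>Inner points lie strictly above the lowest corner. That corner may be shared by several
  blocks and is thus never compared with inner points.\<close>

definition inblk :: "blk \<Rightarrow> pt \<Rightarrow> bool" where
  "inblk B x \<longleftrightarrow> x \<in> corners B \<or> (xlo B < snd x \<and> snd x < xhi B \<and> lmin B < fst x)"

lemma inblk_sub:
  "valid (Arm v s t p q) \<Longrightarrow> inblk (arm_gap (Arm v s t p q)) x \<Longrightarrow> inblk (Arm v s t p q) x"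
  "valid (Arm v s t p q) \<Longrightarrow> inblk (arm_arm (Arm v s t p q)) x \<Longrightarrow> inblk (Arm v s t p q) x"
  "valid (Arm v s t p q) \<Longrightarrow> inblk (arm_out (Arm v s t p q)) x \<Longrightarrow> inblk (Arm v s t p q) x"
  "valid (Gap a b s t p q) \<Longrightarrow> inblk (gap_left (Gap a b s t p q)) x \<Longrightarrow> inblk (Gap a b s t p q) x"
  "valid (Gap a b s t p q) \<Longrightarrow> inblk (gap_right (Gap a b s t p q)) x \<Longrightarrow> inblk (Gap a b s t p q) x"
  "valid (Out a b s t p q) \<Longrightarrow> inblk (out_gap (Out a b s t p q)) x \<Longrightarrow> inblk (Out a b s t p q) x"
  "valid (Out a b s t p q) \<Longrightarrow> inblk (out_out (Out a b s t p q)) x \<Longrightarrow> inblk (Out a b s t p q) x"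
  by (auto simp: inblk_def ear_def max_def min_def split: if_splits)

lemma key_sub:
  "valid (Arm v s t p q) \<Longrightarrow> klo (Arm v s t p q) \<le> klo (arm_gap (Arm v s t p q)) \<and> khi (arm_gap (Arm v s t p q)) \<le> khi (Arm v s t p q)"
  "valid (Arm v s t p q) \<Longrightarrow> klo (Arm v s t p q) \<le> klo (arm_arm (Arm v s t p q)) \<and> khi (arm_arm (Arm v s t p q)) \<le> khi (Arm v s t p q)"
  "valid (Arm v s t p q) \<Longrightarrow> klo (Arm v s t p q) \<le> klo (arm_out (Arm v s t p q)) \<and> khi (arm_out (Arm v s t p q)) \<le> khi (Arm v s t p q)"
  "valid (Gap a b s t p q) \<Longrightarrow> klo (Gap a b s t p q) \<le> klo (gap_left (Gap a b s t p q)) \<and> khi (gap_left (Gap a b s t p q)) \<le> khi (Gap a b s t p q)"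
  "valid (Gap a b s t p q) \<Longrightarrow> klo (Gap a b s t p q) \<le> klo (gap_right (Gap a b s t p q)) \<and> khi (gap_right (Gap a b s t p q)) \<le> khi (Gap a b s t p q)"
  "valid (Out a b s t p q) \<Longrightarrow> klo (Out a b s t p q) \<le> klo (out_gap (Out a b s t p q)) \<and> khi (out_gap (Out a b s t p q)) \<le> khi (Out a b s t p q)"
  "valid (Out a b s t p q) \<Longrightarrow> klo (Out a b s t p q) \<le> klo (out_out (Out a b s t p q)) \<and> khi (out_out (Out a b s t p q)) \<le> khi (Out a b s t p q)"
  by simp_all

lemma tr_bound:
  assumes "tr B k T" "valid B"
  shows "klo B < k \<and> k < khi B \<and> (\<forall>x\<in>T. inblk B x)"
  using assms
proof (induction rule: tr.induct)
  case (tr_gap B a b s t p q)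
  thus ?case by (auto simp: inblk_def ear_def max_def min_def split: if_splits)
next
  case (tr_out B u v s t p q)
  thus ?case by (auto simp: inblk_def ear_def max_def min_def split: if_splits)
next
  case (tr_arm_gap B v s t p q k T)
  show ?case using tr_arm_gap.IH tr_arm_gap.prems valid_sub(1)[of v s t p q] inblk_sub(1)[of v s t p q] key_sub(1)[of v s t p q]
    unfolding tr_arm_gap.hyps(1) by (meson le_less_trans less_le_trans)
next
  case (tr_arm_arm B v s t p q k T)
  show ?case using tr_arm_arm.IH tr_arm_arm.prems valid_sub(2)[of v s t p q] inblk_sub(2)[of v s t p q] key_sub(2)[of v s t p q]
    unfolding tr_arm_arm.hyps(1) by (meson le_less_trans less_le_trans)
next
  case (tr_arm_out B v s t p q k T)
  show ?case using tr_arm_out.IH tr_arm_out.prems valid_sub(3)[of v s t p q] inblk_sub(3)[of v s t p q] key_sub(3)[of v s t p q]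
    unfolding tr_arm_out.hyps(1) by (meson le_less_trans less_le_trans)
next
  case (tr_gap_left B a b s t p q k T)
  show ?case using tr_gap_left.IH tr_gap_left.prems valid_sub(4)[of a b s t p q] inblk_sub(4)[of a b s t p q] key_sub(4)[of a b s t p q]
    unfolding tr_gap_left.hyps(1) by (meson le_less_trans less_le_trans)
next
  case (tr_gap_right B a b s t p q k T)
  show ?case using tr_gap_right.IH tr_gap_right.prems valid_sub(5)[of a b s t p q] inblk_sub(5)[of a b s t p q] key_sub(5)[of a b s t p q]
    unfolding tr_gap_right.hyps(1) by (meson le_less_trans less_le_trans)
next
  case (tr_out_gap B u v s t p q k T)
  show ?case using tr_out_gap.IH tr_out_gap.prems valid_sub(6)[of u v s t p q] inblk_sub(6)[of u v s t p q] key_sub(6)[of u v s t p q]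
    unfolding tr_out_gap.hyps(1) by (meson le_less_trans less_le_trans)
next
  case (tr_out_out B u v s t p q k T)
  show ?case using tr_out_out.IH tr_out_out.prems valid_sub(7)[of u v s t p q] inblk_sub(7)[of u v s t p q] key_sub(7)[of u v s t p q]
    unfolding tr_out_out.hyps(1) by (meson le_less_trans less_le_trans)
qed

lemma tr_levels:
  assumes "tr B k T" "valid B"
  shows "inj_on fst T \<and> (\<exists>i. fst ` T = {i, i+1, i+2})"
  using assms
proof (induction rule: tr.induct)
  case (tr_gap B a b s t p q)
  hence "fst b = fst a + 1 \<or> fst b = fst a + 2 \<or> fst a = fst b + 1 \<or> fst a = fst b + 2" by auto
  thus ?case using tr_gap by (auto simp: ear_def)
next
  case (tr_out B u v s t p q)
  hence "fst v = fst u + 1 \<or> fst v = fst u + 2" by auto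
  thus ?case using tr_out by (auto simp: ear_def)
qed (use valid_sub in metis)+

definition nice :: "pt set \<Rightarrow> pt set \<Rightarrow> bool" where
  "nice T T' \<longleftrightarrow> (\<forall>x\<in>T. \<forall>y\<in>T'. fst x = fst y \<longrightarrow> snd x \<le> snd y)"

text \<open>Keys order the triangles of a component from left to right, monotonically on every
  common level; this excludes crossings inside a component.\<close>

definition ordered :: "real \<Rightarrow> pt set \<Rightarrow> real \<Rightarrow> pt set \<Rightarrow> bool" where
  "ordered k T k' T' \<longleftrightarrow> (k < k' \<longrightarrow> nice T T') \<and> (k' < k \<longrightarrow> nice T' T) \<and> (k = k' \<longrightarrow> T = T')"

lemma ordered_commute: "ordered k T k' T' \<longleftrightarrow> ordered k' T' k T"
  by (auto simp: ordered_def)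

lemma inblk_subs:
  "inblk (arm_gap (Arm v s t p q)) x \<longleftrightarrow> x = v \<or> x = new_pt (Arm v s t p q) \<or> s < snd x \<and> snd x < (2 * s+t)/3 \<and> fst v < fst x"
  "inblk (arm_arm (Arm v s t p q)) x \<longleftrightarrow> x = new_pt (Arm v s t p q) \<or> (2 * s+t)/3 < snd x \<and> snd x < (s+2*t)/3 \<and> fst v + 1 < fst x"
  "inblk (arm_out (Arm v s t p q)) x \<longleftrightarrow> x = v \<or> x = new_pt (Arm v s t p q) \<or> (s+2*t)/3 < snd x \<and> snd x < t \<and> fst v < fst x"
  "inblk (gap_left (Gap a b s t p q)) x \<longleftrightarrow> x = a \<or> x = new_pt (Gap a b s t p q) \<or> s < snd x \<and> snd x < (s+t)/2 \<and> min (fst a) (ear (fst a) (fst b)) < fst x"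
  "inblk (gap_right (Gap a b s t p q)) x \<longleftrightarrow> x = new_pt (Gap a b s t p q) \<or> x = b \<or> (s+t)/2 < snd x \<and> snd x < t \<and> min (ear (fst a) (fst b)) (fst b) < fst x"
  "inblk (out_gap (Out a b s t p q)) x \<longleftrightarrow> x = b \<or> x = new_pt (Out a b s t p q) \<or> s < snd x \<and> snd x < (s+t)/2 \<and> min (fst b) (ear (fst a) (fst b)) < fst x"
  "inblk (out_out (Out a b s t p q)) x \<longleftrightarrow> x = a \<or> x = new_pt (Out a b s t p q) \<or> (s+t)/2 < snd x \<and> snd x < t \<and> fst a < fst x"
  by (auto simp: inblk_def min_def)

section \<open>Left-to-right order of triangles in sibling blocks and in the block itself\<close>

context
  fixes v s t p q B assumes B: "B = Arm v s t p q" "valid B"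
begin
text \<open>Siblings own disjoint ranges of keys and of positions in the same order; shared corners
  are harmless by the level bound in \<open>inblk\<close>.\<close>

lemma arm_ga: assumes "tr (arm_gap B) k T" "tr (arm_arm B) k' T'" shows "ordered k T k' T'"
proof -
  note b = tr_bound[OF assms(1)] tr_bound[OF assms(2)]
  have 1: "k < k'" using b valid_sub(1,2)[of v s t p q] B by auto
  have i: "inblk (arm_gap B) x" if "x \<in> T" for x using b(1) valid_sub(1)[of v s t p q] B that by auto
  have j: "inblk (arm_arm B) x" if "x \<in> T'" for x using b(2) valid_sub(2)[of v s t p q] B that by auto
  have "nice T T'" unfolding nice_def
  proof (intro ballI impI)
    fix x y assume "x \<in> T" "y \<in> T'" "fst x = fst y"
    thus "snd x \<le> snd y" using i[of x] j[of y] B unfolding B(1) inblk_subs by auto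
  qed
  thus ?thesis using 1 by (simp add: ordered_def)
qed
lemma arm_ao: assumes "tr (arm_arm B) k T" "tr (arm_out B) k' T'" shows "ordered k T k' T'"
proof -
  note b = tr_bound[OF assms(1)] tr_bound[OF assms(2)]
  have 1: "k < k'" using b valid_sub(2,3)[of v s t p q] B by auto
  have i: "inblk (arm_arm B) x" if "x \<in> T" for x using b(1) valid_sub(2)[of v s t p q] B that by auto
  have j: "inblk (arm_out B) x" if "x \<in> T'" for x using b(2) valid_sub(3)[of v s t p q] B that by auto
  have "nice T T'" unfolding nice_def
  proof (intro ballI impI)
    fix x y assume "x \<in> T" "y \<in> T'" "fst x = fst y"
    thus "snd x \<le> snd y" using i[of x] j[of y] B unfolding B(1) inblk_subs by auto
  qed
  thus ?thesis using 1 by (simp add: ordered_def)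
qed
lemma arm_go: assumes "tr (arm_gap B) k T" "tr (arm_out B) k' T'" shows "ordered k T k' T'"
proof -
  note b = tr_bound[OF assms(1)] tr_bound[OF assms(2)]
  have 1: "k < k'" using b valid_sub(1,3)[of v s t p q] B by auto
  have i: "inblk (arm_gap B) x" if "x \<in> T" for x using b(1) valid_sub(1)[of v s t p q] B that by auto
  have j: "inblk (arm_out B) x" if "x \<in> T'" for x using b(2) valid_sub(3)[of v s t p q] B that by auto
  have "nice T T'" unfolding nice_def
  proof (intro ballI impI)
    fix x y assume "x \<in> T" "y \<in> T'" "fst x = fst y"
    thus "snd x \<le> snd y" using i[of x] j[of y] B unfolding B(1) inblk_subs by auto
  qed
  thus ?thesis using 1 by (simp add: ordered_def)
qed
end

context
  fixes a b s t p q B assumes B: "B = Gap a b s t p q" "valid B"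
begin
lemma gap_cases: "fst b = fst a + 1 \<or> fst b = fst a + 2 \<or> fst a = fst b + 1 \<or> fst a = fst b + 2"
  using B by auto
lemma gap_lr: assumes "tr (gap_left B) k T" "tr (gap_right B) k' T'" shows "ordered k T k' T'"
proof -
  note b = tr_bound[OF assms(1)] tr_bound[OF assms(2)]
  have 1: "k < k'" using b valid_sub(4,5)[of a b s t p q] B by (auto split: if_splits)
  have i: "inblk (gap_left B) x" if "x \<in> T" for x using b(1) valid_sub(4)[of a b s t p q] B that by auto
  have j: "inblk (gap_right B) x" if "x \<in> T'" for x using b(2) valid_sub(5)[of a b s t p q] B that by auto
  have "nice T T'" unfolding nice_def
  proof (intro ballI impI)
    fix x y assume "x \<in> T" "y \<in> T'" "fst x = fst y"
    thus "snd x \<le> snd y" using i[of x] j[of y] B unfolding B(1) inblk_subs by auto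
  qed
  thus ?thesis using 1 by (simp add: ordered_def)
qed
text \<open>The case split mirrors the choice of the key: if \<open>a\<close> is two levels up,
  inner points on its level are right of it; otherwise inner points can only meet the levels of
  corners to their right.\<close>

lemma gap_l: assumes "tr (gap_left B) k T" shows "ordered k T (key B) {a, new_pt B, b}"
proof -
  note b = tr_bound[OF assms(1)]
  have 1: "if fst a = fst b + 2 then key B < k else k < key B"
    using b valid_sub(4)[of a b s t p q] B by (auto split: if_splits)
  have i: "inblk (gap_left B) x" if "x \<in> T" for x using b(1) valid_sub(4)[of a b s t p q] B that by auto
  have n: "if fst a = fst b + 2 then snd x \<le> snd y else snd y \<le> snd x" if "x \<in> {a, new_pt B, b}" "y \<in> T" "fst x = fst y" for x y
    using that gap_cases i[OF that(2)] B unfolding B(1) inblk_subs by (elim disjE) (auto simp: ear_def)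
  show ?thesis using 1 n by (auto simp: ordered_def nice_def split: if_splits)
qed
lemma gap_r: assumes "tr (gap_right B) k T" shows "ordered k T (key B) {a, new_pt B, b}"
proof -
  note b = tr_bound[OF assms(1)]
  have 1: "if fst b = fst a + 2 then k < key B else key B < k"
    using b valid_sub(5)[of a b s t p q] B by (auto split: if_splits)
  have i: "inblk (gap_right B) x" if "x \<in> T" for x using b(1) valid_sub(5)[of a b s t p q] B that by auto
  have n: "if fst b = fst a + 2 then snd y \<le> snd x else snd x \<le> snd y" if "x \<in> {a, new_pt B, b}" "y \<in> T" "fst x = fst y" for x y
    using that gap_cases i[OF that(2)] B unfolding B(1) inblk_subs by (elim disjE) (auto simp: ear_def)
  show ?thesis using 1 n by (auto simp: ordered_def nice_def split: if_splits)
qed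
end

context
  fixes u v s t p q B assumes B: "B = Out u v s t p q" "valid B"
begin
lemma out_cases: "fst v = fst u + 1 \<or> fst v = fst u + 2"
  using B by auto
lemma out_go: assumes "tr (out_gap B) k T" "tr (out_out B) k' T'" shows "ordered k T k' T'"
proof -
  note b = tr_bound[OF assms(1)] tr_bound[OF assms(2)]
  have 1: "k < k'" using b valid_sub(6,7)[of u v s t p q] B by (auto split: if_splits)
  have i: "inblk (out_gap B) x" if "x \<in> T" for x using b(1) valid_sub(6)[of u v s t p q] B that by auto
  have j: "inblk (out_out B) x" if "x \<in> T'" for x using b(2) valid_sub(7)[of u v s t p q] B that by auto
  have "nice T T'" unfolding nice_def
  proof (intro ballI impI)
    fix x y assume "x \<in> T" "y \<in> T'" "fst x = fst y"
    thus "snd x \<le> snd y" using out_cases i[of x] j[of y] B unfolding B(1) inblk_subs by (elim disjE) (auto simp: ear_def)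
  qed
  thus ?thesis using 1 by (simp add: ordered_def)
qed
lemma out_g: assumes "tr (out_gap B) k T" shows "ordered k T (key B) {u, v, new_pt B}"
proof -
  note b = tr_bound[OF assms(1)]
  have 1: "if fst v = fst u + 2 then key B < k else k < key B"
    using b valid_sub(6)[of u v s t p q] B by (auto split: if_splits)
  have i: "inblk (out_gap B) x" if "x \<in> T" for x using b(1) valid_sub(6)[of u v s t p q] B that by auto
  have n: "if fst v = fst u + 2 then snd x \<le> snd y else snd y \<le> snd x" if "x \<in> {u, v, new_pt B}" "y \<in> T" "fst x = fst y" for x y
    using that out_cases i[OF that(2)] B unfolding B(1) inblk_subs by (elim disjE) (auto simp: ear_def)
  show ?thesis using 1 n by (auto simp: ordered_def nice_def split: if_splits)
qed
lemma out_o: assumes "tr (out_out B) k T" shows "ordered k T (key B) {u, v, new_pt B}"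
proof -
  note b = tr_bound[OF assms(1)]
  have 1: "key B < k"
    using b valid_sub(7)[of u v s t p q] B by (auto split: if_splits)
  have i: "inblk (out_out B) x" if "x \<in> T" for x using b(1) valid_sub(7)[of u v s t p q] B that by auto
  have n: "snd x \<le> snd y" if "x \<in> {u, v, new_pt B}" "y \<in> T" "fst x = fst y" for x y
    using that out_cases i[OF that(2)] B unfolding B(1) inblk_subs by (elim disjE) (auto simp: ear_def)
  show ?thesis using 1 n by (auto simp: ordered_def nice_def)
qed
end

lemmas sub_simps = new_pt.simps arm_gap.simps arm_arm.simps arm_out.simps gap_left.simps gap_right.simps out_gap.simps out_out.simps key.simps

lemma tr_Arm_iff: 
  assumes "B = Arm v s t p q"
  shows "tr B k T \<longleftrightarrow> tr (arm_gap B) k T \<or> tr (arm_arm B) k T \<or> tr (arm_out B) k T" (is "?L = ?R")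
proof
  assume ?L thus ?R by (cases rule: tr.cases) (use assms in \<open>simp_all del: sub_simps\<close>)
next
  assume ?R thus ?L using tr_arm_gap[OF assms] tr_arm_arm[OF assms] tr_arm_out[OF assms] by blast
qed

lemma tr_Gap_iff:
  assumes "B = Gap a b s t p q"
  shows "tr B k T \<longleftrightarrow> (k = key B \<and> T = {a, new_pt B, b}) \<or> tr (gap_left B) k T \<or> tr (gap_right B) k T" (is "?L = ?R")
proof
  assume ?L thus ?R by (cases rule: tr.cases) (use assms in \<open>simp_all del: sub_simps\<close>)
next
  assume ?R thus ?L using tr_gap[OF assms] tr_gap_left[OF assms] tr_gap_right[OF assms] by blast
qed

lemma tr_Out_iff:
  assumes "B = Out u v s t p q"
  shows "tr B k T \<longleftrightarrow> (k = key B \<and> T = {u, v, new_pt B}) \<or> tr (out_gap B) k T \<or> tr (out_out B) k T" (is "?L = ?R")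
proof
  assume ?L thus ?R by (cases rule: tr.cases) (use assms in \<open>simp_all del: sub_simps\<close>)
next
  assume ?R thus ?L using tr_out[OF assms] tr_out_gap[OF assms] tr_out_out[OF assms] by blast
qed

lemma mod_eq_ex: "x mod n = y mod n \<Longrightarrow> y \<le> x \<Longrightarrow> \<exists>q. x = y + n * q" for x y n :: nat
  by (metis dvd_def le_add_diff_inverse mod_eq_dvd_iff_nat)

lemma ordered_refl: "ordered k T k T" by (simp add: ordered_def)

lemma tr_ordered:
  assumes "tr B k T" "valid B" "tr B k' T'"
  shows "ordered k T k' T'"
  using assms
proof (induction arbitrary: k' T' rule: tr.induct)
  case (tr_gap B a b s t p q)
  thus ?case using tr_Gap_iff[OF tr_gap(1), of k' T'] gap_l[OF tr_gap(1,2)] gap_r[OF tr_gap(1,2)] ordered_commute ordered_refl by blast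
next
  case (tr_out B u v s t p q)
  thus ?case using tr_Out_iff[OF tr_out(1), of k' T'] out_g[OF tr_out(1,2)] out_o[OF tr_out(1,2)] ordered_commute ordered_refl by blast
next
  case (tr_arm_gap B v s t p q k T)
  have "valid (arm_gap B)" using tr_arm_gap valid_sub(1) by blast
  thus ?case using tr_arm_gap tr_Arm_iff[OF tr_arm_gap(1), of k' T'] arm_ga[OF tr_arm_gap(1,4)] arm_go[OF tr_arm_gap(1,4)] by blast
next
  case (tr_arm_arm B v s t p q k T)
  have "valid (arm_arm B)" using tr_arm_arm valid_sub(2) by blast
  thus ?case using tr_arm_arm tr_Arm_iff[OF tr_arm_arm(1), of k' T'] arm_ga[OF tr_arm_arm(1,4)] arm_ao[OF tr_arm_arm(1,4)] ordered_commute by blast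
next
  case (tr_arm_out B v s t p q k T)
  have "valid (arm_out B)" using tr_arm_out valid_sub(3) by blast
  thus ?case using tr_arm_out tr_Arm_iff[OF tr_arm_out(1), of k' T'] arm_go[OF tr_arm_out(1,4)] arm_ao[OF tr_arm_out(1,4)] ordered_commute by blast
next
  case (tr_gap_left B a b s t p q k T)
  have "valid (gap_left B)" using tr_gap_left valid_sub(4) by blast
  thus ?case using tr_gap_left tr_Gap_iff[OF tr_gap_left(1), of k' T'] gap_l[OF tr_gap_left(1,4)] gap_lr[OF tr_gap_left(1,4)] by blast
next
  case (tr_gap_right B a b s t p q k T)
  have "valid (gap_right B)" using tr_gap_right valid_sub(5) by blast
  thus ?case using tr_gap_right tr_Gap_iff[OF tr_gap_right(1), of k' T'] gap_r[OF tr_gap_right(1,4)] gap_lr[OF tr_gap_right(1,4)] ordered_commute by blast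
next
  case (tr_out_gap B u v s t p q k T)
  have "valid (out_gap B)" using tr_out_gap valid_sub(6) by blast
  thus ?case using tr_out_gap tr_Out_iff[OF tr_out_gap(1), of k' T'] out_g[OF tr_out_gap(1,4)] out_go[OF tr_out_gap(1,4)] by blast
next
  case (tr_out_out B u v s t p q k T)
  have "valid (out_out B)" using tr_out_out valid_sub(7) by blast
  thus ?case using tr_out_out tr_Out_iff[OF tr_out_out(1), of k' T'] out_o[OF tr_out_out(1,4)] out_go[OF tr_out_out(1,4)] ordered_commute by blast
qed

text \<open>The root \<open>(0,0)\<close> of a component carries one arm per unit interval, so arms
  never interleave. A region with index \<open>k < 3\<close> uses arm \<open>k\<close>.\<close>

definition arm0 :: "nat \<Rightarrow> blk" where
  "arm0 k = Arm (0,0) (real k) (real k + 1) (real k) (real k + 1)"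

definition tr0 :: "real \<Rightarrow> pt set \<Rightarrow> bool" where
  "tr0 k T \<longleftrightarrow> (\<exists>n. tr (arm0 n) k T)"

lemma valid_arm0: "valid (arm0 n)" by (simp add: arm0_def)

lemma tr0_levels: "tr0 k T \<Longrightarrow> inj_on fst T \<and> (\<exists>i. fst ` T = {i, i+1, i+2})"
  using tr_levels valid_arm0 by (auto simp: tr0_def)

lemma tr0_ordered:
  assumes "tr0 k T" "tr0 k' T'" shows "ordered k T k' T'"
proof -
  obtain n n' where n: "tr (arm0 n) k T" "tr (arm0 n') k' T'" using assms by (auto simp: tr0_def)
  have lt: "ordered k T k' T'" if n: "tr (arm0 n) k T" "tr (arm0 n') k' T'" and less: "n < n'" for n n' k k' T T'
  proof -
    note b = tr_bound[OF n(1) valid_arm0] tr_bound[OF n(2) valid_arm0]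
    have r: "real n + 1 \<le> real n'" using less by linarith
    have "k < k'" using b r by (auto simp: arm0_def)
    moreover have "nice T T'" unfolding nice_def
    proof (intro ballI impI)
      fix x y assume "x \<in> T" "y \<in> T'" "fst x = fst y"
      hence "inblk (arm0 n) x" "inblk (arm0 n') y" using b by auto
      thus "snd x \<le> snd y" using \<open>fst x = fst y\<close> r by (auto simp: inblk_def arm0_def)
    qed
    ultimately show ?thesis by (simp add: ordered_def)
  qed
  consider "n < n'" | "n = n'" | "n' < n" by linarith
  thus ?thesis
    by cases (use n lt[of n k T n' k' T'] lt[of n' k' T' n k T] tr_ordered[OF n(1) valid_arm0] ordered_commute in blast)+
qed

text \<open>A node of the network is a component, given by the windows and keys of the nested triangles
  that lead to it, together with a point of the component.\<close>

type_synonym att = "(nat \<times> real) list \<times> pt"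

section \<open>Components, their types, and the order on the nodes of the network\<close>

definition base :: "pt set \<Rightarrow> nat" where "base T = Min (fst ` T)"

text \<open>Every node of a component counts as adjacent to all corners of the surrounding triangle.
  This is more than a planar network allows, but the layout copes with it. The window precedes the
  key because children are sorted by window first.\<close>

definition par :: "(nat \<times> real) list \<Rightarrow> att \<Rightarrow> bool" where
  "par c q \<longleftrightarrow> (\<exists>k T. c = (base T div 3, k) # fst q \<and> tr0 k T \<and> snd q \<in> T)"

definition hadj :: "att \<Rightarrow> att \<Rightarrow> bool" where
  "hadj n q \<longleftrightarrow> (fst n = fst q \<and> snd n \<noteq> snd q \<and> (\<exists>k T. tr0 k T \<and> snd n \<in> T \<and> snd q \<in> T)) \<or> par (fst n) q"

text \<open>The step 1 or 2 encodes the parity of the window. Modulo 5 these steps differ from their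
  negatives, so the types of the ends of an edge tell which end is the parent.\<close>

fun tau :: "(nat \<times> real) list \<Rightarrow> nat" where
  "tau [] = 0"
| "tau (p # c) = (tau c + 1 + fst p mod 2) mod 5"

text \<open>The newest triangle heads the list, so ancestors are compared first: shorter lists
  precede longer ones, and equal lengths are compared lexicographically from the root.\<close>

fun comp_less :: "(nat \<times> real) list \<Rightarrow> (nat \<times> real) list \<Rightarrow> bool" where
  "comp_less _ [] \<longleftrightarrow> False"
| "comp_less [] (_ # _) \<longleftrightarrow> True"
| "comp_less (p # c) (p' # c') \<longleftrightarrow> comp_less c c' \<or> (c = c' \<and> (fst p < fst p' \<or> (fst p = fst p' \<and> snd p < snd p')))"

definition att_less :: "att \<Rightarrow> att \<Rightarrow> bool" where
  "att_less x y \<longleftrightarrow> comp_less (fst x) (fst y) \<or> (fst x = fst y \<and> (fst (snd x) < fst (snd y) \<or> (fst (snd x) = fst (snd y) \<and> snd (snd x) < snd (snd y))))"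

lemma clt_irrefl: "\<not> comp_less c c"
  by (induction c) auto

lemma clt_trans: "comp_less a b \<Longrightarrow> comp_less b c \<Longrightarrow> comp_less a c"
proof (induction a b arbitrary: c rule: comp_less.induct)
  case (2 p b c) thus ?case by (cases c) auto
next
  case (3 p a p' b c) thus ?case by (cases c) auto
qed auto

lemma clt_total: "comp_less a b \<or> a = b \<or> comp_less b a"
proof (induction a b rule: comp_less.induct)
  case (1 a) thus ?case by (cases a) auto
next
  case (3 p c p' c') thus ?case by (cases p; cases p') auto
qed auto

lemma alt_irrefl: "\<not> att_less x x" by (simp add: att_less_def clt_irrefl)

lemma alt_trans: "att_less x y \<Longrightarrow> att_less y z \<Longrightarrow> att_less x z"
  unfolding att_less_def using clt_trans[of "fst x" "fst y" "fst z"] by auto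

lemma alt_total: "att_less x y \<or> x = y \<or> att_less y x"
  unfolding att_less_def using clt_total[of "fst x" "fst y"] by (cases x; cases y) auto

definition trk :: "att \<Rightarrow> nat \<times> nat" where
  "trk x = (tau (fst x), fst (snd x) mod 5)"

definition hedge :: "att \<Rightarrow> att \<Rightarrow> bool" where "hedge x y \<longleftrightarrow> hadj x y \<or> hadj y x"

lemma tau_less: "tau c < 5" by (cases c) auto

lemma hedge_cases:
  assumes "hedge u v"
  obtains (same) k T where "fst u = fst v" "snd u \<noteq> snd v" "tr0 k T" "snd u \<in> T" "snd v \<in> T"
    | (dn) "par (fst v) u" | (up) "par (fst u) v"
  using assms unfolding hedge_def hadj_def by fastforce

lemma par_tau: "par c q \<Longrightarrow> (tau c + 5 - tau (fst q)) mod 5 \<in> {1,2}"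
proof -
  assume "par c q"
  then obtain p where c: "c = p # fst q" by (auto simp: par_def)
  have "p1 mod 2 < 2 \<Longrightarrow> t < 5 \<Longrightarrow> ((t + 1 + p1 mod 2) mod 5 + 5 - t) mod 5 = 1 + p1 mod 2" for p1 t :: nat
  proof -
    assume h: "p1 mod 2 < 2" "t < 5"
    have "t \<in> {0,1,2,3,4}" "p1 mod 2 \<in> {0,1}" using h by auto
    thus ?thesis by (elim insertE) auto
  qed
  from this[of "fst p" "tau (fst q)"] tau_less[of "fst q"] c show ?thesis by auto
qed

lemma tau_diff: "t < 5 \<Longrightarrow> t' < 5 \<Longrightarrow> (t + 5 - t') mod 5 \<in> {1,2} \<Longrightarrow> (t' + 5 - t) mod 5 \<notin> {1,2::nat} \<and> t \<noteq> t'"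
proof -
  assume h: "t < 5" "t' < 5" "(t + 5 - t') mod 5 \<in> {1,2}"
  have "t \<in> {0,1,2,3,4}" "t' \<in> {0,1,2,3,4}" using h by auto
  thus ?thesis using h(3) by (elim insertE) auto
qed

lemma same_levels:
  assumes "tr0 k T" "x \<in> T" "y \<in> T" "x \<noteq> y"
  shows "fst x \<noteq> fst y" "fst x \<le> fst y + 2" "fst y \<le> fst x + 2"
proof -
  obtain i where i: "inj_on fst T" "fst ` T = {i,i+1,i+2}" using tr0_levels[OF assms(1)] by blast
  show "fst x \<noteq> fst y" using i(1) assms by (auto dest: inj_onD)
  have "fst x \<in> {i,i+1,i+2}" "fst y \<in> {i,i+1,i+2}" using i(2) assms by blast+
  thus "fst x \<le> fst y + 2" "fst y \<le> fst x + 2" by auto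
qed

lemma hedge_trk: assumes "hedge u v" shows "trk u \<noteq> trk v"
  using assms
proof (cases rule: hedge_cases)
  case (same k T)
  have "a mod 5 \<noteq> b mod 5" if h: "a \<noteq> b" "a \<le> b + 2" "b \<le> a + 2" for a b :: nat
  proof
    assume m: "a mod 5 = b mod 5"
    show False
    proof (cases "a \<le> b")
      case True
      then obtain k where "b = a + 5 * k" using mod_eq_ex[of b 5 a] m by auto
      thus False using h by presburger
    next
      case False
      then obtain k where "a = b + 5 * k" using mod_eq_ex[of a 5 b] m by auto
      thus False using h by presburger
    qed
  qed
  thus ?thesis using same_levels[OF same(3-5,2)] by (simp add: trk_def)
next
  case dn thus ?thesis using par_tau[OF dn] tau_diff[of "tau (fst v)" "tau (fst u)"] tau_less by (auto simp: trk_def)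
next
  case up thus ?thesis using par_tau[OF up] tau_diff[of "tau (fst u)" "tau (fst v)"] tau_less by (auto simp: trk_def)
qed

lemma base_bounds:
  assumes "tr0 k T" "x \<in> T" shows "base T \<le> fst x" "fst x \<le> base T + 2"
proof -
  obtain i where i: "fst ` T = {i,i+1,i+2}" using tr0_levels[OF assms(1)] by blast
  have "base T = i" unfolding base_def i by simp
  moreover have "fst x \<in> {i,i+1,i+2}" using i assms by blast
  ultimately show "base T \<le> fst x" "fst x \<le> base T + 2" by auto
qed

text \<open>Bases \<open>3m\<close>, \<open>3m+1\<close>, \<open>3m+2\<close> reach only the levels
  \<open>3m\<close> to \<open>3m+4\<close>.\<close>

lemma same_window:
  fixes a b c d :: nat
  assumes h: "a mod 5 = b mod 5" "c \<le> a" "a \<le> c + 2" "d \<le> b" "b \<le> d + 2" "d div 3 = c div 3"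
  shows "a = b"
proof -
  have cd: "c \<le> d + 2" "d \<le> c + 2" using h(6) by linarith+
  show "a = b"
  proof (cases "a \<le> b")
    case True
    then obtain k where "b = a + 5 * k" using mod_eq_ex[of b 5 a] h by auto
    thus ?thesis using h(2-5) cd by presburger
  next
    case False
    then obtain k where "a = b + 5 * k" using mod_eq_ex[of a 5 b] h by auto
    thus ?thesis using h(2-5) cd by presburger
  qed
qed

text \<open>Two triangles whose bases lie in the same window of three levels only meet levels
  that are distinct mod 5; windows of equal parity are far apart.\<close>

lemma no_par_crossing:
  assumes p: "par (fst v) u" "par (fst y) x" and t: "trk u = trk x" "trk v = trk y"
    and l: "att_less u x" "att_less y v"
  shows False
proof -
  obtain k T where 1: "fst v = (base T div 3, k) # fst u" "tr0 k T" "snd u \<in> T" using p(1) by (auto simp: par_def)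
  obtain k' T' where 2: "fst y = (base T' div 3, k') # fst x" "tr0 k' T'" "snd x \<in> T'" using p(2) by (auto simp: par_def)
  \<comment> \<open>\<open>y\<close> before \<open>v\<close> orders the child components, hence
    their parents, one way; \<open>u\<close> before \<open>x\<close> orders these parents the other
    way.\<close>
  have cx: "fst u = fst x"
    using l clt_total[of "fst u" "fst x"] clt_trans[of "fst u" "fst x" "fst u"] clt_irrefl[of "fst u"]
    unfolding att_less_def 1 2 by auto
  let ?m = "base T div 3" and ?m' = "base T' div 3"
  have mm: "?m' < ?m \<or> (?m' = ?m \<and> k' \<le> k)" using l(2) unfolding att_less_def 1 2 cx by (auto simp: clt_irrefl)
  have par: "?m mod 2 = ?m' mod 2"
  proof -
    have "(tau (fst x) + 1 + ?m mod 2) mod 5 = (tau (fst x) + 1 + ?m' mod 2) mod 5"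
      using t(2) unfolding trk_def 1 2 cx by simp
    moreover have "tau (fst x) \<in> {0,1,2,3,4}" using tau_less[of "fst x"] by auto
    moreover have "?m mod 2 \<in> {0,1}" "?m' mod 2 \<in> {0,1}" by auto
    ultimately show ?thesis by (elim insertE) auto
  qed
  have l5: "fst (snd u) mod 5 = fst (snd x) mod 5" using t(1) by (simp add: trk_def)
  have ux: "fst (snd u) < fst (snd x) \<or> (fst (snd u) = fst (snd x) \<and> snd (snd u) < snd (snd x))"
    using l(1) cx by (simp add: att_less_def clt_irrefl)
  have bu: "base T \<le> fst (snd u)" "fst (snd u) \<le> base T + 2" using base_bounds[OF 1(2,3)] by auto
  have bx: "base T' \<le> fst (snd x)" "fst (snd x) \<le> base T' + 2" using base_bounds[OF 2(2,3)] by auto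
  from mm show False
  proof
    assume "?m' < ?m"
    moreover have "b < a \<Longrightarrow> a mod 2 = b mod 2 \<Longrightarrow> b + 2 \<le> a" for a b :: nat by presburger
    ultimately have "?m' + 2 \<le> ?m" using par by blast
    thus False using bu bx ux by linarith
  next
    assume m: "?m' = ?m \<and> k' \<le> k"
    have leq: "fst (snd u) = fst (snd x)" by (rule same_window[OF l5 bu bx m[THEN conjunct1]])
    have lt: "snd (snd u) < snd (snd x)" using ux leq by (metis less_irrefl)
    have o: "ordered k' T' k T" by (rule tr0_ordered[OF 2(2) 1(2)])
    show False
    proof (cases "k' = k")
      case True
      hence "T' = T" using o by (simp add: ordered_def)
      hence "snd u = snd x" using tr0_levels[OF 1(2)] 1(3) 2(3) leq by (auto dest: inj_onD)
      thus False using lt by simp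
    next
      case False
      hence "nice T' T" using o m by (simp add: ordered_def)
      thus False using lt leq 1(3) 2(3) unfolding nice_def by fastforce
    qed
  qed
qed

text \<open>Levels along an edge differ by at most two and the edges are ordered crosswise, so
  congruence modulo 5 forces equal levels. Then one triangle is weakly left of the other on both
  levels, against the crosswise positions.\<close>

lemma no_same_crossing:
  assumes uv: "tr0 k T" "snd u \<in> T" "snd v \<in> T" "snd u \<noteq> snd v" "fst u = fst v"
    and xy: "tr0 k' T'" "snd x \<in> T'" "snd y \<in> T'" "snd x \<noteq> snd y" "fst x = fst y"
    and t: "trk u = trk x" "trk v = trk y" and l: "att_less u x" "att_less y v"
  shows False
proof -
  have c: "fst u = fst x"
    using l uv(5) xy(5) clt_total[of "fst u" "fst x"] clt_trans[of "fst u" "fst x" "fst u"] clt_irrefl[of "fst u"]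
    unfolding att_less_def by auto
  have l1: "fst (snd u) < fst (snd x) \<or> (fst (snd u) = fst (snd x) \<and> snd (snd u) < snd (snd x))"
   and l2: "fst (snd y) < fst (snd v) \<or> (fst (snd y) = fst (snd v) \<and> snd (snd y) < snd (snd v))"
    using l c uv(5) xy(5) by (auto simp: att_less_def clt_irrefl)
  have m: "fst (snd u) mod 5 = fst (snd x) mod 5" "fst (snd v) mod 5 = fst (snd y) mod 5"
    using t by (auto simp: trk_def)
  have arith: "a mod 5 = b mod 5 \<Longrightarrow> c mod 5 = d mod 5 \<Longrightarrow> a \<le> c + 2 \<Longrightarrow> c \<le> a + 2 \<Longrightarrow> b \<le> d + 2 \<Longrightarrow> d \<le> b + 2 \<Longrightarrow> a \<le> b \<Longrightarrow> d \<le> c \<Longrightarrow> a = b \<and> c = d" for a b c d :: nat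
  proof -
    fix a b c d :: nat
    assume h: "a mod 5 = b mod 5" "c mod 5 = d mod 5" "a \<le> c + 2" "c \<le> a + 2" "b \<le> d + 2" "d \<le> b + 2" "a \<le> b" "d \<le> c"
    obtain k where "b = a + 5 * k" using mod_eq_ex[of b 5 a] h by auto
    moreover obtain j where "c = d + 5 * j" using mod_eq_ex[of c 5 d] h by auto
    ultimately show "a = b \<and> c = d" using h(3-8) by presburger
  qed
  have eq: "fst (snd u) = fst (snd x)" "fst (snd v) = fst (snd y)"
    using arith[OF m same_levels(2,3)[OF uv(1-4)] same_levels(2,3)[OF xy(1-4)]] l1 l2 by auto
  hence lt: "snd (snd u) < snd (snd x)" "snd (snd y) < snd (snd v)" using l1 l2 by auto
  have "ordered k T k' T'" by (rule tr0_ordered[OF uv(1) xy(1)])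
  moreover have "T = T' \<Longrightarrow> False"
    using tr0_levels[OF uv(1)] uv xy eq lt by (auto dest: inj_onD)
  ultimately have "nice T T' \<or> nice T' T" unfolding ordered_def by fastforce
  thus False using uv xy eq lt unfolding nice_def by fastforce
qed

text \<open>The types of the two tracks tell whether an edge stays in a component, goes down or goes
  up, so both edges are of one kind. Edges going up are reduced to edges going down by exchanging
  roles.\<close>

theorem network_no_crossing:
  assumes e: "hedge u v" "hedge x y" and t: "trk u = trk x" "trk v = trk y" and l: "att_less u x" "att_less y v"
  shows False
proof -
  have dt: "fst u = fst v \<Longrightarrow> (tau (fst v) + 5 - tau (fst u)) mod 5 = 0" for u v :: att by simp
  have T: "tau (fst u) = tau (fst x)" "tau (fst v) = tau (fst y)" using t by (auto simp: trk_def)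
  have nn: "\<not> (par (fst v) u \<and> par (fst x) y)" "\<not> (par (fst u) v \<and> par (fst y) x)"
    using par_tau[of "fst v" u] par_tau[of "fst x" y] par_tau[of "fst u" v] par_tau[of "fst y" x] T
      tau_diff[of "tau (fst v)" "tau (fst u)"] tau_diff[of "tau (fst u)" "tau (fst v)"] tau_less by metis+
  have ns: "fst u = fst v \<Longrightarrow> \<not> par (fst y) x \<and> \<not> par (fst x) y" "fst x = fst y \<Longrightarrow> \<not> par (fst v) u \<and> \<not> par (fst u) v"
    using par_tau[of "fst v" u] par_tau[of "fst x" y] par_tau[of "fst u" v] par_tau[of "fst y" x] T by auto
  show False
    using e(1)
  proof (cases rule: hedge_cases)
    case (same k T)
    note a = same
    from e(2) show False
    proof (cases rule: hedge_cases)
      case (same k' T') thus False using no_same_crossing[of k T u v k' T' x y] a t l by auto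
    qed (use ns a in auto)
  next
    case dn
    note a = dn
    from e(2) show False
    proof (cases rule: hedge_cases)
      case dn thus False using no_par_crossing[of v u y x] a t l by auto
    qed (use ns nn a in auto)
  next
    case up
    note a = up
    from e(2) show False
    proof (cases rule: hedge_cases)
      case up thus False using no_par_crossing[of x y u v] a t l by auto
    qed (use ns nn a in auto)
  qed
qed

section \<open>Regions of the network\<close>

text \<open>A region of the network is bounded by three corners (some possibly absent).  All corners lie in
  the parent component for \<open>Tri\<close>; otherwise some of them lie in the component that is being filled:
  corner \<open>i\<close> for an arm, and corners \<open>a\<close> and \<open>b\<close> for the other two kinds of block.\<close>

datatype reg = Tri "nat \<Rightarrow> att option" "(nat \<times> real) list"
  | Blk "nat \<Rightarrow> att option" "(nat \<times> real) list" blk nat nat nat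

fun region_corner :: "reg \<Rightarrow> nat \<Rightarrow> att option" where
  "region_corner (Tri K c) = K" | "region_corner (Blk K c B i a b) = K"

fun region_node :: "reg \<Rightarrow> att" where
  "region_node (Tri K c) = (c, (0,0))" | "region_node (Blk K c B i a b) = (c, new_pt B)"

text \<open>The new node replaces corner \<open>k\<close>, and the replaced corner decides where the
  component grows. Replacing the inner end of an arm continues the arm; replacing one of its parent
  corners leads to a gap or an outer block. Once the last parent corner is replaced, the corners
  form a triangle and a new component starts inside it.\<close>

fun subregion :: "nat \<Rightarrow> reg \<Rightarrow> reg" where
  "subregion k (Tri K c) = Blk (K(k := Some (region_node (Tri K c)))) c (arm0 k) k ((k+1) mod 3) ((k+2) mod 3)"
| "subregion k (Blk K c B i a b) = (let K' = K(k := Some (c, new_pt B)) in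
     case B of
       Arm v s t p q \<Rightarrow> if k = i then Blk K' c (arm_arm B) i a b
                        else if k = a then Blk K' c (arm_gap B) b i a
                        else Blk K' c (arm_out B) a i b
     | Gap l r s t p q \<Rightarrow> if k = i then Tri K' ((base {l, new_pt B, r} div 3, key B) # c)
                        else if k = a then Blk K' c (gap_right B) i a b
                        else Blk K' c (gap_left B) i a b
     | Out u v s t p q \<Rightarrow> if k = i then Tri K' ((base {u, v, new_pt B} div 3, key B) # c)
                        else if k = a then Blk K' c (out_gap B) i b a
                        else Blk K' c (out_out B) i a b)"

definition parent_ok :: "(nat \<times> real) list \<Rightarrow> att option \<Rightarrow> bool" where
  "parent_ok c o' \<longleftrightarrow> (\<forall>q. o' = Some q \<longrightarrow> par c q)"

lemma pokD: "parent_ok c o' \<Longrightarrow> o' = Some q \<Longrightarrow> par c q" by (simp add: parent_ok_def)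

definition embedded :: "blk \<Rightarrow> bool" where
  "embedded B \<longleftrightarrow> (\<forall>k T. tr B k T \<longrightarrow> tr0 k T)"

lemma embedded_arm0: "embedded (arm0 k)" by (auto simp: embedded_def tr0_def)

lemma embedded_Arm:
  assumes "embedded B" "B = Arm v s t p q"
  shows "embedded (arm_gap B)" "embedded (arm_arm B)" "embedded (arm_out B)"
  using assms(1) tr_Arm_iff[OF assms(2)] unfolding embedded_def by blast+

lemma embedded_Gap:
  assumes "embedded B" "B = Gap a b s t p q"
  shows "embedded (gap_left B)" "embedded (gap_right B)" "tr0 (key B) {a, new_pt B, b}"
  using assms(1) tr_Gap_iff[OF assms(2)] unfolding embedded_def by blast+

lemma embedded_Out:
  assumes "embedded B" "B = Out u v s t p q"
  shows "embedded (out_gap B)" "embedded (out_out B)" "tr0 (key B) {u, v, new_pt B}"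
  using assms(1) tr_Out_iff[OF assms(2)] unfolding embedded_def by blast+

lemma par_triangle: "tr0 k T \<Longrightarrow> x \<in> T \<Longrightarrow> par ((base T div 3, k) # c) (c, x)"
  by (auto simp: par_def)

text \<open>\<open>None\<close> is possible only for parent corners, where it stands for a missing
  corner; corners inside the component are always present.\<close>

fun region_inv :: "reg \<Rightarrow> bool" where
  "region_inv (Tri K c) \<longleftrightarrow> (\<forall>k<3. parent_ok c (K k))"
| "region_inv (Blk K c B i a b) \<longleftrightarrow> valid B \<and> embedded B \<and> {i,a,b} = {0,1,2} \<and>
     (case B of Arm v s t p q \<Rightarrow> K i = Some (c, v) \<and> parent_ok c (K a) \<and> parent_ok c (K b)
      | Gap l r s t p q \<Rightarrow> K a = Some (c, l) \<and> K b = Some (c, r) \<and> parent_ok c (K i)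
      | Out u v s t p q \<Rightarrow> K a = Some (c, u) \<and> K b = Some (c, v) \<and> parent_ok c (K i))"

lemma gcor_sub: "region_corner (subregion k g) = (region_corner g)(k := Some (region_node g))"
  by (cases g) (auto simp: Let_def split: blk.splits)

lemma perm3:
  assumes "{i,a,b} = {0,1,2::nat}"
  shows "i \<noteq> a" "i \<noteq> b" "a \<noteq> b" "i < 3" "a < 3" "b < 3" "k < 3 \<Longrightarrow> k = i \<or> k = a \<or> k = b"
proof -
  have c: "card {i,a,b} = 3" using assms by simp
  thus "i \<noteq> a" "i \<noteq> b" "a \<noteq> b" by (auto simp: card_insert_if split: if_splits)
  have "i \<in> {0,1,2}" "a \<in> {0,1,2}" "b \<in> {0,1,2}" using assms by blast+
  thus "i < 3" "a < 3" "b < 3" by auto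
  assume "k < 3"
  hence "k \<in> {0,1,2}" by auto
  thus "k = i \<or> k = a \<or> k = b" using assms by blast
qed

lemma gsub_Arm:
  assumes "B = Arm v s t p q" "i \<noteq> a" "i \<noteq> b" "a \<noteq> b"
  shows "subregion i (Blk K c B i a b) = Blk (K(i := Some (c, new_pt B))) c (arm_arm B) i a b"
    "subregion a (Blk K c B i a b) = Blk (K(a := Some (c, new_pt B))) c (arm_gap B) b i a"
    "subregion b (Blk K c B i a b) = Blk (K(b := Some (c, new_pt B))) c (arm_out B) a i b"
  using assms by (simp_all add: Let_def)

lemma gsub_Gap:
  assumes "B = Gap l r s t p q" "i \<noteq> a" "i \<noteq> b" "a \<noteq> b"
  shows "subregion i (Blk K c B i a b) = Tri (K(i := Some (c, new_pt B))) ((base {l, new_pt B, r} div 3, key B) # c)"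
    "subregion a (Blk K c B i a b) = Blk (K(a := Some (c, new_pt B))) c (gap_right B) i a b"
    "subregion b (Blk K c B i a b) = Blk (K(b := Some (c, new_pt B))) c (gap_left B) i a b"
  using assms by (simp_all add: Let_def)

lemma gsub_Out:
  assumes "B = Out u v s t p q" "i \<noteq> a" "i \<noteq> b" "a \<noteq> b"
  shows "subregion i (Blk K c B i a b) = Tri (K(i := Some (c, new_pt B))) ((base {u, v, new_pt B} div 3, key B) # c)"
    "subregion a (Blk K c B i a b) = Blk (K(a := Some (c, new_pt B))) c (out_gap B) i b a"
    "subregion b (Blk K c B i a b) = Blk (K(b := Some (c, new_pt B))) c (out_out B) i a b"
  using assms by (simp_all add: Let_def)

lemma ginv_Tri: "(\<And>k. k < 3 \<Longrightarrow> parent_ok c (K k)) \<Longrightarrow> region_inv (Tri K c)" by simp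

lemma ginv_sub:
  assumes "region_inv g" "k < 3"
  shows "region_inv (subregion k g)"
proof (cases g)
  case (Tri K c)
  have "k \<in> {0,1,2}" using assms by auto
  hence "{k, (k+1) mod 3, (k+2) mod 3} = {0,1,2}" by (elim insertE) auto
  moreover have "(k+1) mod 3 \<noteq> k" "(k+2) mod 3 \<noteq> k" using assms(2) by presburger+
  moreover note valid_arm0[of k] embedded_arm0[of k]
  ultimately show ?thesis using assms Tri by (simp add: arm0_def)
next
  case (Blk K c B i a b)
  have v: "valid B" "embedded B" "{i,a,b} = {0,1,2}" using assms Blk by auto
  note p = perm3[OF v(3)]
  have perms: "{b,i,a} = {0,1,2}" "{a,i,b} = {0,1,2}" "{i,b,a} = {0,1,2}"
    using v(3) by (metis insert_commute)+
  have k: "k = i \<or> k = a \<or> k = b" by (rule p(7)[OF assms(2)])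
  show ?thesis
  proof (cases B)
    case (Arm v s t p q)
    have K: "K i = Some (c, v)" "parent_ok c (K a)" "parent_ok c (K b)" using assms Blk Arm by auto
    note e = embedded_Arm[OF v(2) Arm] and vs = valid_sub(1-3)[of v s t p q] and gs = gsub_Arm[OF Arm p(1-3)]
    have "region_inv (subregion i g)" "region_inv (subregion a g)" "region_inv (subregion b g)"
      using e vs K p(1-3) v(1,3) perms unfolding Blk gs Arm by (simp_all del: valid.simps)
    thus ?thesis using k by blast
  next
    case (Gap l r s t p q)
    have K: "K a = Some (c, l)" "K b = Some (c, r)" "parent_ok c (K i)" using assms Blk Gap by auto
    note e = embedded_Gap[OF v(2) Gap] and vs = valid_sub(4,5)[of l r s t p q] and gs = gsub_Gap[OF Gap p(1-3)]
    have "region_inv (subregion a g)" "region_inv (subregion b g)"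
      using e(1,2) vs K p(1-3) v(1,3) perms unfolding Blk gs Gap by (simp_all del: valid.simps)
    \<comment> \<open>The last parent corner is gone: all three corners belong to one triangle and
      are parents of the new component.\<close>
    moreover have "region_inv (subregion i g)" unfolding Blk gs
    proof (rule ginv_Tri)
      fix j :: nat assume "j < 3"
      hence "j = i \<or> j = a \<or> j = b" by (rule p(7))
      thus "parent_ok ((base {l, new_pt B, r} div 3, key B) # c) ((K(i := Some (c, new_pt B))) j)"
        by (elim disjE) (use p(1-3) K par_triangle[OF e(3), of _ c] in \<open>simp_all add: parent_ok_def\<close>)
    qed
    ultimately show ?thesis using k by blast
  next
    case (Out l r s t p q)
    have K: "K a = Some (c, l)" "K b = Some (c, r)" "parent_ok c (K i)" using assms Blk Out by auto
    note e = embedded_Out[OF v(2) Out] and vs = valid_sub(6,7)[of l r s t p q] and gs = gsub_Out[OF Out p(1-3)]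
    have "region_inv (subregion a g)" "region_inv (subregion b g)"
      using e(1,2) vs K p(1-3) v(1,3) perms unfolding Blk gs Out by (simp_all del: valid.simps)
    moreover have "region_inv (subregion i g)" unfolding Blk gs
    proof (rule ginv_Tri)
      fix j :: nat assume "j < 3"
      hence "j = i \<or> j = a \<or> j = b" by (rule p(7))
      thus "parent_ok ((base {l, r, new_pt B} div 3, key B) # c) ((K(i := Some (c, new_pt B))) j)"
        by (elim disjE) (use p(1-3) K par_triangle[OF e(3), of _ c] in \<open>simp_all add: parent_ok_def\<close>)
    qed
    ultimately show ?thesis using k by blast
  qed
qed

lemma hadj_triangle: "tr0 k T \<Longrightarrow> x \<in> T \<Longrightarrow> y \<in> T \<Longrightarrow> x \<noteq> y \<Longrightarrow> hadj (c, x) (c, y)"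
  unfolding hadj_def fst_conv snd_conv by blast

lemma hadj_par: "par (fst n) q \<Longrightarrow> hadj n q"
  unfolding hadj_def by blast

lemma node_hadj:
  assumes "region_inv g" "k < 3" "region_corner g k = Some q"
  shows "hadj (region_node g) q"
proof (cases g)
  case (Tri K c)
  have "parent_ok c (K k)" using assms(1,2) unfolding Tri region_inv.simps by blast
  hence "par c q" by (rule pokD) (use assms(3) Tri in simp)
  thus ?thesis using hadj_par[of "(c,(0,0))" q] Tri by simp
next
  case (Blk K c B i a b)
  have v: "valid B" "embedded B" "{i,a,b} = {0,1,2}" using assms Blk by auto
  have k: "k = i \<or> k = a \<or> k = b" by (rule perm3(7)[OF v(3) assms(2)])
  have q: "K k = Some q" and n: "region_node g = (c, new_pt B)" using assms Blk by auto
  have pk: "hadj (c, new_pt B) q" if "parent_ok c (K k)" by (rule hadj_par) (simp add: pokD[OF that q])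
  have lk: "hadj (c, new_pt B) q" if "K k = Some q'" "hadj (c, new_pt B) q'" for q' using that q by simp
  have "hadj (c, new_pt B) q"
  proof (cases B)
    case (Arm v s t p q')
    have K: "K i = Some (c, v)" "parent_ok c (K a)" "parent_ok c (K b)" using assms Blk Arm by auto
    \<comment> \<open>An arm has no triangle of its own; the triangle of its first gap witnesses the
      edge from \<open>v\<close> to the new point.\<close>
    have g: "arm_gap B = Gap v (new_pt B) s ((2 * s+t)/3) p ((2*p+q')/3)" using Arm by simp
    have "new_pt B \<noteq> v" using Arm by (cases v) simp
    hence "hadj (c, new_pt B) (c, v)"
      using hadj_triangle[OF embedded_Gap(3)[OF embedded_Arm(1)[OF v(2) Arm] g]] by blast
    thus ?thesis using k K pk lk by blast
  next
    case (Gap l r s t p q')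
    have K: "K a = Some (c, l)" "K b = Some (c, r)" "parent_ok c (K i)" using assms Blk Gap by auto
    have "fst (new_pt B) \<noteq> fst l" "fst (new_pt B) \<noteq> fst r" using Gap v(1) by (auto simp: ear_def)
    hence "new_pt B \<noteq> l" "new_pt B \<noteq> r" by blast+
    hence "hadj (c, new_pt B) (c, l)" "hadj (c, new_pt B) (c, r)"
      using hadj_triangle[OF embedded_Gap(3)[OF v(2) Gap]] by blast+
    thus ?thesis using k K pk lk by blast
  next
    case (Out l r s t p q')
    have K: "K a = Some (c, l)" "K b = Some (c, r)" "parent_ok c (K i)" using assms Blk Out by auto
    have "fst (new_pt B) \<noteq> fst l" "fst (new_pt B) \<noteq> fst r" using Out v(1) by (auto simp: ear_def)
    hence "new_pt B \<noteq> l" "new_pt B \<noteq> r" by blast+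
    hence "hadj (c, new_pt B) (c, l)" "hadj (c, new_pt B) (c, r)"
      using hadj_triangle[OF embedded_Out(3)[OF v(2) Out]] by blast+
    thus ?thesis using k K pk lk by blast
  qed
  thus ?thesis using n by simp
qed

section \<open>Territories: the nodes reserved for a region\<close>

definition ext :: "(nat \<times> real) list \<Rightarrow> real \<Rightarrow> real \<Rightarrow> (nat \<times> real) list \<Rightarrow> bool" where
  "ext c p q c' \<longleftrightarrow> (\<exists>r m k. c' = r @ (m, k) # c \<and> p < k \<and> k < q)"

text \<open>All vertices of a region are placed in its territory, so disjoint territories keep
  vertices of sibling regions apart. Components nested in a block are recognised by the key that
  stands just before \<open>c\<close>.\<close>

fun terr :: "reg \<Rightarrow> att \<Rightarrow> bool" where
  "terr (Tri K c) x \<longleftrightarrow> (\<exists>r. fst x = r @ c)"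
| "terr (Blk K c B i a b) x \<longleftrightarrow> (fst x = c \<and> xlo B < snd (snd x) \<and> snd (snd x) < xhi B) \<or> ext c (klo B) (khi B) (fst x)"

lemma ext_mono: "ext c p q c' \<Longrightarrow> p' \<le> p \<Longrightarrow> q \<le> q' \<Longrightarrow> ext c p' q' c'"
  unfolding ext_def by (elim exE conjE, intro exI conjI, assumption) auto

lemma ext_append: "p < k \<Longrightarrow> k < q \<Longrightarrow> ext c p q (r @ (m,k) # c)"
  by (auto simp: ext_def)

lemma ext_irrefl: "\<not> ext c p q c"
  by (auto simp: ext_def)

lemma append_key_eq: 
  assumes "r @ (m,k) # c = r' @ (m',k') # c" shows "k = k'"
proof -
  have "length r = length r'" using arg_cong[OF assms, of length] by simp
  thus ?thesis using assms by simp
qed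

lemma ext_disj:
  assumes "ext c p q c'" "ext c p' q' c'" "q \<le> p' \<or> q' \<le> p" shows False
proof -
  obtain r m k where 1: "c' = r @ (m,k) # c" "p < k" "k < q" using assms(1) by (auto simp: ext_def)
  obtain r' m' k' where 2: "c' = r' @ (m',k') # c" "p' < k'" "k' < q'" using assms(2) by (auto simp: ext_def)
  have "k = k'" using 1(1) 2(1) append_key_eq by metis
  thus False using 1 2 assms(3) by linarith
qed

lemma ext_disj':
  assumes "ext c p q (r @ (m,k) # c)" "k \<le> p \<or> q \<le> k" shows False
proof -
  obtain r' m' k' where 2: "r @ (m,k) # c = r' @ (m',k') # c" "p < k'" "k' < q" using assms(1) by (auto simp: ext_def)
  have "k = k'" by (rule append_key_eq[OF 2(1)])
  thus False using 2 assms(2) by linarith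
qed

lemma node_in_blk: "valid B \<Longrightarrow> xlo B < snd (new_pt B) \<and> snd (new_pt B) < xhi B"
  by (cases B) auto

lemma terr_node: "region_inv g \<Longrightarrow> terr g (region_node g)"
  using node_in_blk by (cases g) auto

lemma sub_x:
  "valid (Arm v s t p q) \<Longrightarrow> xlo (Arm v s t p q) \<le> xlo (arm_gap (Arm v s t p q)) \<and> xhi (arm_gap (Arm v s t p q)) \<le> xhi (Arm v s t p q)"
  "valid (Arm v s t p q) \<Longrightarrow> xlo (Arm v s t p q) \<le> xlo (arm_arm (Arm v s t p q)) \<and> xhi (arm_arm (Arm v s t p q)) \<le> xhi (Arm v s t p q)"
  "valid (Arm v s t p q) \<Longrightarrow> xlo (Arm v s t p q) \<le> xlo (arm_out (Arm v s t p q)) \<and> xhi (arm_out (Arm v s t p q)) \<le> xhi (Arm v s t p q)"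
  "valid (Gap a b s t p q) \<Longrightarrow> xlo (Gap a b s t p q) \<le> xlo (gap_left (Gap a b s t p q)) \<and> xhi (gap_left (Gap a b s t p q)) \<le> xhi (Gap a b s t p q)"
  "valid (Gap a b s t p q) \<Longrightarrow> xlo (Gap a b s t p q) \<le> xlo (gap_right (Gap a b s t p q)) \<and> xhi (gap_right (Gap a b s t p q)) \<le> xhi (Gap a b s t p q)"
  "valid (Out a b s t p q) \<Longrightarrow> xlo (Out a b s t p q) \<le> xlo (out_gap (Out a b s t p q)) \<and> xhi (out_gap (Out a b s t p q)) \<le> xhi (Out a b s t p q)"
  "valid (Out a b s t p q) \<Longrightarrow> xlo (Out a b s t p q) \<le> xlo (out_out (Out a b s t p q)) \<and> xhi (out_out (Out a b s t p q)) \<le> xhi (Out a b s t p q)"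
  by simp_all

lemma terr_mono:
  assumes "terr (Blk K' c B' i' a' b') x" "klo B \<le> klo B' \<and> khi B' \<le> khi B" "xlo B \<le> xlo B' \<and> xhi B' \<le> xhi B"
  shows "terr (Blk K c B i a b) x"
  using assms ext_mono[of c "klo B'" "khi B'" "fst x" "klo B" "khi B"] by auto

definition apart :: "blk \<Rightarrow> blk \<Rightarrow> bool" where
  "apart B B' \<longleftrightarrow> (xhi B \<le> xlo B' \<or> xhi B' \<le> xlo B) \<and> (khi B \<le> klo B' \<or> khi B' \<le> klo B)"

lemma apart_disj:
  assumes "terr (Blk K c B i a b) x" "terr (Blk K' c B' i' a' b') x" "apart B B'"
  shows False
proof -
  consider (a) "fst x = c" "xlo B < snd (snd x)" "snd (snd x) < xhi B" | (b) "ext c (klo B) (khi B) (fst x)" using assms(1) by auto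
  thus False
  proof cases
    case a
    hence "\<not> ext c (klo B') (khi B') (fst x)" using ext_irrefl by simp
    hence "xlo B' < snd (snd x) \<and> snd (snd x) < xhi B'" using assms(2) by simp
    thus False using a assms(3) unfolding apart_def by linarith
  next
    case b
    hence "fst x \<noteq> c" using ext_irrefl by metis
    hence "ext c (klo B') (khi B') (fst x)" using assms(2) by simp
    from ext_disj[OF b this] assms(3) show False unfolding apart_def by blast
  qed
qed

lemma Tri_Blk_disj:
  assumes "terr (Tri K ((m,k) # c)) x" "terr (Blk K' c B' i' a' b') x" "k \<le> klo B' \<or> khi B' \<le> k"
  shows False
proof -
  obtain r where r: "fst x = r @ (m,k) # c" using assms(1) by auto
  hence "fst x \<noteq> c" by simp
  hence "ext c (klo B') (khi B') (r @ (m,k) # c)" using assms(2) r by simp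
  thus False using ext_disj' assms(3) by blast
qed

lemma Tri_sub: "terr (Tri K ((m,k) # c)) x \<Longrightarrow> klo B < k \<Longrightarrow> k < khi B \<Longrightarrow> terr (Blk K' c B i a b) x"
  using ext_append by auto

lemma Blk_node: "terr (Blk K c B i a b) (c, y) \<longleftrightarrow> xlo B < snd y \<and> snd y < xhi B"
  by (simp add: ext_irrefl)

text \<open>Common to gaps and outer blocks, where the three replacements lead to a new component
  below key \<open>k\<close> and to two smaller blocks.\<close>

lemma terr_two_blocks:
  assumes "apart B1 B2" "k \<le> klo B1 \<or> khi B1 \<le> k" "k \<le> klo B2 \<or> khi B2 \<le> k" "klo B < k" "k < khi B"
    "klo B \<le> klo B1 \<and> khi B1 \<le> khi B" "xlo B \<le> xlo B1 \<and> xhi B1 \<le> xhi B"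
    "klo B \<le> klo B2 \<and> khi B2 \<le> khi B" "xlo B \<le> xlo B2 \<and> xhi B2 \<le> xhi B"
    "\<not> (xlo B1 < snd y \<and> snd y < xhi B1)" "\<not> (xlo B2 < snd y \<and> snd y < xhi B2)"
  shows "(\<not> terr (Tri K0 ((m, k) # c)) (c, y) \<and> (terr (Tri K0 ((m, k) # c)) x \<longrightarrow> terr (Blk K c B i a b) x)) \<and>
    (\<not> terr (Blk K1 c B1 i1 a1 b1) (c, y) \<and> (terr (Blk K1 c B1 i1 a1 b1) x \<longrightarrow> terr (Blk K c B i a b) x)) \<and>
    (\<not> terr (Blk K2 c B2 i2 a2 b2) (c, y) \<and> (terr (Blk K2 c B2 i2 a2 b2) x \<longrightarrow> terr (Blk K c B i a b) x)) \<and>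
    \<not> (terr (Tri K0 ((m, k) # c)) x \<and> terr (Blk K1 c B1 i1 a1 b1) x) \<and> \<not> (terr (Tri K0 ((m, k) # c)) x \<and> terr (Blk K2 c B2 i2 a2 b2) x) \<and> \<not> (terr (Blk K1 c B1 i1 a1 b1) x \<and> terr (Blk K2 c B2 i2 a2 b2) x)"
proof (intro conjI impI)
  show "\<not> terr (Tri K0 ((m, k) # c)) (c, y)" by simp
  show "\<not> terr (Blk K1 c B1 i1 a1 b1) (c, y)" "\<not> terr (Blk K2 c B2 i2 a2 b2) (c, y)" unfolding Blk_node using assms(10,11) by blast+
  show "terr (Blk K c B i a b) x" if "terr (Tri K0 ((m, k) # c)) x" using Tri_sub that assms(4,5) by blast
  show "terr (Blk K c B i a b) x" if "terr (Blk K1 c B1 i1 a1 b1) x" using that assms(6,7) by (rule terr_mono)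
  show "terr (Blk K c B i a b) x" if "terr (Blk K2 c B2 i2 a2 b2) x" using that assms(8,9) by (rule terr_mono)
  show "\<not> (terr (Tri K0 ((m, k) # c)) x \<and> terr (Blk K1 c B1 i1 a1 b1) x)" using Tri_Blk_disj assms(2) by blast
  show "\<not> (terr (Tri K0 ((m, k) # c)) x \<and> terr (Blk K2 c B2 i2 a2 b2) x)" using Tri_Blk_disj assms(3) by blast
  show "\<not> (terr (Blk K1 c B1 i1 a1 b1) x \<and> terr (Blk K2 c B2 i2 a2 b2) x)" using apart_disj assms(1) by blast
qed

text \<open>Subblocks have disjoint open ranges of positions and of keys, none of which contains the
  position of the new point; a component inside the triangle is kept apart by the key of that
  triangle.\<close>

lemma terr_sub:
  assumes "region_inv g" "k < 3"
  shows "\<not> terr (subregion k g) (region_node g)" "terr (subregion k g) x \<Longrightarrow> terr g x"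
    "k' < 3 \<Longrightarrow> k \<noteq> k' \<Longrightarrow> terr (subregion k g) x \<Longrightarrow> terr (subregion k' g) x \<Longrightarrow> False"
proof -
  have "\<not> terr (subregion k g) (region_node g) \<and> (terr (subregion k g) x \<longrightarrow> terr g x) \<and>
    (k' < 3 \<longrightarrow> k \<noteq> k' \<longrightarrow> terr (subregion k g) x \<longrightarrow> \<not> terr (subregion k' g) x)"
  proof (cases g)
    case (Tri K c)
    have 1: "\<exists>r. c' = r @ c" if "ext c p q c'" for p q c' using that unfolding ext_def by force
    have "k \<noteq> k' \<Longrightarrow> real k + 1 \<le> real k' \<or> real k' + 1 \<le> real k" by linarith
    hence "k \<noteq> k' \<Longrightarrow> apart (arm0 k) (arm0 k')" by (auto simp: apart_def arm0_def)
    thus ?thesis using Tri apart_disj[of _ c "arm0 k" _ _ _ x _ "arm0 k'"] 1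
      by (auto simp: Blk_node arm0_def simp del: terr.simps) (auto simp: ext_def)
  next
    case (Blk K c B i a b)
    have v: "valid B" "{i,a,b} = {0,1,2}" using assms Blk by auto
    note p = perm3[OF v(2)]
    have k: "k = i \<or> k = a \<or> k = b" by (rule p(7)[OF assms(2)])
    have k': "k' < 3 \<Longrightarrow> k' = i \<or> k' = a \<or> k' = b" by (rule p(7))
    have n: "region_node g = (c, new_pt B)" using Blk by simp
    have "(\<not> terr (subregion i g) (region_node g) \<and> (terr (subregion i g) x \<longrightarrow> terr g x)) \<and>
       (\<not> terr (subregion a g) (region_node g) \<and> (terr (subregion a g) x \<longrightarrow> terr g x)) \<and>
       (\<not> terr (subregion b g) (region_node g) \<and> (terr (subregion b g) x \<longrightarrow> terr g x)) \<and>
       \<not> (terr (subregion i g) x \<and> terr (subregion a g) x) \<and> \<not> (terr (subregion i g) x \<and> terr (subregion b g) x) \<and> \<not> (terr (subregion a g) x \<and> terr (subregion b g) x)"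
    proof (cases B)
      case (Arm v s t p q)
      note gs = gsub_Arm[OF Arm p(1-3)]
      have o: "apart (arm_arm B) (arm_gap B)" "apart (arm_arm B) (arm_out B)" "apart (arm_gap B) (arm_out B)"
        using v(1) Arm by (auto simp: apart_def)
      have o2: "\<not> (xlo (arm_arm B) < snd (new_pt B) \<and> snd (new_pt B) < xhi (arm_arm B))"
          "\<not> (xlo (arm_gap B) < snd (new_pt B) \<and> snd (new_pt B) < xhi (arm_gap B))" "\<not> (xlo (arm_out B) < snd (new_pt B) \<and> snd (new_pt B) < xhi (arm_out B))"
        using v(1) Arm by auto
      note ks = key_sub(1-3)[OF v(1)[unfolded Arm], folded Arm] sub_x(1-3)[OF v(1)[unfolded Arm], folded Arm]
      show ?thesis unfolding n unfolding Blk gs Blk_node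
        by (intro conjI impI; (rule o2 | erule terr_mono[OF _ ks(1,4)] | erule terr_mono[OF _ ks(2,5)] | erule terr_mono[OF _ ks(3,6)]
          | (rule notI, elim conjE, erule (1) apart_disj, rule o)))
    next
      case (Gap l r s t p q)
      note gs = gsub_Gap[OF Gap p(1-3)]
      have o: "apart (gap_right B) (gap_left B)" "key B \<le> klo (gap_left B) \<or> khi (gap_left B) \<le> key B" "key B \<le> klo (gap_right B) \<or> khi (gap_right B) \<le> key B"
        using v(1) Gap by (auto simp: apart_def)
      have o2: "\<not> (xlo (gap_left B) < snd (new_pt B) \<and> snd (new_pt B) < xhi (gap_left B))"
          "\<not> (xlo (gap_right B) < snd (new_pt B) \<and> snd (new_pt B) < xhi (gap_right B))"
        using v(1) Gap by auto
      have o3: "klo B < key B" "key B < khi B" using v(1) Gap by auto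
      note ks = key_sub(4,5)[OF v(1)[unfolded Gap], folded Gap] sub_x(4,5)[OF v(1)[unfolded Gap], folded Gap]
      show ?thesis unfolding n unfolding Blk gs by (rule terr_two_blocks[OF o(1,3,2) o3 ks(2,4,1,3) o2(2,1)])
    next
      case (Out l r s t p q)
      note gs = gsub_Out[OF Out p(1-3)]
      have o: "apart (out_gap B) (out_out B)" "key B \<le> klo (out_gap B) \<or> khi (out_gap B) \<le> key B" "key B \<le> klo (out_out B) \<or> khi (out_out B) \<le> key B"
        using v(1) Out by (auto simp: apart_def)
      have o2: "\<not> (xlo (out_gap B) < snd (new_pt B) \<and> snd (new_pt B) < xhi (out_gap B))"
          "\<not> (xlo (out_out B) < snd (new_pt B) \<and> snd (new_pt B) < xhi (out_out B))"
        using v(1) Out by auto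
      have o3: "klo B < key B" "key B < khi B" using v(1) Out by auto
      note ks = key_sub(6,7)[OF v(1)[unfolded Out], folded Out] sub_x(6,7)[OF v(1)[unfolded Out], folded Out]
      show ?thesis unfolding n unfolding Blk gs by (rule terr_two_blocks[OF o(1,2,3) o3 ks(1,3,2,4) o2(1,2)])
    qed
    thus ?thesis using k k' by blast
  qed
  thus "\<not> terr (subregion k g) (region_node g)" "terr (subregion k g) x \<Longrightarrow> terr g x"
    "k' < 3 \<Longrightarrow> k \<noteq> k' \<Longrightarrow> terr (subregion k g) x \<Longrightarrow> terr (subregion k' g) x \<Longrightarrow> False" by blast+
qed

section \<open>Planarity of lattice quotients\<close>

text \<open>As \<open>U\<close> is connected, some uncovered element is adjacent to a covered one
  and can join its set; finiteness ends the process. An empty set never gains an element.\<close>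

lemma absorb:
  fixes P :: "'i \<Rightarrow> 'v set"
  assumes r: "symp r" "conn r U"
    and P: "\<And>i. P i \<subseteq> U" "\<And>i. conn r (P i)" "\<And>i j. i \<noteq> j \<Longrightarrow> P i \<inter> P j = {}"
    and fin: "finite (U - (\<Union>i. P i))" and ne: "(\<Union>i. P i) \<noteq> {}"
  shows "\<exists>Q. (\<forall>i. P i \<subseteq> Q i \<and> conn r (Q i)) \<and> (\<forall>i j. i \<noteq> j \<longrightarrow> Q i \<inter> Q j = {}) \<and> (\<Union>i. Q i) = U
    \<and> (\<forall>i. P i = {} \<longrightarrow> Q i = {})"
  using assms
proof (induction "card (U - (\<Union>i. P i))" arbitrary: P rule: less_induct)
  case (less P)
  show ?case
  proof (cases "U \<subseteq> (\<Union>i. P i)")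
    case True
    thus ?thesis using less.prems by (intro exI[of _ P]) blast
  next
    case False
    then obtain z where z: "z \<in> U" "z \<notin> (\<Union>i. P i)" by auto
    obtain p where p: "p \<in> (\<Union>i. P i)" using less.prems(7) by auto
    obtain x y where xy: "x \<in> U" "y \<in> U" "r x y" "x \<in> (\<Union>i. P i)" "y \<notin> (\<Union>i. P i)"
      using conn_leaves[OF r(2) _ z(1) p z(2)] p less.prems(3) by blast
    obtain i where i: "x \<in> P i" using xy by auto
    define P' where "P' = P(i := insert y (P i))"
    have U': "(\<Union>j. P' j) = insert y (\<Union>j. P j)" unfolding P'_def using i by (auto split: if_splits)
    have c: "conn r (insert y (P i))"
      using conn_Un[OF r(1) less.prems(4)[of i], of "{y}"] xy i by (auto simp: touch_def)
    have yP: "y \<notin> P j" for j using xy(5) by auto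
    have ex: "\<exists>Q. (\<forall>i. P' i \<subseteq> Q i \<and> conn r (Q i)) \<and> (\<forall>i j. i \<noteq> j \<longrightarrow> Q i \<inter> Q j = {}) \<and> (\<Union>i. Q i) = U
       \<and> (\<forall>i. P' i = {} \<longrightarrow> Q i = {})"
    proof (rule less.hyps)
      have "U - (\<Union>j. P' j) \<subset> U - (\<Union>j. P j)" unfolding U' using xy by auto
      thus "card (U - (\<Union>j. P' j)) < card (U - (\<Union>j. P j))" using less.prems(6) by (rule psubset_card_mono[rotated])
      show "symp r" "conn r U" by fact+
      show "P' j \<subseteq> U" for j using less.prems(3) xy by (auto simp: P'_def)
      show "conn r (P' j)" for j using less.prems(4) c by (auto simp: P'_def)
      show "P' j \<inter> P' k = {}" if "j \<noteq> k" for j k using less.prems(5)[OF that] yP that by (auto simp: P'_def)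
      show "finite (U - (\<Union>j. P' j))" unfolding U' using less.prems(6) by (rule rev_finite_subset) auto
      show "(\<Union>j. P' j) \<noteq> {}" unfolding U' by auto
    qed
    then obtain Q where Q: "\<forall>i. P' i \<subseteq> Q i \<and> conn r (Q i)" "\<forall>i j. i \<noteq> j \<longrightarrow> Q i \<inter> Q j = {}" "(\<Union>i. Q i) = U"
      "\<forall>i. P' i = {} \<longrightarrow> Q i = {}" by (elim exE conjE)
    have PP: "P j \<subseteq> P' j" "P j = {} \<Longrightarrow> P' j = {}" for j using i by (auto simp: P'_def)
    show ?thesis
    proof (intro exI[of _ Q] conjI allI impI)
      show "P j \<subseteq> Q j" for j using PP(1)[of j] Q(1) by (meson order_trans)
      show "conn r (Q j)" for j using Q(1) by (rule allE) (rule conjunct2)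
      show "Q j \<inter> Q k = {}" if "j \<noteq> k" for j k using Q(2) that by metis
      show "(\<Union>i. Q i) = U" by (rule Q(3))
      show "Q j = {}" if "P j = {}" for j using Q(4) PP(2)[OF that] by metis
    qed
  qed
qed

lemma touch_mono: "touch r A B \<Longrightarrow> A \<subseteq> A' \<Longrightarrow> B \<subseteq> B' \<Longrightarrow> touch r A' B'"
  unfolding touch_def by blast

lemma touch_sym: "symp r \<Longrightarrow> touch r A B \<Longrightarrow> touch r B A"
  unfolding touch_def symp_def by blast

lemma ladj_H: "ladj (i,j) (i+1,j)" and ladj_V: "ladj (i,j) (i,j+1)"
  unfolding ladj_def by (metis ends.simps(1)) (metis ends.simps(2))

lemma restr_row: 
  assumes "i \<le> i'" "\<And>k. i \<le> k \<Longrightarrow> k \<le> i' \<Longrightarrow> (k,j) \<in> S"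
  shows "(restr ladj S)\<^sup>*\<^sup>* (i,j) (i',j)"
  using assms
proof (induction i' rule: int_ge_induct)
  case (step i')
  have "restr ladj S (i',j) (i'+1,j)" using step ladj_H by (auto simp: restr_def)
  moreover have "(restr ladj S)\<^sup>*\<^sup>* (i,j) (i',j)" using step by auto
  ultimately show ?case by (meson rtranclp.rtrancl_into_rtrancl)
qed simp

lemma restr_col: 
  assumes "j \<le> j'" "\<And>k. j \<le> k \<Longrightarrow> k \<le> j' \<Longrightarrow> (i,k) \<in> S"
  shows "(restr ladj S)\<^sup>*\<^sup>* (i,j) (i,j')"
  using assms
proof (induction j' rule: int_ge_induct)
  case (step j')
  have "restr ladj S (i,j') (i,j'+1)" using step ladj_V by (auto simp: restr_def)
  moreover have "(restr ladj S)\<^sup>*\<^sup>* (i,j) (i,j')" using step by auto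
  ultimately show ?case by (meson rtranclp.rtrancl_into_rtrancl)
qed simp

lemma restr_row': 
  assumes "\<And>k. min i i' \<le> k \<Longrightarrow> k \<le> max i i' \<Longrightarrow> (k,j) \<in> S"
  shows "(restr ladj S)\<^sup>*\<^sup>* (i,j) (i',j)"
  using restr_row[of i i' j S] restr_row[of i' i j S] restr_sym[OF symp_ladj] assms by (cases "i \<le> i'") auto

lemma restr_col': 
  assumes "\<And>k. min j j' \<le> k \<Longrightarrow> k \<le> max j j' \<Longrightarrow> (i,k) \<in> S"
  shows "(restr ladj S)\<^sup>*\<^sup>* (i,j) (i,j')"
  using restr_col[of j j' i S] restr_col[of j' j i S] restr_sym[OF symp_ladj] assms by (cases "j \<le> j'") auto

lemma ladj_connected: "ladj\<^sup>*\<^sup>* x y"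
proof -
  have "(restr ladj UNIV)\<^sup>*\<^sup>* (fst x, snd x) (fst y, snd x)" "(restr ladj UNIV)\<^sup>*\<^sup>* (fst y, snd x) (fst y, snd y)"
    by (rule restr_row', simp) (rule restr_col', simp)
  hence "(restr ladj UNIV)\<^sup>*\<^sup>* x y" by (metis prod.collapse rtranclp_trans)
  moreover have "restr ladj UNIV = ladj" by (auto simp: restr_def fun_eq_iff)
  ultimately show ?thesis by simp
qed

text \<open>Contracting connected cell sets models a plane graph. A fibre may be infinite (the
  outside), so finiteness is asked of the edges between different fibres; it makes all crossing
  counts finite.\<close>

locale cell_quotient =
  fixes f :: "cell \<Rightarrow> 'v"
  assumes fibre_conn: "conn ladj (f -` {u})"
    and finite_mixed: "finite {e. \<not> (\<exists>u. f ` ends e \<subseteq> {u})}"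
    and finite_range: "finite (range f)"
begin

definition U where "U = range f"

definition adj where "adj u v \<longleftrightarrow> u \<noteq> v \<and> (\<exists>z z'. ladj z z' \<and> f z = u \<and> f z' = v)"

definition meets :: "face \<Rightarrow> 'v set \<Rightarrow> bool" where "meets F S \<longleftrightarrow> S \<subseteq> f ` fv F"

lemma meets_U: "meets F S \<Longrightarrow> x \<in> S \<Longrightarrow> x \<in> U" by (auto simp: meets_def U_def)

definition face3 where "face3 x y z \<longleftrightarrow> (\<exists>F. {x,y,z} \<subseteq> f ` fv F)"

lemma symp_adj: "symp adj"
  using symp_ladj unfolding symp_def adj_def by metis

lemma adj_U: "adj u v \<Longrightarrow> u \<in> U \<and> v \<in> U" by (auto simp: adj_def U_def)

text \<open>A path of the quotient lifts step by step, walking inside each fibre from the cell of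
  arrival to the cell of departure.\<close>

lemma vimage_conn:
  assumes "conn adj S" shows "conn ladj (f -` S)"
  unfolding conn_def
proof (intro ballI)
  fix x y assume x: "x \<in> f -` S" and y: "y \<in> f -` S"
  have fib: "(restr ladj (f -` S))\<^sup>*\<^sup>* a b" if "f a \<in> S" "f a = f b" for a b
    using fibre_conn[of "f a"] that restr_mono[of "f -` {f a}" "f -` S" ladj a b] by (auto simp: conn_def)
  have "(restr adj S)\<^sup>*\<^sup>* (f x) (f y)" using assms x y by (auto simp: conn_def)
  hence "\<forall>b. f b = f y \<longrightarrow> (restr ladj (f -` S))\<^sup>*\<^sup>* x b"
  proof (induction rule: rtranclp_induct)
    case base
    show ?case using fib x by auto
  next
    case (step u v)
    obtain z z' where z: "ladj z z'" "f z = u" "f z' = v" "u \<in> S" "v \<in> S" using step(2) by (auto simp: restr_def adj_def)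
    show ?case
    proof (intro allI impI)
      fix b assume b: "f b = v"
      have "(restr ladj (f -` S))\<^sup>*\<^sup>* x z" using step.IH z by blast
      also have "restr ladj (f -` S) z z'" using z by (auto simp: restr_def)
      also have "(restr ladj (f -` S))\<^sup>*\<^sup>* z' b" using fib z b by auto
      finally show "(restr ladj (f -` S))\<^sup>*\<^sup>* x b" .
    qed
  qed
  thus "(restr ladj (f -` S))\<^sup>*\<^sup>* x y" by blast
qed

lemma vimage_touch: "touch adj S T \<Longrightarrow> touch ladj (f -` S) (f -` T)"
  by (auto simp: touch_def adj_def)

lemma finite_cross:
  assumes "S \<inter> T = {}" shows "finite (cross (f -` S) (f -` T))"
proof -
  have "cross (f -` S) (f -` T) \<subseteq> {e. \<not> (\<exists>u. f ` ends e \<subseteq> {u})}"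
    using assms by (fastforce simp: cross_def)
  thus ?thesis using finite_mixed finite_subset by blast
qed

lemma card_face: "card (f ` fv F) \<le> 3"
proof -
  have "card (fv F) \<le> 3" "finite (fv F)" by (cases F; auto simp: card_insert_if)+
  thus ?thesis using card_image_le[of "fv F" f] by linarith
qed

lemma face3_adj: "face3 x y z \<Longrightarrow> x \<noteq> y \<Longrightarrow> adj x y"
proof -
  assume "face3 x y z" "x \<noteq> y"
  then obtain F a b where "a \<in> fv F" "b \<in> fv F" "f a = x" "f b = y" unfolding face3_def by auto
  thus "adj x y" using face_adj[of a F b] \<open>x \<noteq> y\<close> unfolding adj_def by metis
qed

lemma face3_perm: "face3 x y z \<Longrightarrow> face3 y x z" "face3 x y z \<Longrightarrow> face3 x z y"
  unfolding face3_def by (simp_all add: insert_commute)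

lemma triI:
  assumes "P \<inter> Q = {}" "p \<in> P" "q \<in> Q" "t \<notin> P \<union> Q" "meets F {p,q,t}"
  shows "tri (f -` P) (f -` Q) F"
proof -
  obtain a b c where "a \<in> fv F" "f a = p" "b \<in> fv F" "f b = q" "c \<in> fv F" "f c = t"
    using assms(5) unfolding meets_def by (metis image_iff insert_subset)
  thus ?thesis using assms unfolding tri_def by blast
qed

lemma triE:
  assumes "tri (f -` P) (f -` Q) F"
  obtains p q t where "p \<in> P" "q \<in> Q" "t \<notin> P \<union> Q" "meets F {p,q,t}"
proof -
  obtain a b c where *: "a \<in> fv F" "f a \<in> P" "b \<in> fv F" "f b \<in> Q" "c \<in> fv F" "f c \<notin> P \<union> Q"
    using assms unfolding tri_def by blast
  hence "meets F {f a, f b, f c}" by (simp add: meets_def)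
  with * show ?thesis using that by blast
qed

text \<open>With \<open>W - R\<close> as the set to be avoided, the third vertex of the face is left
  with \<open>R\<close> only.\<close>

lemma side_face:
  assumes c: "conn adj P" "conn adj Q" "conn adj R" "conn adj (W - R)"
    and d: "P \<inter> Q = {}" "W \<inter> (P \<union> Q) = {}" "R \<subseteq> W" "P \<union> Q \<union> W = U"
    and t: "touch adj P Q" "touch adj Q R" "touch adj R P"
  shows "\<exists>F. \<exists>p\<in>P. \<exists>q\<in>Q. \<exists>x\<in>R. meets F {p,q,x}"
proof -
  have "\<exists>F. tri (f -` P) (f -` Q) F \<and> fv F \<inter> (f -` (W - R)) = {}"
    using d by (intro tri_exists_avoiding[of _ _ "f -` R"] vimage_conn vimage_touch c t finite_cross) auto
  then obtain F where F: "tri (f -` P) (f -` Q) F" "fv F \<inter> (f -` (W - R)) = {}" by blast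
  obtain p q x where x: "p \<in> P" "q \<in> Q" "x \<notin> P \<union> Q" "meets F {p,q,x}"
    by (rule triE[OF F(1)])
  have "x \<in> U" using meets_U[OF x(4)] by blast
  moreover have "x \<notin> W - R"
  proof
    assume "x \<in> W - R"
    moreover obtain a where "a \<in> fv F" "f a = x" using x(4) unfolding meets_def by blast
    ultimately show False using F(2) by blast
  qed
  ultimately have "x \<in> R" using x(3) d by blast
  thus ?thesis using x by blast
qed

lemma three_faces:
  assumes c: "conn adj P" "conn adj Q" "conn adj W"
    and d: "P \<inter> Q = {}" "W \<inter> (P \<union> Q) = {}" "P \<union> Q \<union> W = U"
    and F: "p1 \<in> P" "q1 \<in> Q" "x1 \<in> W" "meets F1 {p1,q1,x1}"
      "p2 \<in> P" "q2 \<in> Q" "x2 \<in> W" "meets F2 {p2,q2,x2}"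
      "p3 \<in> P" "q3 \<in> Q" "x3 \<in> W" "meets F3 {p3,q3,x3}"
    and ne: "F1 \<noteq> F2" "F1 \<noteq> F3" "F2 \<noteq> F3"
  shows False
proof (rule at_most_two_tri[of "f -` P" "f -` Q" F1 F2 F3])
  show "conn ladj (f -` P)" "conn ladj (f -` Q)" using c vimage_conn by blast+
  have "- (f -` P \<union> f -` Q) = f -` W" using d by (auto simp: U_def)
  thus "conn ladj (- (f -` P \<union> f -` Q))" using vimage_conn[OF c(3)] by simp
  show "f -` P \<inter> f -` Q = {}" using d by auto
  show "finite (cross (f -` P) (f -` Q))" using finite_cross d by blast
  show "tri (f -` P) (f -` Q) F1" "tri (f -` P) (f -` Q) F2" "tri (f -` P) (f -` Q) F3"
    using triI[OF d(1) F(1,2) _ F(4)] triI[OF d(1) F(5,6) _ F(8)] triI[OF d(1) F(9,10) _ F(12)] F(3,7,11) d(2) by blast+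
qed (use ne in auto)

text \<open>A face has three cells, so it cannot meet a fourth vertex.\<close>

lemma face_ne:
  assumes "meets F {p,q,x}" "meets F' {p',q',x'}" "p \<noteq> q" "x \<notin> {p,q}" "x' \<notin> {p,q,x}"
  shows "F \<noteq> F'"
proof
  assume "F = F'"
  hence "{p,q,x,x'} \<subseteq> f ` fv F" using assms by (simp add: meets_def)
  moreover have "finite (f ` fv F)" by (cases F) auto
  ultimately have "card {p,q,x,x'} \<le> card (f ` fv F)" by (rule card_mono[rotated])
  thus False using card_face[of F] assms by auto
qed

text \<open>Disjoint parts of \<open>W\<close> contribute different faces between \<open>P\<close>
  and \<open>Q\<close>, one more than possible.\<close>

lemma three_sides:
  assumes c: "conn adj P" "conn adj Q" "conn adj W"
    and d: "P \<inter> Q = {}" "W \<inter> (P \<union> Q) = {}" "P \<union> Q \<union> W = U"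
    and F: "\<exists>F. \<exists>p\<in>P. \<exists>q\<in>Q. \<exists>x\<in>R1. meets F {p,q,x}" "\<exists>F. \<exists>p\<in>P. \<exists>q\<in>Q. \<exists>x\<in>R2. meets F {p,q,x}"
      "\<exists>F. \<exists>p\<in>P. \<exists>q\<in>Q. \<exists>x\<in>R3. meets F {p,q,x}"
    and R: "R1 \<subseteq> W" "R2 \<subseteq> W" "R3 \<subseteq> W" "R1 \<inter> R2 = {}" "R1 \<inter> R3 = {}" "R2 \<inter> R3 = {}"
  shows False
proof -
  obtain F1 p1 q1 x1 where 1: "p1 \<in> P" "q1 \<in> Q" "x1 \<in> R1" "meets F1 {p1,q1,x1}" using F(1) by blast
  obtain F2 p2 q2 x2 where 2: "p2 \<in> P" "q2 \<in> Q" "x2 \<in> R2" "meets F2 {p2,q2,x2}" using F(2) by blast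
  obtain F3 p3 q3 x3 where 3: "p3 \<in> P" "q3 \<in> Q" "x3 \<in> R3" "meets F3 {p3,q3,x3}" using F(3) by blast
  have W: "x1 \<in> W" "x2 \<in> W" "x3 \<in> W" using 1 2 3 R by auto
  have m: "p1 \<noteq> q1" "p2 \<noteq> q2" "x1 \<notin> {p1,q1}" "x2 \<notin> {p2,q2}" "x2 \<notin> {p1,q1,x1}" "x3 \<notin> {p1,q1,x1}" "x3 \<notin> {p2,q2,x2}"
    using 1(1-3) 2(1-3) 3(1-3) W d(1,2) R(4-6) by auto
  have ne: "F1 \<noteq> F2" "F1 \<noteq> F3" "F2 \<noteq> F3"
    by (rule face_ne[OF 1(4) 2(4) m(1,3,5)] face_ne[OF 1(4) 3(4) m(1,3,6)] face_ne[OF 2(4) 3(4) m(2,4,7)])+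
  show False by (rule three_faces[OF c d 1(1,2) W(1) 1(4) 2(1,2) W(2) 2(4) 3(1,2) W(3) 3(4) ne])
qed

lemma conn_U: "conn adj U"
  unfolding conn_def
proof (intro ballI)
  fix u v assume "u \<in> U" "v \<in> U"
  then obtain x y where xy: "f x = u" "f y = v" by (auto simp: U_def)
  have "ladj\<^sup>*\<^sup>* x y" using ladj_connected .
  thus "(restr adj U)\<^sup>*\<^sup>* u v" unfolding xy[symmetric]
  proof (induction rule: rtranclp_induct)
    case (step y z)
    show ?case
    proof (cases "f y = f z")
      case False
      hence "adj (f y) (f z)" using step(2) unfolding adj_def by blast
      hence "restr adj U (f y) (f z)" unfolding restr_def U_def by blast
      with step.IH show ?thesis by (rule rtranclp.rtrancl_into_rtrancl)
    qed (use step in simp)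
  qed simp
qed

lemma absorb_U:
  fixes P :: "nat \<Rightarrow> 'v set"
  assumes "\<And>i. P i \<subseteq> U" "\<And>i. conn adj (P i)" "\<And>i j. i \<noteq> j \<Longrightarrow> P i \<inter> P j = {}" "P 0 \<noteq> {}"
  obtains Q where "\<And>i. P i \<subseteq> Q i" "\<And>i. conn adj (Q i)" "\<And>i j. i \<noteq> j \<Longrightarrow> Q i \<inter> Q j = {}" "(\<Union>i. Q i) = U"
    "\<And>i. P i = {} \<Longrightarrow> Q i = {}"
proof -
  have "finite (U - (\<Union>i. P i))" using finite_range by (simp add: U_def)
  moreover have "(\<Union>i. P i) \<noteq> {}" using assms(4) by blast
  ultimately show ?thesis using absorb[OF symp_adj conn_U, of P] assms(1-3) that by metis
qed

lemma touchI: "touch adj A B \<Longrightarrow> A \<noteq> {} \<and> B \<noteq> {}" by (auto simp: touch_def)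

lemma conn_Un_adj: "conn adj S \<Longrightarrow> conn adj T \<Longrightarrow> touch adj S T \<or> touch adj T S \<Longrightarrow> conn adj (S \<union> T)"
  using conn_Un[OF symp_adj] touch_sym[OF symp_adj] by blast

section \<open>Systems of touching connected sets that planarity excludes, and Sperner's
  lemma\<close>

definition sys :: "(nat \<Rightarrow> 'v set) \<Rightarrow> nat \<Rightarrow> bool" where
  "sys P n \<longleftrightarrow> (\<forall>i<n. P i \<subseteq> U \<and> conn adj (P i)) \<and> (\<forall>i<n. \<forall>j<n. i \<noteq> j \<longrightarrow> P i \<inter> P j = {})"

lemma sys_absorb:
  assumes "sys P n" "P 0 \<noteq> {}" "0 < n"
  obtains Q where "\<And>i. i < n \<Longrightarrow> P i \<subseteq> Q i" "\<And>i. i < n \<Longrightarrow> conn adj (Q i)" "\<And>i j. i < n \<Longrightarrow> j < n \<Longrightarrow> i \<noteq> j \<Longrightarrow> Q i \<inter> Q j = {}"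
    "(\<Union>i<n. Q i) = U"
proof -
  define P' where "P' i = (if i < n then P i else {})" for i
  obtain Q where Q: "\<And>i. P' i \<subseteq> Q i" "\<And>i. conn adj (Q i)" "\<And>i j. i \<noteq> j \<Longrightarrow> Q i \<inter> Q j = {}" "(\<Union>i. Q i) = U"
    "\<And>i. P' i = {} \<Longrightarrow> Q i = {}"
    by (rule absorb_U[of P']) (use assms in \<open>auto simp: P'_def sys_def\<close>)
  have "Q i = {}" if "\<not> i < n" for i using Q(5)[of i] that by (simp add: P'_def)
  hence "(\<Union>i<n. Q i) = (\<Union>i. Q i)" by auto
  moreover have "P i \<subseteq> Q i" if "i < n" for i using Q(1)[of i] that by (simp add: P'_def)
  ultimately show ?thesis using that Q by metis
qed

text \<open>Seen from \<open>P 0\<close> and \<open>P 1\<close>, each of the other three sets yields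
  a face of its own, since the remaining two form a connected set to be avoided.\<close>

lemma no_K5:
  assumes s: "sys P 5" and t: "\<And>i j. i < 5 \<Longrightarrow> j < 5 \<Longrightarrow> i \<noteq> j \<Longrightarrow> touch adj (P i) (P j)"
  shows False
proof -
  have ne: "P 0 \<noteq> {}" using t[of 0 1] touchI by auto
  obtain Q where Q: "\<And>i. i < 5 \<Longrightarrow> P i \<subseteq> Q i" "\<And>i. i < 5 \<Longrightarrow> conn adj (Q i)" 
    "\<And>i j. i < 5 \<Longrightarrow> j < 5 \<Longrightarrow> i \<noteq> j \<Longrightarrow> Q i \<inter> Q j = {}" "(\<Union>i<5. Q i) = U"
    using sys_absorb[OF s ne] by auto
  have T: "touch adj (Q i) (Q j)" if "i < 5" "j < 5" "i \<noteq> j" for i j using t[OF that] Q(1) that touch_mono by metis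
  have five: "{..<5} = {0,1,2,3,4::nat}" by auto
  have cov: "Q 0 \<union> Q 1 \<union> (Q 2 \<union> Q 3 \<union> Q 4) = U" using Q(4) unfolding five by auto
  have D: "Q i \<inter> Q j = {}" if "i < 5" "j < 5" "i \<noteq> j" for i j using Q(3) that .
  have c2: "conn adj (Q i \<union> Q j)" if "i < 5" "j < 5" "i \<noteq> j" for i j using conn_Un_adj Q(2) T that by blast
  have W: "conn adj (Q 2 \<union> Q 3 \<union> Q 4)"
    using conn_Un_adj[OF c2[of 2 3] Q(2)[of 4]] T[of 2 4] touch_mono[of adj "Q 2" "Q 4" "Q 2 \<union> Q 3" "Q 4"] by auto
  have dW: "(Q 2 \<union> Q 3 \<union> Q 4) \<inter> (Q 0 \<union> Q 1) = {}" using D[of 2 0] D[of 3 0] D[of 4 0] D[of 2 1] D[of 3 1] D[of 4 1] by auto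
  have diff: "Q 2 \<union> Q 3 \<union> Q 4 - Q 2 = Q 3 \<union> Q 4" "Q 2 \<union> Q 3 \<union> Q 4 - Q 3 = Q 2 \<union> Q 4" "Q 2 \<union> Q 3 \<union> Q 4 - Q 4 = Q 2 \<union> Q 3"
    using D[of 2 3] D[of 2 4] D[of 3 4] by auto
  have face: "\<exists>F. \<exists>p\<in>Q 0. \<exists>q\<in>Q 1. \<exists>x\<in>Q i. meets F {p,q,x}" if "i \<in> {2,3,4}" for i
    by (rule side_face[where W = "Q 2 \<union> Q 3 \<union> Q 4"]) (use that T Q(2) cov D[of 0 1] dW c2 diff in auto)
  show False
    by (rule three_sides[OF _ _ W _ dW cov face[of 2] face[of 3] face[of 4]]) (use Q(2) D in auto)
qed

text \<open>A triangle of connected sets separates the plane into only two sides.\<close>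

lemma no_three_sides:
  assumes s: "sys P 6" and t: "\<And>i j. i < 3 \<Longrightarrow> j < 6 \<Longrightarrow> i \<noteq> j \<Longrightarrow> touch adj (P i) (P j)"
  shows False
proof -
  have ne: "P 0 \<noteq> {}" using t[of 0 1] touchI by auto
  obtain Q where Q: "\<And>i. i < 6 \<Longrightarrow> P i \<subseteq> Q i" "\<And>i. i < 6 \<Longrightarrow> conn adj (Q i)" 
    "\<And>i j. i < 6 \<Longrightarrow> j < 6 \<Longrightarrow> i \<noteq> j \<Longrightarrow> Q i \<inter> Q j = {}" "(\<Union>i<6. Q i) = U"
    using sys_absorb[OF s ne] by auto
  have T: "touch adj (Q i) (Q j)" if "i < 3" "j < 6" "i \<noteq> j" for i j using t[OF that] Q(1)[of i] Q(1)[of j] that touch_mono by fastforce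
  have T': "touch adj (Q j) (Q i)" if "i < 3" "j < 6" "i \<noteq> j" for i j using touch_sym[OF symp_adj T[OF that]] .
  have six: "{..<6} = {0,1,2,3,4,5::nat}" by auto
  \<comment> \<open>The sides need not touch each other. Adding the corner \<open>Q 0\<close>, which
    touches all of them, makes \<open>?W\<close> connected, also after removing one side.\<close>
  let ?W = "Q 0 \<union> Q 3 \<union> Q 4 \<union> Q 5"
  have cov: "Q 1 \<union> Q 2 \<union> ?W = U" using Q(4) unfolding six by auto
  have D: "Q i \<inter> Q j = {}" if "i < 6" "j < 6" "i \<noteq> j" for i j using Q(3) that .
  have c2: "conn adj (Q 0 \<union> Q i)" if "i \<in> {3,4,5}" for i using conn_Un_adj Q(2)[of i] Q(2)[of 0] T[of 0 i] that by auto
  have c3: "conn adj (Q 0 \<union> Q i \<union> Q j)" if "i \<in> {3,4,5}" "j \<in> {3,4,5}" "i \<noteq> j" for i j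
    using conn_Un_adj[OF c2[OF that(1)] Q(2)[of j]] T[of 0 j] touch_mono[of adj "Q 0" "Q j" "Q 0 \<union> Q i" "Q j"] that by auto
  have W: "conn adj ?W"
    using conn_Un_adj[OF c3[of 3 4] Q(2)[of 5]] T[of 0 5] touch_mono[of adj "Q 0" "Q 5" "Q 0 \<union> Q 3 \<union> Q 4" "Q 5"] by auto
  have dW: "?W \<inter> (Q 1 \<union> Q 2) = {}"
    using D[of 0 1] D[of 3 1] D[of 4 1] D[of 5 1] D[of 0 2] D[of 3 2] D[of 4 2] D[of 5 2] by auto
  have diff: "?W - Q 3 = Q 0 \<union> Q 4 \<union> Q 5" "?W - Q 4 = Q 0 \<union> Q 3 \<union> Q 5" "?W - Q 5 = Q 0 \<union> Q 3 \<union> Q 4"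
    using D[of 0 3] D[of 0 4] D[of 0 5] D[of 3 4] D[of 3 5] D[of 4 5] by auto
  have face: "\<exists>F. \<exists>p\<in>Q 1. \<exists>q\<in>Q 2. \<exists>x\<in>Q i. meets F {p,q,x}" if "i \<in> {3,4,5}" for i
    by (rule side_face[where W = ?W]) (use that T T' Q(2) cov D[of 1 2] dW c3 diff in auto)
  show False
    by (rule three_sides[OF _ _ W _ dW cov face[of 3] face[of 4] face[of 5]]) (use Q(2) D in auto)
qed

text \<open>The common face replaces a third side: it lies between \<open>P 1\<close> and
  \<open>P 2\<close> with its third vertex in \<open>P 0\<close>, unlike the faces that belong to
  the two sides.\<close>

lemma no_two_sides_and_face:
  assumes s: "sys P 5" and t: "\<And>i j. i < 3 \<Longrightarrow> j < 5 \<Longrightarrow> i \<noteq> j \<Longrightarrow> touch adj (P i) (P j)"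
    and F: "a \<in> P 0" "b \<in> P 1" "c \<in> P 2" "face3 a b c"
  shows False
proof -
  have ne: "P 0 \<noteq> {}" using t[of 0 1] touchI by auto
  obtain Q where Q: "\<And>i. i < 5 \<Longrightarrow> P i \<subseteq> Q i" "\<And>i. i < 5 \<Longrightarrow> conn adj (Q i)" 
    "\<And>i j. i < 5 \<Longrightarrow> j < 5 \<Longrightarrow> i \<noteq> j \<Longrightarrow> Q i \<inter> Q j = {}" "(\<Union>i<5. Q i) = U"
    using sys_absorb[OF s ne] by auto
  have T: "touch adj (Q i) (Q j)" if "i < 3" "j < 5" "i \<noteq> j" for i j using t[OF that] Q(1)[of i] Q(1)[of j] that touch_mono by fastforce
  have T': "touch adj (Q j) (Q i)" if "i < 3" "j < 5" "i \<noteq> j" for i j using touch_sym[OF symp_adj T[OF that]] .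
  have five: "{..<5} = {0,1,2,3,4::nat}" by auto
  let ?W = "Q 0 \<union> Q 3 \<union> Q 4"
  have cov: "Q 1 \<union> Q 2 \<union> ?W = U" using Q(4) unfolding five by auto
  have D: "Q i \<inter> Q j = {}" if "i < 5" "j < 5" "i \<noteq> j" for i j using Q(3) that .
  have c2: "conn adj (Q 0 \<union> Q i)" if "i \<in> {3,4}" for i using conn_Un_adj Q(2)[of i] Q(2)[of 0] T[of 0 i] that by auto
  have W: "conn adj ?W"
    using conn_Un_adj[OF c2[of 3] Q(2)[of 4]] T[of 0 4] touch_mono[of adj "Q 0" "Q 4" "Q 0 \<union> Q 3" "Q 4"] by auto
  have dW: "?W \<inter> (Q 1 \<union> Q 2) = {}" using D[of 0 1] D[of 3 1] D[of 4 1] D[of 0 2] D[of 3 2] D[of 4 2] by auto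
  have diff: "?W - Q 3 = Q 0 \<union> Q 4" "?W - Q 4 = Q 0 \<union> Q 3" using D[of 0 3] D[of 0 4] D[of 3 4] by auto
  have face: "\<exists>F. \<exists>p\<in>Q 1. \<exists>q\<in>Q 2. \<exists>x\<in>Q i. meets F {p,q,x}" if "i \<in> {3,4}" for i
    by (rule side_face[where W = ?W]) (use that T T' Q(2) cov D[of 1 2] dW c2 diff in auto)
  have face0: "\<exists>F. \<exists>p\<in>Q 1. \<exists>q\<in>Q 2. \<exists>x\<in>Q 0. meets F {p,q,x}"
  proof -
    have "a \<in> Q 0" "b \<in> Q 1" "c \<in> Q 2" using F Q(1)[of 0] Q(1)[of 1] Q(1)[of 2] by auto
    moreover obtain F where "meets F {b,c,a}" using F(4) unfolding face3_def meets_def by (metis insert_commute)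
    ultimately show ?thesis by blast
  qed
  show False
    by (rule three_sides[OF _ _ W _ dW cov face0 face[of 3] face[of 4]]) (use Q(2) D in auto)
qed

text \<open>Sperner's lemma inside the region \<open>P 0\<close>: there is exactly one face between the three outer sets, and the number of
  tricoloured faces is even.\<close>

lemma sperner:
  assumes s: "sys P 4" and t: "\<And>i j. i < 4 \<Longrightarrow> j < 4 \<Longrightarrow> i \<noteq> j \<Longrightarrow> touch adj (P i) (P j)"
    and N: "\<And>x y. x \<in> P 0 \<Longrightarrow> adj x y \<Longrightarrow> y \<in> P 0 \<union> P 1 \<union> P 2 \<union> P 3"
    and col: "\<And>x. x \<in> P 0 \<Longrightarrow> col x \<in> {1,2,3::nat}"
  shows "\<exists>x1 x2 x3. face3 x1 x2 x3 \<and> (\<forall>(k,x)\<in>{(1,x1),(2,x2),(3,x3)}. x \<in> P k \<or> (x \<in> P 0 \<and> col x = k)) \<and> (x1 \<in> P 0 \<or> x2 \<in> P 0 \<or> x3 \<in> P 0)"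
proof -
  have ne: "P 0 \<noteq> {}" using t[of 0 1] touchI by auto
  obtain Q where Q: "\<And>i. i < 4 \<Longrightarrow> P i \<subseteq> Q i" "\<And>i. i < 4 \<Longrightarrow> conn adj (Q i)" 
    "\<And>i j. i < 4 \<Longrightarrow> j < 4 \<Longrightarrow> i \<noteq> j \<Longrightarrow> Q i \<inter> Q j = {}" "(\<Union>i<4. Q i) = U"
    using sys_absorb[OF s ne] by auto
  have T: "touch adj (Q i) (Q j)" if "i < 4" "j < 4" "i \<noteq> j" for i j using t[OF that] Q(1)[of i] Q(1)[of j] that touch_mono by fastforce
  have four: "{..<4} = {0,1,2,3::nat}" by auto
  have D: "Q i \<inter> Q j = {}" if "i < 4" "j < 4" "i \<noteq> j" for i j using Q(3) that .
  \<comment> \<open>Absorption cannot enlarge the region, because all neighbours of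
    \<open>P 0\<close> already belong to one of the four sets.\<close>
  have X: "Q 0 = P 0"
  proof (rule ccontr)
    assume "Q 0 \<noteq> P 0"
    then obtain z where z: "z \<in> Q 0" "z \<notin> P 0" using Q(1)[of 0] by auto
    obtain p where p: "p \<in> P 0" using ne by auto
    obtain x y where xy: "x \<in> Q 0" "y \<in> Q 0" "adj x y" "x \<in> P 0" "y \<notin> P 0"
      using conn_leaves[OF Q(2)[of 0] _ z(1) p z(2)] p Q(1)[of 0] by auto
    hence "y \<in> P 1 \<union> P 2 \<union> P 3" using N by blast
    thus False using xy(2) D[of 0 1] D[of 0 2] D[of 0 3] Q(1)[of 1] Q(1)[of 2] Q(1)[of 3] by auto
  qed
  let ?W = "Q 3 \<union> Q 0"
  have cov: "Q 1 \<union> Q 2 \<union> ?W = U" using Q(4) unfolding four by auto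
  have W: "conn adj ?W" using conn_Un_adj Q(2) T by auto
  have dW: "?W \<inter> (Q 1 \<union> Q 2) = {}" using D[of 0 1] D[of 3 1] D[of 0 2] D[of 3 2] by auto
  have diff: "?W - Q 3 = Q 0" "?W - Q 0 = Q 3" using D[of 0 3] by auto
  have face: "\<exists>F. \<exists>p\<in>Q 1. \<exists>q\<in>Q 2. \<exists>x\<in>Q i. meets F {p,q,x}" if "i \<in> {0,3}" for i
    by (rule side_face[where W = ?W]) (use that T Q(2) cov D[of 1 2] dW diff in auto)
  obtain F0 p0 q0 x0 where F0: "p0 \<in> Q 1" "q0 \<in> Q 2" "x0 \<in> Q 3" "meets F0 {p0,q0,x0}" using face[of 3] by auto
  obtain G pg qg xg where G: "pg \<in> Q 1" "qg \<in> Q 2" "xg \<in> Q 0" "meets G {pg,qg,xg}" using face[of 0] by auto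
  \<comment> \<open>\<open>G\<close> uses up one of the two possible faces between
    \<open>Q 1\<close> and \<open>Q 2\<close>, so the three outer sets have just one.\<close>
  have uniq: "F = F0" if F: "p \<in> Q 1" "q \<in> Q 2" "x \<in> Q 3" "meets F {p,q,x}" for F p q x
  proof (rule ccontr)
    assume "F \<noteq> F0"
    moreover have "F0 \<noteq> G" by (rule face_ne[OF F0(4) G(4)]) (use F0 G D[of 1 2] D[of 1 3] D[of 2 3] D[of 0 1] D[of 0 2] D[of 0 3] in auto)
    moreover have "F \<noteq> G" by (rule face_ne[OF F(4) G(4)]) (use F G D[of 1 2] D[of 1 3] D[of 2 3] D[of 0 1] D[of 0 2] D[of 0 3] in auto)
    ultimately show False
      using three_faces[OF Q(2)[of 1] Q(2)[of 2] W D[of 1 2] dW cov F(1,2) _ F(4) F0(1,2) _ F0(4) G(1,2) _ G(4)] F F0 G by auto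
  qed
  \<comment> \<open>Each outer set is extended by the inner vertices of its colour; tricoloured
    faces become the faces counted by \<open>even_tri\<close>.\<close>
  define R where "R k = Q k \<union> {x \<in> P 0. col x = k}" for k
  have R12: "R 1 \<inter> R 2 = {}" using D[of 1 2] D[of 0 1] D[of 0 2] X by (auto simp: R_def)
  have R3: "t \<in> R 3" if "t \<notin> R 1 \<union> R 2" "t \<in> U" for t using that cov X col by (auto simp: R_def)
  have R3': "t \<notin> R 1 \<union> R 2" if "t \<in> R 3" for t using that D[of 1 3] D[of 2 3] D[of 0 1] D[of 0 2] D[of 0 3] X by (auto simp: R_def)
  let ?T = "{F. tri (f -` R 1) (f -` R 2) F}"
  have dd: "f -` R 1 \<inter> f -` R 2 = {}" using R12 by auto
  have ev: "even (card ?T)" and fin: "finite ?T"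
    using even_tri[OF dd finite_cross[OF R12]] finite_tri[OF dd finite_cross[OF R12]] by auto
  have "F0 \<in> ?T" unfolding mem_Collect_eq by (rule triI[OF R12 _ _ _ F0(4)]) (use F0 R3'[of x0] in \<open>auto simp: R_def\<close>)
  \<comment> \<open>\<open>F0\<close> is one of an even number, so there is a second face, and by
    \<open>uniq\<close> it has a vertex in \<open>P 0\<close>.\<close>
  hence "?T \<noteq> {F0}" using ev by auto
  then obtain F where F: "F \<in> ?T" "F \<noteq> F0" using \<open>F0 \<in> ?T\<close> by auto
  then obtain x1 x2 x3 where x: "x1 \<in> R 1" "x2 \<in> R 2" "x3 \<notin> R 1 \<union> R 2" "meets F {x1,x2,x3}"
    unfolding mem_Collect_eq by (elim triE)
  have "x3 \<in> U" using meets_U[OF x(4)] by blast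
  hence x3: "x3 \<in> R 3" using R3 x by auto
  have f3: "face3 x1 x2 x3" using x(4) unfolding face3_def meets_def by blast
  have inP: "x1 \<in> P 0 \<or> x2 \<in> P 0 \<or> x3 \<in> P 0"
    using uniq[of x1 x2 x3 F] F(2) x x3 by (auto simp: R_def)
  \<comment> \<open>The conclusion speaks of \<open>P k\<close>, not of the enlarged
    \<open>Q k\<close>; closeness to \<open>P 0\<close> makes up the difference.\<close>
  have nb: "y \<in> P 0 \<union> P 1 \<union> P 2 \<union> P 3" if "y \<in> {x1,x2,x3}" for y
  proof -
    obtain z where z: "z \<in> P 0" "z \<in> {x1,x2,x3}" using inP by auto
    have "z = y \<or> adj z y" using f3 face3_adj face3_perm z that by (metis insertE singletonD)
    thus ?thesis using N z by blast
  qed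
  have mem: "y \<in> P k \<or> (y \<in> P 0 \<and> col y = k)" if yR: "y \<in> R k" and yx: "y \<in> {x1,x2,x3}" and kk: "k \<in> {1,2,3}" for k y
  proof (cases "y \<in> P 0")
    case True
    hence "y \<notin> Q k" using D[of 0 k] X kk by auto
    thus ?thesis using yR True by (auto simp: R_def)
  next
    case False
    hence "y \<in> Q k" using yR by (auto simp: R_def)
    moreover obtain m where m: "m \<in> {1,2,3}" "y \<in> P m" using nb[OF yx] False by auto
    moreover have "y \<in> Q m" using m Q(1)[of m] by auto
    ultimately have "m = k" using D[of k m] kk by auto
    thus ?thesis using m by blast
  qed
  show ?thesis
    using f3 inP mem[of x1 1] mem[of x2 2] mem[of x3 3] x x3 by (intro exI[of _ x1] exI[of _ x2] exI[of _ x3]) auto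
qed

text \<open>Three mutually touching sets have a face at the first two and something else, and the
  neighbours of \<open>P 0\<close> leave only \<open>P 2\<close> for its third vertex.\<close>

lemma digon_face:
  assumes s: "sys P 3" and t: "\<And>i j. i < 3 \<Longrightarrow> j < 3 \<Longrightarrow> i \<noteq> j \<Longrightarrow> touch adj (P i) (P j)"
    and N: "\<And>x y. x \<in> P 0 \<Longrightarrow> adj x y \<Longrightarrow> y \<in> P 0 \<union> P 1 \<union> P 2"
  shows "\<exists>x\<in>P 0. \<exists>a\<in>P 1. \<exists>b\<in>P 2. face3 x a b"
proof -
  have d: "P 0 \<inter> P 1 = {}" "P 0 \<inter> P 2 = {}" "P 1 \<inter> P 2 = {}" and c: "conn adj (P 0)" "conn adj (P 1)" "conn adj (P 2)"
    using s by (auto simp: sys_def)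
  have "\<exists>F. tri (f -` P 0) (f -` P 1) F \<and> fv F \<inter> {} = {}"
    using d by (intro tri_exists_avoiding[of _ _ "f -` P 2"] vimage_conn vimage_touch c t finite_cross) auto
  then obtain F where F: "tri (f -` P 0) (f -` P 1) F" by blast
  then obtain p q x where x: "p \<in> P 0" "q \<in> P 1" "x \<notin> P 0 \<union> P 1" "meets F {p,q,x}"
    by (rule triE)
  have f3: "face3 p q x" using x(4) unfolding face3_def meets_def by blast
  hence "adj p x" using face3_adj face3_perm x by (metis UnI1)
  hence "x \<in> P 2" using N x by blast
  thus ?thesis using x f3 by blast
qed

end

section \<open>Tripod decomposition\<close>

context cell_quotient begin

text \<open>On explicit lists the pairwise conditions unfold to finitely many facts for the
  simplifier. \<open>touching_parts\<close> asks for one direction; symmetry gives the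
  other.\<close>

fun disjoint_parts :: "'v set list \<Rightarrow> bool" where
  "disjoint_parts [] \<longleftrightarrow> True"
| "disjoint_parts (S # xs) \<longleftrightarrow> S \<subseteq> U \<and> conn adj S \<and> (\<forall>T\<in>set xs. S \<inter> T = {}) \<and> disjoint_parts xs"

fun touching_parts :: "'v set list \<Rightarrow> bool" where
  "touching_parts [] \<longleftrightarrow> True"
| "touching_parts (S # xs) \<longleftrightarrow> (\<forall>T\<in>set xs. touch adj S T) \<and> touching_parts xs"

lemma sys_list: "disjoint_parts xs \<Longrightarrow> sys ((!) xs) (length xs)"
proof (induction xs)
  case (Cons S xs)
  hence IH: "sys ((!) xs) (length xs)" by simp
  show ?case unfolding sys_def
  proof (intro conjI allI impI)
    fix i assume i: "i < length (S # xs)"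
    show "(S # xs) ! i \<subseteq> U" "conn adj ((S # xs) ! i)"
      using i IH Cons.prems by (cases i; simp add: sys_def)+
    fix j assume j: "j < length (S # xs)" "i \<noteq> j"
    have d: "S \<inter> xs ! k = {}" if "k < length xs" for k using Cons.prems that nth_mem by auto
    show "(S # xs) ! i \<inter> (S # xs) ! j = {}"
    proof (cases i)
      case 0 thus ?thesis using i j d by (cases j) auto
    next
      case (Suc i')
      show ?thesis
      proof (cases j)
        case 0 thus ?thesis using i Suc d[of i'] by auto
      next
        case (Suc j')
        thus ?thesis using \<open>i = Suc i'\<close> i j IH by (simp add: sys_def)
      qed
    qed
  qed
qed (simp add: sys_def)

lemma tch_nth: "touching_parts xs \<Longrightarrow> i < length xs \<Longrightarrow> j < length xs \<Longrightarrow> i \<noteq> j \<Longrightarrow> touch adj (xs ! i) (xs ! j)"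
proof (induction xs arbitrary: i j)
  case (Cons S xs)
  have d: "touch adj S (xs ! k)" if "k < length xs" for k using Cons.prems(1) that nth_mem by auto
  show ?case
  proof (cases i)
    case 0 thus ?thesis using Cons.prems d by (cases j) auto
  next
    case (Suc i')
    thus ?thesis using Cons d[of i'] touch_sym[OF symp_adj] by (cases j) auto
  qed
qed simp

lemma K5_list:
  assumes "disjoint_parts [A,B,C,D,E]" "touching_parts [A,B,C,D,E]" shows False
proof (rule no_K5[of "(!) [A,B,C,D,E]"])
  show "sys ((!) [A,B,C,D,E]) 5" using sys_list[OF assms(1)] by (simp add: eval_nat_numeral)
  show "touch adj ([A,B,C,D,E] ! i) ([A,B,C,D,E] ! j)" if "i < 5" "j < 5" "i \<noteq> j" for i j
    using tch_nth[OF assms(2), of i j] that by simp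
qed

lemma three_sides_list:
  assumes "disjoint_parts [A,B,C,X,Y,Z]" "touching_parts [A,B,C]" "\<forall>S\<in>{A,B,C}. \<forall>T\<in>{X,Y,Z}. touch adj S T"
  shows False
proof (rule no_three_sides[of "(!) [A,B,C,X,Y,Z]"])
  show "sys ((!) [A,B,C,X,Y,Z]) 6" using sys_list[OF assms(1)] by (simp add: eval_nat_numeral)
  fix i j :: nat assume ij: "i < 3" "j < 6" "i \<noteq> j"
  show "touch adj ([A,B,C,X,Y,Z] ! i) ([A,B,C,X,Y,Z] ! j)"
  proof (cases "j < 3")
    case True
    have "[A,B,C,X,Y,Z] ! k = [A,B,C] ! k" if "k < 3" for k using that by (auto simp: less_Suc_eq numeral_3_eq_3)
    thus ?thesis using tch_nth[OF assms(2), of i j] ij True by simp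
  next
    case False
    hence "j = 3 \<or> j = 4 \<or> j = 5" using ij by linarith
    moreover have "i = 0 \<or> i = 1 \<or> i = 2" using ij by linarith
    ultimately show ?thesis using assms(3) by (elim disjE) (simp_all add: eval_nat_numeral)
  qed
qed

lemma two_sides_face_list:
  assumes "disjoint_parts [A,B,C,X,Y]" "touching_parts [A,B,C]" "\<forall>S\<in>{A,B,C}. \<forall>T\<in>{X,Y}. touch adj S T" "a \<in> A" "b \<in> B" "c \<in> C" "face3 a b c"
  shows False
proof (rule no_two_sides_and_face[of "(!) [A,B,C,X,Y]" a b c])
  show "sys ((!) [A,B,C,X,Y]) 5" using sys_list[OF assms(1)] by (simp add: eval_nat_numeral)
  fix i j :: nat assume ij: "i < 3" "j < 5" "i \<noteq> j"
  show "touch adj ([A,B,C,X,Y] ! i) ([A,B,C,X,Y] ! j)"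
  proof (cases "j < 3")
    case True
    have "[A,B,C,X,Y] ! k = [A,B,C] ! k" if "k < 3" for k using that by (auto simp: less_Suc_eq numeral_3_eq_3)
    thus ?thesis using tch_nth[OF assms(2), of i j] ij True by simp
  next
    case False
    hence "j = 3 \<or> j = 4" using ij by linarith
    moreover have "i = 0 \<or> i = 1 \<or> i = 2" using ij by linarith
    ultimately show ?thesis using assms(3) by (elim disjE) (simp_all add: eval_nat_numeral)
  qed
qed (use assms in \<open>simp_all add: eval_nat_numeral\<close>)

lemma sperner_list:
  assumes "disjoint_parts [X,A,B,C]" "touching_parts [X,A,B,C]" and N: "\<And>x y. x \<in> X \<Longrightarrow> adj x y \<Longrightarrow> y \<in> X \<union> A \<union> B \<union> C"
    and col: "\<And>x. x \<in> X \<Longrightarrow> col x \<in> {0,1,2::nat}"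
  shows "\<exists>a b c. face3 a b c \<and> (a \<in> A \<or> (a \<in> X \<and> col a = 0)) \<and> (b \<in> B \<or> (b \<in> X \<and> col b = 1)) \<and> 
    (c \<in> C \<or> (c \<in> X \<and> col c = 2)) \<and> (a \<in> X \<or> b \<in> X \<or> c \<in> X)"
proof -
  have "sys ((!) [X,A,B,C]) 4" using sys_list[OF assms(1)] by (simp add: eval_nat_numeral)
  moreover have "touch adj ([X,A,B,C] ! i) ([X,A,B,C] ! j)" if "i < 4" "j < 4" "i \<noteq> j" for i j
    using tch_nth[OF assms(2), of i j] that by simp
  moreover have "y \<in> [X,A,B,C] ! 0 \<union> [X,A,B,C] ! 1 \<union> [X,A,B,C] ! 2 \<union> [X,A,B,C] ! 3" if "x \<in> [X,A,B,C] ! 0" "adj x y" for x y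
    using N[of x y] that by (simp add: eval_nat_numeral)
  moreover have "Suc (col x) \<in> {1,2,3}" if "x \<in> [X,A,B,C] ! 0" for x using col[of x] that by auto
  ultimately have "\<exists>x1 x2 x3. face3 x1 x2 x3 \<and> (\<forall>(k,x)\<in>{(1,x1),(2,x2),(3,x3)}. x \<in> [X,A,B,C] ! k \<or> (x \<in> [X,A,B,C] ! 0 \<and> Suc (col x) = k))
     \<and> (x1 \<in> [X,A,B,C] ! 0 \<or> x2 \<in> [X,A,B,C] ! 0 \<or> x3 \<in> [X,A,B,C] ! 0)" by (rule sperner)
  thus ?thesis by (simp add: eval_nat_numeral)
qed

lemma digon_list:
  assumes "disjoint_parts [X,A,B]" "touching_parts [X,A,B]" and N: "\<And>x y. x \<in> X \<Longrightarrow> adj x y \<Longrightarrow> y \<in> X \<union> A \<union> B"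
  shows "\<exists>x\<in>X. \<exists>a\<in>A. \<exists>b\<in>B. face3 x a b"
proof -
  have "sys ((!) [X,A,B]) 3" using sys_list[OF assms(1)] by (simp add: eval_nat_numeral)
  moreover have "touch adj ([X,A,B] ! i) ([X,A,B] ! j)" if "i < 3" "j < 3" "i \<noteq> j" for i j
    using tch_nth[OF assms(2), of i j] that by simp
  moreover have "y \<in> [X,A,B] ! 0 \<union> [X,A,B] ! 1 \<union> [X,A,B] ! 2" if "x \<in> [X,A,B] ! 0" "adj x y" for x y
    using N[of x y] that by (simp add: eval_nat_numeral)
  ultimately have "\<exists>x\<in>[X,A,B]!0. \<exists>a\<in>[X,A,B]!1. \<exists>b\<in>[X,A,B]!2. face3 x a b" by (rule digon_face)
  thus ?thesis by (simp add: eval_nat_numeral)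
qed

section \<open>Connected components of a vertex set\<close>

definition cmp :: "'v set \<Rightarrow> 'v \<Rightarrow> 'v set" where
  "cmp X x = {y. y \<in> X \<and> (restr adj X)\<^sup>*\<^sup>* x y}"

definition iscmp :: "'v set \<Rightarrow> 'v set \<Rightarrow> bool" where
  "iscmp X Z \<longleftrightarrow> (\<exists>x\<in>X. Z = cmp X x)"

lemma cmp_self: "x \<in> X \<Longrightarrow> x \<in> cmp X x" by (simp add: cmp_def)

lemma cmp_sub: "cmp X x \<subseteq> X" by (auto simp: cmp_def)

lemma cmp_eq: "y \<in> cmp X x \<Longrightarrow> cmp X y = cmp X x"
proof -
  assume y: "y \<in> cmp X x"
  hence "(restr adj X)\<^sup>*\<^sup>* x y" "(restr adj X)\<^sup>*\<^sup>* y x" using restr_sym[OF symp_adj] by (auto simp: cmp_def)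
  thus ?thesis unfolding cmp_def by (meson rtranclp_trans)
qed

lemma cmp_closed: "y \<in> cmp X x \<Longrightarrow> adj y z \<Longrightarrow> z \<in> X \<Longrightarrow> z \<in> cmp X x"
  unfolding cmp_def restr_def by (auto intro: rtranclp.rtrancl_into_rtrancl)

lemma cmp_conn: assumes "x \<in> X" shows "conn adj (cmp X x)"
proof (rule conn_star[OF symp_adj cmp_self[OF assms]])
  fix y assume "y \<in> cmp X x"
  hence "(restr adj X)\<^sup>*\<^sup>* x y" by (simp add: cmp_def)
  thus "(restr adj (cmp X x))\<^sup>*\<^sup>* x y"
  proof (induction rule: rtranclp_induct)
    case (step y z)
    hence "(restr adj X)\<^sup>*\<^sup>* x y" "adj y z" "y \<in> X" "z \<in> X" by (auto simp: restr_def)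
    hence "y \<in> cmp X x" "z \<in> cmp X x" using step cmp_closed[of y X x z] by (auto simp: cmp_def)
    hence "restr adj (cmp X x) y z" using \<open>adj y z\<close> by (simp add: restr_def)
    with step.IH show ?case by (rule rtranclp.rtrancl_into_rtrancl)
  qed simp
qed

lemma conn_in_cmp: 
  assumes "conn adj S" "S \<subseteq> X" "x \<in> S" shows "S \<subseteq> cmp X x"
proof
  fix y assume "y \<in> S"
  hence "(restr adj S)\<^sup>*\<^sup>* x y" using assms by (auto simp: conn_def)
  from restr_mono[OF assms(2) this] show "y \<in> cmp X x" using \<open>y \<in> S\<close> assms by (auto simp: cmp_def)
qed

lemma iscmpD: assumes "iscmp X Z" shows "Z \<subseteq> X" "Z \<noteq> {}" "conn adj Z" "z \<in> Z \<Longrightarrow> Z = cmp X z"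
  "z \<in> Z \<Longrightarrow> adj z y \<Longrightarrow> y \<in> X \<Longrightarrow> y \<in> Z"
proof -
  obtain x where x: "x \<in> X" "Z = cmp X x" using assms by (auto simp: iscmp_def)
  show "Z \<subseteq> X" "Z \<noteq> {}" "conn adj Z" using x cmp_sub cmp_self cmp_conn by blast+
  show "z \<in> Z \<Longrightarrow> Z = cmp X z" using x cmp_eq by blast
  show "z \<in> Z \<Longrightarrow> adj z y \<Longrightarrow> y \<in> X \<Longrightarrow> y \<in> Z" using x cmp_closed by blast
qed

lemma iscmp_disj: "iscmp X Z \<Longrightarrow> iscmp X Z' \<Longrightarrow> Z \<noteq> Z' \<Longrightarrow> Z \<inter> Z' = {}"
  using iscmpD(4)[of X Z] iscmpD(4)[of X Z'] by blast

lemma iscmp_in: assumes "iscmp X Z" "X \<subseteq> X'" obtains Z' where "iscmp X' Z'" "Z \<subseteq> Z'"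
proof -
  obtain z where z: "z \<in> Z" using iscmpD(2)[OF assms(1)] by blast
  have "Z \<subseteq> cmp X' z" by (rule conn_in_cmp) (use z iscmpD[OF assms(1)] assms(2) in blast)+
  moreover have "iscmp X' (cmp X' z)" unfolding iscmp_def using z iscmpD(1)[OF assms(1)] assms(2) by blast
  ultimately show ?thesis using that by blast
qed

lemma iscmp_cmp: "x \<in> X \<Longrightarrow> iscmp X (cmp X x)" unfolding iscmp_def by blast

lemma touch_subset: "touch adj Z A \<Longrightarrow> Z \<subseteq> Z' \<Longrightarrow> touch adj Z' A" unfolding touch_def by blast

end

locale layered = cell_quotient f for f :: "cell \<Rightarrow> 'v" +
  fixes rt :: 'v and L :: "'v \<Rightarrow> nat" and up :: "'v \<Rightarrow> 'v"
  assumes rt: "rt \<in> U"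
    and up: "u \<in> U \<Longrightarrow> u \<noteq> rt \<Longrightarrow> adj u (up u) \<and> L u = Suc (L (up u))"
begin

section \<open>Vertical paths: the ancestors of a vertex up to the first one outside a given
  set\<close>

definition path_len :: "'v set \<Rightarrow> 'v \<Rightarrow> nat" where "path_len X x = (LEAST n. (up ^^ n) x \<notin> X)"

definition vertical_path :: "'v set \<Rightarrow> 'v \<Rightarrow> 'v set" where "vertical_path X x = (\<lambda>n. (up ^^ n) x) ` {..<path_len X x}"

definition path_exit :: "'v set \<Rightarrow> 'v \<Rightarrow> 'v" where "path_exit X x = (up ^^ path_len X x) x"

context
  fixes X assumes X: "X \<subseteq> U" "rt \<notin> X"
begin

lemma up_X: "x \<in> X \<Longrightarrow> adj x (up x) \<and> L x = Suc (L (up x))"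
  using up X by blast

lemma ht_in: "n < path_len X x \<Longrightarrow> (up ^^ n) x \<in> X"
  unfolding path_len_def using not_less_Least by blast

lemma L_up: "n \<le> path_len X x \<Longrightarrow> L ((up ^^ n) x) + n = L x"
proof (induction n)
  case (Suc n)
  hence "(up ^^ n) x \<in> X" using ht_in by auto
  thus ?case using up_X Suc by fastforce
qed simp

text \<open>\<open>L\<close> drops at every step taken from a vertex of \<open>X\<close>, so the
  ancestors cannot stay in \<open>X\<close> forever.\<close>

lemma exit_notin: "path_exit X x \<notin> X"
proof -
  have "\<exists>n. (up ^^ n) x \<notin> X"
  proof (rule ccontr)
    assume a: "\<nexists>n. (up ^^ n) x \<notin> X"
    have "L ((up ^^ n) x) + n = L x" for n
    proof (induction n)
      case (Suc n)
      have "(up ^^ n) x \<in> X" using a by blast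
      thus ?case using up_X Suc by fastforce
    qed simp
    from this[of "Suc (L x)"] show False by simp
  qed
  thus ?thesis unfolding path_exit_def path_len_def by (rule LeastI_ex)
qed

lemma ht_pos: "x \<in> X \<Longrightarrow> 0 < path_len X x"
  using exit_notin[of x] unfolding path_exit_def by (cases "path_len X x") auto

lemma vp_self: "x \<in> X \<Longrightarrow> x \<in> vertical_path X x"
  unfolding vertical_path_def using ht_pos by (intro image_eqI[of _ _ 0]) auto

lemma vp_sub: "vertical_path X x \<subseteq> X"
  unfolding vertical_path_def using ht_in by blast

lemma vp_conn: assumes "x \<in> X" shows "conn adj (vertical_path X x)"
proof (rule conn_star[OF symp_adj vp_self[OF assms]])
  fix y assume "y \<in> vertical_path X x"
  then obtain n where n: "n < path_len X x" "y = (up ^^ n) x" by (auto simp: vertical_path_def)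
  have "(restr adj (vertical_path X x))\<^sup>*\<^sup>* x ((up ^^ n) x)" using n(1)
  proof (induction n)
    case (Suc n)
    have "(up ^^ n) x \<in> vertical_path X x" "(up ^^ Suc n) x \<in> vertical_path X x" using Suc by (auto simp: vertical_path_def intro!: image_eqI)
    moreover have "adj ((up ^^ n) x) ((up ^^ Suc n) x)" using up_X[OF ht_in[of n x]] Suc by simp
    ultimately have "restr adj (vertical_path X x) ((up ^^ n) x) ((up ^^ Suc n) x)" by (simp add: restr_def)
    with Suc.IH show ?case using Suc.prems by (meson Suc_lessD rtranclp.rtrancl_into_rtrancl)
  qed simp
  thus "(restr adj (vertical_path X x))\<^sup>*\<^sup>* x y" using n by simp
qed

text \<open>Each step up lowers the layer by one. This is why leg and layer identify a vertex of a
  tripod.\<close>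

lemma vp_inj: "inj_on L (vertical_path X x)"
proof (rule inj_onI)
  fix y z assume "y \<in> vertical_path X x" "z \<in> vertical_path X x" "L y = L z"
  then obtain n m where n: "n < path_len X x" "y = (up ^^ n) x" and m: "m < path_len X x" "z = (up ^^ m) x" by (auto simp: vertical_path_def)
  have "n = m" using L_up[of n x] L_up[of m x] n m \<open>L y = L z\<close> by simp
  thus "y = z" using n m by simp
qed

lemma vp_exit: assumes "x \<in> X" shows "\<exists>y\<in>vertical_path X x. adj y (path_exit X x)"
proof -
  obtain n where n: "path_len X x = Suc n" using ht_pos[OF assms] by (cases "path_len X x") auto
  have "(up ^^ n) x \<in> vertical_path X x" using n by (auto simp: vertical_path_def intro!: image_eqI)
  moreover have "adj ((up ^^ n) x) (path_exit X x)" using up_X[OF ht_in[of n x]] n by (simp add: path_exit_def)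
  ultimately show ?thesis by blast
qed

end

text \<open>Neither connectedness of \<open>X\<close> nor nonempty corners are demanded. The last
  two clauses replace the cyclic order on a boundary curve: corners seen by one component touch each
  other, and at most one component sees all three, so a single tripod can cut it.\<close>

definition region :: "(nat \<Rightarrow> 'v set) \<Rightarrow> 'v set \<Rightarrow> bool" where
  "region A X \<longleftrightarrow> X \<subseteq> U \<and> rt \<notin> X \<and> (\<forall>k<3. A k \<subseteq> U \<and> conn adj (A k) \<and> A k \<inter> X = {}) \<and>
    (\<forall>i<3. \<forall>j<3. i \<noteq> j \<longrightarrow> A i \<inter> A j = {}) \<and>
    (\<forall>x\<in>X. \<forall>y. adj x y \<longrightarrow> y \<in> X \<or> (\<exists>k<3. y \<in> A k)) \<and>
    (\<forall>Z i j. iscmp X Z \<longrightarrow> i < 3 \<longrightarrow> j < 3 \<longrightarrow> i \<noteq> j \<longrightarrow> touch adj Z (A i) \<longrightarrow> touch adj Z (A j) \<longrightarrow> touch adj (A i) (A j)) \<and>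
    (\<forall>Z Z'. iscmp X Z \<longrightarrow> iscmp X Z' \<longrightarrow> (\<forall>k<3. touch adj Z (A k) \<and> touch adj Z' (A k)) \<longrightarrow> Z = Z')"

text \<open>The tripod that is placed next in a region: \<open>lg\<close> numbers its legs, which are vertical paths, and every remaining
  component loses contact with one of the old corners, so that the tripod can replace that corner.\<close>

definition separator :: "(nat \<Rightarrow> 'v set) \<Rightarrow> 'v set \<Rightarrow> 'v set \<Rightarrow> ('v \<Rightarrow> nat) \<Rightarrow> bool" where
  "separator A X Y lg \<longleftrightarrow> Y \<subseteq> X \<and> Y \<noteq> {} \<and> conn adj Y \<and> (\<forall>y\<in>Y. lg y < 3) \<and>
    (\<forall>y\<in>Y. \<forall>z\<in>Y. lg y = lg z \<and> L y = L z \<longrightarrow> y = z) \<and>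
    (\<forall>Z. iscmp (X - Y) Z \<longrightarrow> (\<exists>k<3. \<not> touch adj Z (A k))) \<and>
    (\<forall>Z j. iscmp (X - Y) Z \<longrightarrow> j < 3 \<longrightarrow> touch adj Z Y \<longrightarrow> touch adj Z (A j) \<longrightarrow> touch adj Y (A j)) \<and>
    (\<forall>Z Z' k. iscmp (X - Y) Z \<longrightarrow> iscmp (X - Y) Z' \<longrightarrow> k < 3 \<longrightarrow> touch adj Z Y \<longrightarrow> touch adj Z' Y \<longrightarrow>
       (\<forall>j<3. j \<noteq> k \<longrightarrow> touch adj Z (A j) \<and> touch adj Z' (A j)) \<longrightarrow> Z = Z')"

context
  fixes A X assumes reg: "region A X"
begin

lemmas regc = reg[unfolded region_def]

lemma reg_X: "X \<subseteq> U" "rt \<notin> X"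
  by (rule regc[THEN conjunct1], rule regc[THEN conjunct2, THEN conjunct1])

lemma reg_A: 
  shows "k < 3 \<Longrightarrow> A k \<subseteq> U" "k < 3 \<Longrightarrow> conn adj (A k)" "k < 3 \<Longrightarrow> A k \<inter> X = {}"
    "i < 3 \<Longrightarrow> j < 3 \<Longrightarrow> i \<noteq> j \<Longrightarrow> A i \<inter> A j = {}"
  using regc[THEN conjunct2, THEN conjunct2, THEN conjunct1] regc[THEN conjunct2, THEN conjunct2, THEN conjunct2, THEN conjunct1]
  by simp_all

lemma reg_N: "x \<in> X \<Longrightarrow> adj x y \<Longrightarrow> y \<in> X \<or> (\<exists>k<3. y \<in> A k)"
  using regc[THEN conjunct2, THEN conjunct2, THEN conjunct2, THEN conjunct2, THEN conjunct1] by simp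

lemma reg_touch: "iscmp X Z \<Longrightarrow> i < 3 \<Longrightarrow> j < 3 \<Longrightarrow> i \<noteq> j \<Longrightarrow> touch adj Z (A i) \<Longrightarrow> touch adj Z (A j) \<Longrightarrow> touch adj (A i) (A j)"
  using regc[THEN conjunct2, THEN conjunct2, THEN conjunct2, THEN conjunct2, THEN conjunct2, THEN conjunct1] by (elim allE impE) assumption+

lemma reg_unique: "iscmp X Z \<Longrightarrow> iscmp X Z' \<Longrightarrow> \<forall>k<3. touch adj Z (A k) \<and> touch adj Z' (A k) \<Longrightarrow> Z = Z'"
  using regc[THEN conjunct2, THEN conjunct2, THEN conjunct2, THEN conjunct2, THEN conjunct2, THEN conjunct2] by (drule_tac spec[of _ Z], drule_tac spec[of _ Z']) simp

lemma exit_A: assumes "x \<in> X" shows "\<exists>k<3. path_exit X x \<in> A k \<and> touch adj (vertical_path X x) (A k)"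
proof -
  obtain y where y: "y \<in> vertical_path X x" "adj y (path_exit X x)" using vp_exit[OF reg_X assms] by blast
  have "y \<in> X" using y vp_sub[OF reg_X] by blast
  then obtain k where "k < 3" "path_exit X x \<in> A k" using reg_N y(2) exit_notin[OF reg_X] by blast
  thus ?thesis using y unfolding touch_def by blast
qed

lemma vp_in_cmp:
  assumes "iscmp X Z" "x \<in> Z" shows "vertical_path X x \<subseteq> Z"
proof -
  have x: "x \<in> X" using iscmpD(1)[OF assms(1)] assms(2) by blast
  have "vertical_path X x \<subseteq> cmp X x"
    by (rule conn_in_cmp[OF vp_conn[OF reg_X x] vp_sub[OF reg_X] vp_self[OF reg_X x]])
  thus ?thesis using iscmpD(4)[OF assms] by simp
qed

text \<open>Removing \<open>Y\<close> affects only the component around it: since \<open>Z1\<close>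
  is connected, each of its pieces touches \<open>Y\<close>, and all other components survive
  unchanged.\<close>

lemma sub_cmp:
  assumes Z1: "iscmp X Z1" and Y: "Y \<subseteq> Z1" "Y \<noteq> {}" and Z: "iscmp (X - Y) Z"
  shows "(Z \<subseteq> Z1 \<and> touch adj Z Y) \<or> (iscmp X Z \<and> Z \<inter> Z1 = {} \<and> \<not> touch adj Z Y)"
proof -
  obtain Z0 where Z0: "iscmp X Z0" "Z \<subseteq> Z0" by (rule iscmp_in[OF Z Diff_subset])
  note d = iscmpD[OF Z] and d1 = iscmpD[OF Z1] and d0 = iscmpD[OF Z0(1)]
  show ?thesis
  proof (cases "Z0 = Z1")
    case True
    obtain z y where zy: "z \<in> Z" "y \<in> Y" using d(2) Y(2) by blast
    have "y \<notin> Z" using d(1) zy by blast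
    moreover have "z \<in> Z1" "y \<in> Z1" using zy Z0 True Y by auto
    ultimately obtain a b where ab: "a \<in> Z1" "b \<in> Z1" "adj a b" "a \<in> Z" "b \<notin> Z"
      using conn_leaves[OF d1(3) _ _ zy(1)] by blast
    have "b \<in> X" using ab d1(1) by blast
    hence "b \<in> Y" using d(5)[OF ab(4,3)] ab(5) by blast
    thus ?thesis using Z0 True ab unfolding touch_def by blast
  next
    case False
    have dj: "Z0 \<inter> Z1 = {}" by (rule iscmp_disj[OF Z0(1) Z1 False])
    have "\<not> touch adj Z Y"
    proof
      assume "touch adj Z Y"
      then obtain a b where ab: "a \<in> Z" "b \<in> Y" "adj a b" unfolding touch_def by blast
      have "b \<in> X" using ab Y d1(1) by blast
      hence "b \<in> Z0" using d0(5) ab Z0 by blast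
      thus False using ab Y dj by blast
    qed
    moreover have "Z0 \<subseteq> Z"
    proof -
      obtain z where z: "z \<in> Z" using d(2) by blast
      have "Z0 \<subseteq> X - Y" using d0(1) dj Y by blast
      hence "Z0 \<subseteq> cmp (X - Y) z" using conn_in_cmp[OF d0(3)] z Z0 by blast
      thus ?thesis using d(4)[OF z] by blast
    qed
    moreover have "Z = Z0" using calculation(2) Z0(2) by blast
    ultimately show ?thesis using Z0(1) dj by simp
  qed
qed

lemma three: "k < (3::nat) \<Longrightarrow> k = 0 \<or> k = 1 \<or> k = 2" by linarith

text \<open>The vertical paths from the vertices of a tricoloured face end in three different
  corners and form the tripod. A vertex that already lies in its corner contributes no leg.\<close>

lemma separator_three:
  assumes Z1: "iscmp X Z1" and t: "\<And>k. k < 3 \<Longrightarrow> touch adj Z1 (A k)"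
  shows "\<exists>Y lg. separator A X Y lg"
proof -
  note d1 = iscmpD[OF Z1]
  have ZU: "Z1 \<subseteq> U" using d1(1) reg_X by blast
  have ZA: "Z1 \<inter> A k = {}" if "k < 3" for k using d1(1) reg_A(3)[OF that] by blast
  have AA: "touch adj (A i) (A j)" if "i < 3" "j < 3" "i \<noteq> j" for i j by (rule reg_touch[OF Z1 that t[OF that(1)] t[OF that(2)]])
  \<comment> \<open>The Sperner colour of a vertex is the corner in which its vertical path
    ends.\<close>
  define col where "col x = (SOME k. k < 3 \<and> path_exit X x \<in> A k \<and> touch adj (vertical_path X x) (A k))" for x
  have col: "col x < 3" "touch adj (vertical_path X x) (A (col x))" if "x \<in> X" for x
    using someI_ex[OF exit_A[OF that]] unfolding col_def by blast+
  have "\<exists>a b c. face3 a b c \<and> (a \<in> A 0 \<or> (a \<in> Z1 \<and> col a = 0)) \<and> (b \<in> A 1 \<or> (b \<in> Z1 \<and> col b = 1)) \<and> 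
    (c \<in> A 2 \<or> (c \<in> Z1 \<and> col c = 2)) \<and> (a \<in> Z1 \<or> b \<in> Z1 \<or> c \<in> Z1)"
  proof (rule sperner_list)
    show "disjoint_parts [Z1, A 0, A 1, A 2]" using ZU d1(3) ZA reg_A by simp
    show "touching_parts [Z1, A 0, A 1, A 2]" using t AA by simp
    show "y \<in> Z1 \<union> A 0 \<union> A 1 \<union> A 2" if "x \<in> Z1" "adj x y" for x y
      using reg_N[of x y] d1(5)[OF that] that d1(1) three by blast
    show "col x \<in> {0,1,2}" if "x \<in> Z1" for x using col(1)[of x] that d1(1) by (auto dest: three)
  qed
  then obtain a b c where abc: "face3 a b c" "a \<in> A 0 \<or> (a \<in> Z1 \<and> col a = 0)" "b \<in> A 1 \<or> (b \<in> Z1 \<and> col b = 1)"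
    "c \<in> A 2 \<or> (c \<in> Z1 \<and> col c = 2)" "a \<in> Z1 \<or> b \<in> Z1 \<or> c \<in> Z1" by blast
  define w where "w k = (if k = 0 then a else if k = 1 then b else c)" for k :: nat
  have w: "w k \<in> A k \<or> (w k \<in> Z1 \<and> col (w k) = k)" if "k < 3" for k using three[OF that] abc by (auto simp: w_def)
  have wadj: "w i = w j \<or> adj (w i) (w j)" if "i < 3" "j < 3" for i j
  proof -
    have sy: "w j = w i \<or> adj (w j) (w i)" if "w i = w j \<or> adj (w i) (w j)" for i j
      using that symp_adj by (metis sympD)
    have e: "w 0 = w 1 \<or> adj (w 0) (w 1)" "w 0 = w 2 \<or> adj (w 0) (w 2)" "w 1 = w 2 \<or> adj (w 1) (w 2)"
      using face3_adj[OF abc(1)] face3_adj[OF face3_perm(2)[OF abc(1)]] face3_adj[OF face3_perm(2)[OF face3_perm(1)[OF abc(1)]]]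
      by (auto simp: w_def)
    from three[OF that(1)] three[OF that(2)] show ?thesis
      by (elim disjE) (use e sy[OF e(1)] sy[OF e(2)] sy[OF e(3)] in simp_all)
  qed
  obtain k0 where k0: "k0 < 3" "w k0 \<in> Z1"
  proof -
    have "w 0 \<in> Z1 \<or> w 1 \<in> Z1 \<or> w 2 \<in> Z1" using abc(5) by (simp add: w_def)
    thus ?thesis using that[of 0] that[of 1] that[of 2] by auto
  qed
  define I where "I = {k. k < 3 \<and> w k \<in> Z1}"
  define Y where "Y = (\<Union>k\<in>I. vertical_path X (w k))"
  have I: "k < 3" "w k \<in> Z1" "w k \<in> X" if "k \<in> I" for k using that d1(1) by (auto simp: I_def)
  have YZ: "Y \<subseteq> Z1" unfolding Y_def using vp_in_cmp[OF Z1] I by blast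
  have k0I: "k0 \<in> I" using k0 by (simp add: I_def)
  have wY: "w k \<in> Y" if "k \<in> I" for k using that vp_self[OF reg_X I(3)[OF that]] by (auto simp: Y_def)
  have Yne: "Y \<noteq> {}" using wY[OF k0I] by blast
  have Yc: "conn adj Y"
  proof (rule conn_star[OF symp_adj wY[OF k0I]])
    fix y assume "y \<in> Y"
    then obtain k where k: "k \<in> I" "y \<in> vertical_path X (w k)" by (auto simp: Y_def)
    have "(restr adj Y)\<^sup>*\<^sup>* (w k0) (w k)"
    proof (cases "w k0 = w k")
      case False
      hence "restr adj Y (w k0) (w k)" using wadj[of k0 k] k0 I(1)[OF k(1)] wY[OF k0I] wY[OF k(1)] by (simp add: restr_def)
      thus ?thesis by blast
    qed simp
    moreover have "(restr adj (vertical_path X (w k)))\<^sup>*\<^sup>* (w k) y"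
      using vp_conn[OF reg_X I(3)[OF k(1)]] vp_self[OF reg_X I(3)[OF k(1)]] k(2) unfolding conn_def by blast
    hence "(restr adj Y)\<^sup>*\<^sup>* (w k) y" by (rule restr_mono[rotated]) (use k(1) in \<open>auto simp: Y_def\<close>)
    ultimately show "(restr adj Y)\<^sup>*\<^sup>* (w k0) y" by (rule rtranclp_trans)
  qed
  \<comment> \<open>Corner \<open>k\<close> is reached along leg \<open>k\<close>, or, if the face
    already has a vertex in that corner, directly from \<open>w k0\<close>.\<close>
  have YA: "touch adj Y (A k)" if k: "k < 3" for k
  proof (cases "k \<in> I")
    case True
    hence "w k \<notin> A k" using ZA[OF k] I(2) by blast
    hence "col (w k) = k" using w[OF k] by blast
    hence "touch adj (vertical_path X (w k)) (A k)" using col(2)[OF I(3)[OF True]] by simp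
    thus ?thesis using True unfolding Y_def touch_def by blast
  next
    case False
    hence wk: "w k \<in> A k" using w[OF k] k by (auto simp: I_def)
    have "w k0 \<notin> A k" using k0(2) ZA[OF k] by blast
    hence "w k0 \<noteq> w k" using wk by metis
    hence "adj (w k0) (w k)" using wadj[OF k0(1) k] by blast
    thus ?thesis using wY[OF k0I] wk unfolding touch_def by blast
  qed
  \<comment> \<open>Legs may merge at common ancestors; each vertex is assigned to one leg that
    contains it, so layers stay distinct within a leg.\<close>
  define lg where "lg y = (SOME k. k \<in> I \<and> y \<in> vertical_path X (w k))" for y
  have lg: "lg y \<in> I" "y \<in> vertical_path X (w (lg y))" if "y \<in> Y" for y
  proof -
    have "\<exists>k. k \<in> I \<and> y \<in> vertical_path X (w k)" using that by (auto simp: Y_def)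
    from someI_ex[OF this] show "lg y \<in> I" "y \<in> vertical_path X (w (lg y))" unfolding lg_def by blast+
  qed
  have YU: "Y \<subseteq> U" using YZ ZU by blast
  have Ydj: "Y \<inter> A k = {}" if "k < 3" for k using YZ ZA[OF that] by blast
  have cU: "Z \<subseteq> U" "conn adj Z" "Y \<inter> Z = {}" "Z \<inter> Y = {}" "k < 3 \<Longrightarrow> A k \<inter> Z = {}" "k < 3 \<Longrightarrow> Z \<inter> A k = {}" if "iscmp (X - Y) Z" for Z k
    using iscmpD(1,3)[OF that] reg_X(1) reg_A(3)[of k] by blast+
  have "separator A X Y lg" unfolding separator_def
  proof (intro conjI allI ballI impI)
    show "Y \<subseteq> X" using YZ d1(1) by blast
    show "Y \<noteq> {}" "conn adj Y" by fact+
    show "lg y < 3" if "y \<in> Y" for y using I(1) lg(1)[OF that] .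
    show "y = z" if "y \<in> Y" "z \<in> Y" "lg y = lg z \<and> L y = L z" for y z
      using inj_onD[OF vp_inj[OF reg_X, of "w (lg y)"]] lg(2)[OF that(1)] lg(2)[OF that(2)] that(3) by metis
    show "touch adj Y (A j)" if "j < 3" for j by (rule YA[OF that])
  next
    fix Z assume Z: "iscmp (X - Y) Z"
    show "\<exists>k<3. \<not> touch adj Z (A k)"
    proof (rule ccontr)
      assume "\<not> (\<exists>k<3. \<not> touch adj Z (A k))"
      hence tZ: "touch adj Z (A k)" if "k < 3" for k using that by blast
      from sub_cmp[OF Z1 YZ Yne Z] show False
      proof (elim disjE conjE)
        assume "iscmp X Z" "Z \<inter> Z1 = {}"
        moreover have "Z = Z1" by (rule reg_unique[OF \<open>iscmp X Z\<close> Z1]) (use tZ t in blast)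
        ultimately show False using d1(2) by blast
      next
        assume "touch adj Z Y"
        \<comment> \<open>A piece that still saw all corners would form five mutually touching sets
          with the tripod and the corners.\<close>
        hence "touching_parts [Z, Y, A 0, A 1, A 2]" using tZ YA AA by simp
        moreover have "disjoint_parts [Z, Y, A 0, A 1, A 2]" using cU[OF Z] YU Yc Ydj reg_A by simp
        ultimately show False by (rule K5_list[rotated])
      qed
    qed
  next
    fix Z Z' k assume Z: "iscmp (X - Y) Z" "iscmp (X - Y) Z'" and k: "k < (3::nat)"
      and tY: "touch adj Z Y" "touch adj Z' Y" and tA: "\<forall>j<3. j \<noteq> k \<longrightarrow> touch adj Z (A j) \<and> touch adj Z' (A j)"
    show "Z = Z'"
    proof (rule ccontr)
      assume ne: "Z \<noteq> Z'"
      have dj: "Z \<inter> Z' = {}" by (rule iscmp_disj[OF Z ne])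
      obtain i j where ij: "i < 3" "j < 3" "i \<noteq> j" "i \<noteq> k" "j \<noteq> k"
      proof -
        have "k = 0 \<or> k = 1 \<or> k = 2" by (rule three[OF k])
        thus ?thesis using that[of 1 2] that[of 0 2] that[of 0 1] by auto
      qed
      have s: "touch adj P Q" if "touch adj Q P" for P Q using touch_sym[OF symp_adj that] .
      \<comment> \<open>The old corner \<open>A k\<close> touches \<open>A i\<close>,
        \<open>A j\<close> and \<open>Y\<close>, so it counts as a third side of that triangle
        besides \<open>Z\<close> and \<open>Z'\<close>.\<close>
      have "disjoint_parts [A i, A j, Y, Z, Z', A k]" using cU[OF Z(1)] cU[OF Z(2)] YU Yc Ydj reg_A ij k dj by (simp add: Int_commute)
      moreover have "touching_parts [A i, A j, Y]" using AA ij YA s by simp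
      moreover have "\<forall>S\<in>{A i, A j, Y}. \<forall>T\<in>{Z, Z', A k}. touch adj S T" using AA ij k YA s tY tA by simp
      ultimately show False by (rule three_sides_list)
    qed
  qed
  thus ?thesis by blast
qed

text \<open>If no component sees three corners, one vertical path suffices, provided its start
  shares a face with any two corners seen: that face acts as the third side in the uniqueness
  clause.\<close>

lemma separator_path:
  assumes Z1: "iscmp X Z1" and x: "x \<in> Z1"
    and two: "\<And>Z. iscmp X Z \<Longrightarrow> \<exists>k<3. \<not> touch adj Z (A k)"
    and tY: "\<And>j. j < 3 \<Longrightarrow> touch adj Z1 (A j) \<Longrightarrow> touch adj (vertical_path X x) (A j)"
    and f: "\<And>i j. i < 3 \<Longrightarrow> j < 3 \<Longrightarrow> i \<noteq> j \<Longrightarrow> touch adj Z1 (A i) \<Longrightarrow> touch adj Z1 (A j) \<Longrightarrow> \<exists>a\<in>A i. \<exists>b\<in>A j. face3 a b x"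
  shows "separator A X (vertical_path X x) (\<lambda>_. 0)"
proof -
  note d1 = iscmpD[OF Z1]
  let ?Y = "vertical_path X x"
  have xX: "x \<in> X" using x d1(1) by blast
  have YZ: "?Y \<subseteq> Z1" by (rule vp_in_cmp[OF Z1 x])
  have Yne: "?Y \<noteq> {}" using vp_self[OF reg_X xX] by blast
  have Yc: "conn adj ?Y" by (rule vp_conn[OF reg_X xX])
  have YU: "?Y \<subseteq> U" using YZ d1(1) reg_X(1) by blast
  have Ydj: "?Y \<inter> A k = {}" if "k < 3" for k using YZ d1(1) reg_A(3)[OF that] by blast
  have cU: "Z \<subseteq> U" "conn adj Z" "?Y \<inter> Z = {}" "Z \<inter> ?Y = {}" "k < 3 \<Longrightarrow> A k \<inter> Z = {}" "k < 3 \<Longrightarrow> Z \<inter> A k = {}" if "iscmp (X - ?Y) Z" for Z k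
    using iscmpD(1,3)[OF that] reg_X(1) reg_A(3)[of k] by blast+
  have inZ1: "Z \<subseteq> Z1" if "iscmp (X - ?Y) Z" "touch adj Z ?Y" for Z using sub_cmp[OF Z1 YZ Yne that(1)] that(2) by blast
  show ?thesis unfolding separator_def
  proof (intro conjI allI ballI impI)
    show "?Y \<subseteq> X" by (rule vp_sub[OF reg_X])
    show "?Y \<noteq> {}" "conn adj ?Y" by fact+
    show "(0::nat) < 3" by simp
    show "y = z" if "y \<in> ?Y" "z \<in> ?Y" "(0::nat) = 0 \<and> L y = L z" for y z
      using inj_onD[OF vp_inj[OF reg_X]] that by blast
  next
    fix Z assume Z: "iscmp (X - ?Y) Z"
    obtain Z0 where Z0: "iscmp X Z0" "Z \<subseteq> Z0" by (rule iscmp_in[OF Z Diff_subset])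
    show "\<exists>k<3. \<not> touch adj Z (A k)" using two[OF Z0(1)] touch_subset[OF _ Z0(2)] by blast
  next
    fix Z j assume "iscmp (X - ?Y) Z" "j < (3::nat)" "touch adj Z ?Y" "touch adj Z (A j)"
    thus "touch adj ?Y (A j)" using inZ1[of Z] tY touch_subset by blast
  next
    fix Z Z' k assume Z: "iscmp (X - ?Y) Z" "iscmp (X - ?Y) Z'" and k: "k < (3::nat)"
      and tYZ: "touch adj Z ?Y" "touch adj Z' ?Y" and tA: "\<forall>j<3. j \<noteq> k \<longrightarrow> touch adj Z (A j) \<and> touch adj Z' (A j)"
    show "Z = Z'"
    proof (rule ccontr)
      assume ne: "Z \<noteq> Z'"
      have dj: "Z \<inter> Z' = {}" by (rule iscmp_disj[OF Z ne])
      obtain i j where ij: "i < 3" "j < 3" "i \<noteq> j" "i \<noteq> k" "j \<noteq> k"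
      proof -
        have "k = 0 \<or> k = 1 \<or> k = 2" by (rule three[OF k])
        thus ?thesis using that[of 1 2] that[of 0 2] that[of 0 1] by auto
      qed
      have t1: "touch adj Z1 (A i)" "touch adj Z1 (A j)" using tA ij touch_subset[OF _ inZ1[OF Z(1) tYZ(1)]] by blast+
      obtain a b where ab: "a \<in> A i" "b \<in> A j" "face3 a b x" using f[OF ij(1-3) t1] by blast
      have s: "touch adj P Q" if "touch adj Q P" for P Q using touch_sym[OF symp_adj that] .
      have "disjoint_parts [A i, A j, ?Y, Z, Z']" using cU[OF Z(1)] cU[OF Z(2)] YU Yc Ydj reg_A ij k dj by (simp add: Int_commute)
      moreover have "touching_parts [A i, A j, ?Y]" using reg_touch[OF Z1 ij(1-3) t1] ij tY t1 s by simp
      moreover have "\<forall>S\<in>{A i, A j, ?Y}. \<forall>T\<in>{Z, Z'}. touch adj S T" using ij k s tYZ tA by simp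
      ultimately show False by (rule two_sides_face_list[OF _ _ _ ab(1,2) vp_self[OF reg_X xX] ab(3)])
    qed
  qed
qed

text \<open>Three corners seen by one component call for Sperner's lemma, two for the face of a
  digon; if no component sees two, any vertical path will do.\<close>

lemma separator_exists:
  assumes "X \<noteq> {}"
  shows "\<exists>Y lg. separator A X Y lg"
proof (cases "\<exists>Z. iscmp X Z \<and> (\<forall>k<3. touch adj Z (A k))")
  case True thus ?thesis using separator_three by blast
next
  case False
  hence two: "\<exists>k<3. \<not> touch adj Z (A k)" if "iscmp X Z" for Z using that by blast
  show ?thesis
  proof (cases "\<exists>Z i j. iscmp X Z \<and> i < 3 \<and> j < 3 \<and> i \<noteq> j \<and> touch adj Z (A i) \<and> touch adj Z (A j)")
    case True
    then obtain Z i j where Z: "iscmp X Z" and ij: "i < 3" "j < 3" "i \<noteq> j" "touch adj Z (A i)" "touch adj Z (A j)" by blast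
    note d = iscmpD[OF Z]
    obtain k where k: "k < 3" "\<not> touch adj Z (A k)" using two[OF Z] by blast
    have all: "m = i \<or> m = j \<or> m = k" if "m < 3" for m 
    proof -
      have "k \<noteq> i" "k \<noteq> j" using k ij by blast+
      thus ?thesis using that ij(1-3) k(1) by linarith
    qed
    have Aij: "touch adj (A i) (A j)" by (rule reg_touch[OF Z ij])
    have "\<exists>x\<in>Z. \<exists>a\<in>A i. \<exists>b\<in>A j. face3 x a b"
    proof (rule digon_list)
      have "Z \<subseteq> U" "Z \<inter> A m = {}" if "m < 3" for m using d(1) reg_X reg_A(3)[OF that] by blast+
      thus "disjoint_parts [Z, A i, A j]" using d(3) reg_A ij by simp
      show "touching_parts [Z, A i, A j]" using ij Aij by simp
      show "y \<in> Z \<union> A i \<union> A j" if "x \<in> Z" "adj x y" for x y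
      proof -
        have "x \<in> X" using that d(1) by blast
        from reg_N[OF this that(2)] show ?thesis
        proof (elim disjE exE conjE)
          assume "y \<in> X" thus ?thesis using d(5)[OF that] by blast
        next
          fix m assume m: "m < 3" "y \<in> A m"
          hence "touch adj Z (A m)" using that unfolding touch_def by blast
          hence "m = i \<or> m = j" using all[OF m(1)] k by blast
          thus ?thesis using m by blast
        qed
      qed
    qed
    then obtain x a b where x: "x \<in> Z" "a \<in> A i" "b \<in> A j" "face3 x a b" by blast
    have xX: "x \<in> X" using x d by blast
    have xA: "x \<notin> A m" if "m < 3" for m using xX reg_A(3)[OF that] by blast
    have f1: "face3 a b x" "face3 b a x"
      using face3_perm(2)[OF face3_perm(1)[OF x(4)]] face3_perm(2)[OF face3_perm(1)[OF face3_perm(2)[OF x(4)]]] by blast+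
    have "separator A X (vertical_path X x) (\<lambda>_. 0)"
    proof (rule separator_path[OF Z x(1) two])
      show "touch adj (vertical_path X x) (A m)" if "m < 3" "touch adj Z (A m)" for m
      proof -
        have "m = i \<or> m = j" using all[OF that(1)] k that by blast
        moreover have "adj x a" "adj x b" using face3_adj[OF x(4)] face3_adj[OF face3_perm(2)[OF x(4)]] x(2,3) xA[OF ij(1)] xA[OF ij(2)] by auto
        ultimately show ?thesis using x vp_self[OF reg_X xX] unfolding touch_def by blast
      qed
      show "\<exists>a\<in>A m. \<exists>b\<in>A n. face3 a b x" if "m < 3" "n < 3" "m \<noteq> n" "touch adj Z (A m)" "touch adj Z (A n)" for m n
      proof -
        have "(m = i \<and> n = j) \<or> (m = j \<and> n = i)" using all[OF that(1)] all[OF that(2)] k that by blast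
        thus ?thesis using f1 x by blast
      qed
    qed
    thus ?thesis by blast
  next
    case False
    obtain x where x: "x \<in> X" using assms by blast
    have Z: "iscmp X (cmp X x)" by (rule iscmp_cmp[OF x])
    obtain k where k: "k < 3" "touch adj (vertical_path X x) (A k)" using exit_A[OF x] by blast
    have "vertical_path X x \<subseteq> cmp X x" by (rule vp_in_cmp[OF Z cmp_self[OF x]])
    hence tk: "touch adj (cmp X x) (A k)" using touch_subset[OF k(2)] by blast
    have "separator A X (vertical_path X x) (\<lambda>_. 0)"
      by (rule separator_path[OF Z cmp_self[OF x] two]) (use False Z k tk in blast)+
    thus ?thesis by blast
  qed
qed

end

end

section \<open>Placing the vertices of a region in the network\<close>

context layered begin

text \<open>The clause on corners passes adjacency to tripods placed earlier through the recursion;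
  a corner with value \<open>None\<close> imposes nothing.\<close>

definition placed :: "(nat \<Rightarrow> 'v set) \<Rightarrow> 'v set \<Rightarrow> reg \<Rightarrow> ('v \<Rightarrow> att) \<Rightarrow> ('v \<Rightarrow> nat) \<Rightarrow> bool" where
  "placed A X g loc leg \<longleftrightarrow> (\<forall>x\<in>X. terr g (loc x) \<and> leg x < 3) \<and>
     (\<forall>u\<in>X. \<forall>v\<in>X. adj u v \<longrightarrow> loc u = loc v \<or> hedge (loc u) (loc v)) \<and>
     (\<forall>u\<in>X. \<forall>k<3. \<forall>v\<in>A k. \<forall>q. adj u v \<longrightarrow> region_corner g k = Some q \<longrightarrow> hadj (loc u) q) \<and>
     (\<forall>u\<in>X. \<forall>v\<in>X. loc u = loc v \<longrightarrow> leg u = leg v \<longrightarrow> L u = L v \<longrightarrow> u = v)"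

context
  fixes A X Y lg assumes reg: "region A X" and sep: "separator A X Y lg"
begin

lemmas sepc = sep[unfolded separator_def]

lemma sep_Y: "Y \<subseteq> X" "Y \<noteq> {}" "conn adj Y"
  using sepc[THEN conjunct1] sepc[THEN conjunct2, THEN conjunct1] sepc[THEN conjunct2, THEN conjunct2, THEN conjunct1] .

lemma sep_lg: "y \<in> Y \<Longrightarrow> lg y < 3" 
  using sepc[THEN conjunct2, THEN conjunct2, THEN conjunct2, THEN conjunct1] by blast

lemma sep_inj: "y \<in> Y \<Longrightarrow> z \<in> Y \<Longrightarrow> lg y = lg z \<Longrightarrow> L y = L z \<Longrightarrow> y = z"
  using sepc[THEN conjunct2, THEN conjunct2, THEN conjunct2, THEN conjunct2, THEN conjunct1] by simp

lemma sep_miss: "iscmp (X - Y) Z \<Longrightarrow> \<exists>k<3. \<not> touch adj Z (A k)"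
  using sepc[THEN conjunct2, THEN conjunct2, THEN conjunct2, THEN conjunct2, THEN conjunct2, THEN conjunct1] by simp

lemma sep_touch: "iscmp (X - Y) Z \<Longrightarrow> j < 3 \<Longrightarrow> touch adj Z Y \<Longrightarrow> touch adj Z (A j) \<Longrightarrow> touch adj Y (A j)"
  using sepc[THEN conjunct2, THEN conjunct2, THEN conjunct2, THEN conjunct2, THEN conjunct2, THEN conjunct2, THEN conjunct1] by simp

lemma sep_unique: "iscmp (X - Y) Z \<Longrightarrow> iscmp (X - Y) Z' \<Longrightarrow> k < 3 \<Longrightarrow> touch adj Z Y \<Longrightarrow> touch adj Z' Y \<Longrightarrow>
       \<forall>j<3. j \<noteq> k \<longrightarrow> touch adj Z (A j) \<and> touch adj Z' (A j) \<Longrightarrow> Z = Z'"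
  using sepc[THEN conjunct2, THEN conjunct2, THEN conjunct2, THEN conjunct2, THEN conjunct2, THEN conjunct2, THEN conjunct2]
  by (drule_tac spec[of _ Z], drule_tac spec[of _ Z'], drule_tac spec[of _ k]) simp

text \<open>The choice depends on \<open>x\<close> only through its component, so components stay
  whole. Several of them may lose the same corner and form one piece, which is why regions may be
  disconnected.\<close>

definition miss :: "'v \<Rightarrow> nat" where
  "miss x = (SOME k. k < 3 \<and> \<not> touch adj (cmp (X - Y) x) (A k))"

definition piece :: "nat \<Rightarrow> 'v set" where "piece k = {x \<in> X - Y. miss x = k}"

lemma miss: assumes "x \<in> X - Y" shows "miss x < 3" "\<not> touch adj (cmp (X - Y) x) (A (miss x))"
  using someI_ex[OF sep_miss[OF iscmp_cmp[OF assms]]] unfolding miss_def by blast+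

lemma piece_sub: "piece k \<subseteq> X" "piece k \<inter> Y = {}" "x \<in> X - Y \<Longrightarrow> x \<in> piece (miss x)"
  unfolding piece_def by auto

lemma miss_cmp: "y \<in> cmp (X - Y) x \<Longrightarrow> miss y = miss x"
  unfolding miss_def using cmp_eq by metis

lemma piece_adj: assumes "u \<in> X - Y" "v \<in> X - Y" "adj u v" shows "miss u = miss v"
  using miss_cmp[OF cmp_closed[OF cmp_self[OF assms(1)] assms(3,2)]] by simp

lemma piece_cmp:
  assumes "iscmp (piece k) Z" shows "iscmp (X - Y) Z" "\<not> touch adj Z (A k)"
proof -
  note d = iscmpD[OF assms]
  obtain z where z: "z \<in> Z" using d(2) by blast
  have zX: "z \<in> X - Y" "miss z = k" using z d(1) by (auto simp: piece_def)
  have 1: "Z \<subseteq> cmp (X - Y) z" by (rule conn_in_cmp[OF d(3) _ z]) (use d(1) in \<open>auto simp: piece_def\<close>)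
  have "cmp (X - Y) z \<subseteq> piece k" using cmp_sub[of "X - Y" z] miss_cmp zX(2) unfolding piece_def by blast
  hence "cmp (X - Y) z \<subseteq> cmp (piece k) z" by (rule conn_in_cmp[OF cmp_conn[OF zX(1)] _ cmp_self[OF zX(1)]])
  hence 2: "cmp (X - Y) z = Z" using 1 d(4)[OF z] by simp
  show "iscmp (X - Y) Z" using iscmp_cmp[OF zX(1)] 2 by simp
  show "\<not> touch adj Z (A k)" using miss(2)[OF zX(1)] 2 zX(2) by simp
qed

lemma piece_no_touch: assumes "x \<in> piece k" "y \<in> A k" shows "\<not> adj x y"
proof
  assume "adj x y"
  have x: "x \<in> piece k" by fact
  have "touch adj (cmp (piece k) x) (A k)" using cmp_self[OF x] \<open>adj x y\<close> assms(2) unfolding touch_def by blast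
  thus False using piece_cmp(2)[OF iscmp_cmp[OF x]] by blast
qed

text \<open>\<open>Y\<close> takes over corner \<open>k\<close>, which this piece does not touch.
  The touching and uniqueness clauses of \<open>separator\<close> are those of \<open>region\<close>
  for the new corners.\<close>

lemma region_piece:
  assumes k: "k < 3"
  shows "region (A(k := Y)) (piece k)"
proof -
  note rX = reg_X[OF reg] and rA = reg_A[OF reg]
  have YU: "Y \<subseteq> U" using sep_Y(1) rX(1) by blast
  have YA: "Y \<inter> A j = {}" "A j \<inter> Y = {}" if "j < 3" for j using sep_Y(1) rA(3)[OF that] by blast+
  show ?thesis unfolding region_def
  proof (intro conjI allI impI ballI)
    show "piece k \<subseteq> U" using piece_sub(1) rX(1) by blast
    show "rt \<notin> piece k" using piece_sub(1) rX(2) by blast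
    show "(A(k := Y)) j \<subseteq> U" "conn adj ((A(k := Y)) j)" if "j < 3" for j using rA[OF that] YU sep_Y by auto
    show "(A(k := Y)) j \<inter> piece k = {}" if "j < 3" for j
      using rA(3)[OF that] piece_sub(1,2)[of k] by (cases "j = k") auto
    show "(A(k := Y)) i \<inter> (A(k := Y)) j = {}" if "i < 3" "j < 3" "i \<noteq> j" for i j
      using rA(4)[OF that] YA(1)[OF that(1)] YA(1)[OF that(2)] YA(2)[OF that(1)] that(3) by auto
  next
    fix x y assume x: "x \<in> piece k" and a: "adj x y"
    have xX: "x \<in> X" "x \<in> X - Y" using x by (auto simp: piece_def)
    consider "y \<in> Y" | "y \<in> X - Y" | j where "j < 3" "y \<in> A j" using reg_N[OF reg xX(1) a] by blast
    thus "y \<in> piece k \<or> (\<exists>j<3. y \<in> (A(k := Y)) j)"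
    proof cases
      case 1 thus ?thesis using k by (metis fun_upd_same)
    next
      case 2
      hence "miss y = k" using piece_adj[OF xX(2) 2 a] x by (simp add: piece_def)
      thus ?thesis using 2 by (simp add: piece_def)
    next
      case 3
      hence "j \<noteq> k" using piece_no_touch[OF x] a by blast
      thus ?thesis using 3 by (metis fun_upd_other)
    qed
  next
    fix Z i j assume Z: "iscmp (piece k) Z" and ij: "i < 3" "j < 3" "i \<noteq> j" 
      and t: "touch adj Z ((A(k := Y)) i)" "touch adj Z ((A(k := Y)) j)"
    note Z' = piece_cmp[OF Z]
    obtain Z0 where Z0: "iscmp X Z0" "Z \<subseteq> Z0" by (rule iscmp_in[OF Z'(1) Diff_subset])
    consider "i = k" "j \<noteq> k" | "j = k" "i \<noteq> k" | "i \<noteq> k" "j \<noteq> k" using ij by blast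
    thus "touch adj ((A(k := Y)) i) ((A(k := Y)) j)"
    proof cases
      case 1 thus ?thesis using sep_touch[OF Z'(1) ij(2)] t by simp
    next
      case 2 thus ?thesis using touch_sym[OF symp_adj sep_touch[OF Z'(1) ij(1)]] t by simp
    next
      case 3 thus ?thesis using reg_touch[OF reg Z0(1) ij] touch_subset[OF _ Z0(2)] t by simp
    qed
  next
    fix Z Z' assume Z: "iscmp (piece k) Z" "iscmp (piece k) Z'"
      and t: "\<forall>j<3. touch adj Z ((A(k := Y)) j) \<and> touch adj Z' ((A(k := Y)) j)"
    have "touch adj Z Y" "touch adj Z' Y" using t[rule_format, OF k] by simp_all
    moreover have "\<forall>j<3. j \<noteq> k \<longrightarrow> touch adj Z (A j) \<and> touch adj Z' (A j)"
    proof (intro allI impI)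
      fix j assume "j < (3::nat)" "j \<noteq> k"
      thus "touch adj Z (A j) \<and> touch adj Z' (A j)" using t[rule_format, of j] by simp
    qed
    ultimately show "Z = Z'" using sep_unique[OF piece_cmp(1)[OF Z(1)] piece_cmp(1)[OF Z(2)] k] by blast
  qed
qed

text \<open>The whole tripod goes to the node of the region, each piece to its subregion. Pieces
  have no edges between them and disjoint territories; edges to the tripod are edges to the new
  corner of a subregion.\<close>

lemma placed_combine:
  assumes g: "region_inv g" and p: "\<And>k. k < 3 \<Longrightarrow> placed (A(k := Y)) (piece k) (subregion k g) (loc k) (leg k)"
  shows "placed A X g (\<lambda>x. if x \<in> Y then region_node g else loc (miss x) x) (\<lambda>x. if x \<in> Y then lg x else leg (miss x) x)"
    (is "placed A X g ?loc ?leg")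
proof -
  have T: "terr (subregion (miss x) g) (loc (miss x) x)" "leg (miss x) x < 3" if "x \<in> X - Y" for x
    using p[OF miss(1)[OF that]] piece_sub(3)[OF that] unfolding placed_def by blast+
  have E: "loc (miss u) u = loc (miss u) v \<or> hedge (loc (miss u) u) (loc (miss u) v)" if "u \<in> X - Y" "v \<in> X - Y" "adj u v" for u v
    using p[OF miss(1)[OF that(1)]] piece_sub(3)[OF that(1)] piece_sub(3)[OF that(2)] piece_adj[OF that] that(3) unfolding placed_def by metis
  have C: "hadj (loc (miss u) u) q" if "u \<in> X - Y" "k < 3" "v \<in> (A(miss u := Y)) k" "adj u v" "region_corner (subregion (miss u) g) k = Some q" for u k v q
    using p[OF miss(1)[OF that(1)]] piece_sub(3)[OF that(1)] that(2-) unfolding placed_def by metis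
  have J: "u = v" if "u \<in> X - Y" "v \<in> X - Y" "miss u = miss v" "loc (miss u) u = loc (miss u) v" "leg (miss u) u = leg (miss u) v" "L u = L v" for u v
    using p[OF miss(1)[OF that(1)]] piece_sub(3)[OF that(1)] piece_sub(3)[OF that(2)] that(3-) unfolding placed_def by metis
  have n: "hadj (loc (miss u) u) (region_node g)" if "u \<in> X - Y" "v \<in> Y" "adj u v" for u v
    by (rule C[OF that(1) miss(1)[OF that(1)] _ that(3)]) (use that(2) gcor_sub in auto)
  have nT: "loc (miss u) u \<noteq> region_node g" if "u \<in> X - Y" for u
    using terr_sub(1)[OF g miss(1)[OF that]] T(1)[OF that] by metis
  have as: "adj u v \<Longrightarrow> adj v u" for u v using symp_adj by (rule sympD)
  show ?thesis unfolding placed_def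
  proof (intro conjI ballI allI impI)
    fix x assume x: "x \<in> X"
    show "terr g (?loc x)" using terr_node[OF g] terr_sub(2)[OF g miss(1) T(1)] x by simp
    show "?leg x < 3" using sep_lg T(2) x by simp
  next
    fix u v assume uv: "u \<in> X" "v \<in> X" "adj u v"
    consider "u \<in> Y" "v \<in> Y" | "u \<in> Y" "v \<in> X - Y" | "u \<in> X - Y" "v \<in> Y" | "u \<in> X - Y" "v \<in> X - Y" using uv by blast
    thus "?loc u = ?loc v \<or> hedge (?loc u) (?loc v)"
    proof cases
      case 2
      thus ?thesis using n[OF 2(2,1) as[OF uv(3)]] by (simp add: hedge_def)
    next
      case 3
      thus ?thesis using n[OF 3 uv(3)] by (simp add: hedge_def)
    next
      case 4
      thus ?thesis using E[OF 4 uv(3)] piece_adj[OF 4 uv(3)] by simp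
    qed simp
  next
    fix u k v q assume u: "u \<in> X" and k: "k < (3::nat)" and v: "v \<in> A k" "adj u v" and q: "region_corner g k = Some q"
    show "hadj (?loc u) q"
    proof (cases "u \<in> Y")
      case True thus ?thesis using node_hadj[OF g k q] by simp
    next
      case False
      hence uX: "u \<in> X - Y" using u by blast
      have km: "k \<noteq> miss u" using piece_no_touch[OF piece_sub(3)[OF uX]] v by blast
      have "hadj (loc (miss u) u) q" by (rule C[OF uX k _ v(2)]) (use km v q gcor_sub in auto)
      thus ?thesis using False by simp
    qed
  next
    fix u v assume u: "u \<in> X" and v: "v \<in> X" and e: "?loc u = ?loc v" "?leg u = ?leg v" "L u = L v"
    consider "u \<in> Y" "v \<in> Y" | "u \<in> Y" "v \<in> X - Y" | "u \<in> X - Y" "v \<in> Y" | "u \<in> X - Y" "v \<in> X - Y" using u v by blast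
    thus "u = v"
    proof cases
      case 1 thus ?thesis using sep_inj e by simp
    next
      case 2 thus ?thesis using nT[OF 2(2)] e(1) by simp
    next
      case 3 thus ?thesis using nT[OF 3(1)] e(1) by simp
    next
      case 4
      have m: "miss u = miss v"
      proof (rule ccontr)
        assume ne: "miss u \<noteq> miss v"
        have "loc (miss u) u = loc (miss v) v" using e(1) 4 by simp
        thus False using terr_sub(3)[OF g miss(1)[OF 4(1)] miss(1)[OF 4(2)] ne T(1)[OF 4(1)]] T(1)[OF 4(2)] by simp
      qed
      show ?thesis by (rule J[OF 4 m]) (use e 4 m in simp_all)
    qed
  qed
qed

lemma card_piece: "card (piece k) < card X"
proof -
  have "piece k \<subset> X" using sep_Y(1,2) piece_sub(1,2)[of k] by blast
  moreover have "finite X" using reg_X(1)[OF reg] finite_range unfolding U_def by (rule finite_subset)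
  ultimately show ?thesis by (rule psubset_card_mono[rotated])
qed

end

theorem region_placed:
  assumes "region A X" "region_inv g"
  shows "\<exists>loc leg. placed A X g loc leg"
  using assms
proof (induction "card X" arbitrary: A X g rule: less_induct)
  case less
  show ?case
  proof (cases "X = {}")
    case True
    have "placed A X g (\<lambda>_. undefined) (\<lambda>_. 0)" unfolding placed_def True by simp
    thus ?thesis by blast
  next
    case False
    obtain Y lg where s: "separator A X Y lg" using separator_exists[OF less.prems(1) False] by blast
    have "\<exists>loc leg. placed (A(k := Y)) (piece A X Y k) (subregion k g) loc leg" if "k < 3" for k
      by (rule less.hyps[OF card_piece[OF less.prems(1) s] region_piece[OF less.prems(1) s that] ginv_sub[OF less.prems(2) that]])
    then obtain loc leg where p: "\<And>k. k < 3 \<Longrightarrow> placed (A(k := Y)) (piece A X Y k) (subregion k g) (loc k) (leg k)" by metis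
    show ?thesis using placed_combine[OF less.prems(1) s less.prems(2) p] by blast
  qed
qed

theorem network_map:
  shows "\<exists>loc leg. (\<forall>u\<in>U. leg u < (3::nat)) \<and> (\<forall>u\<in>U. \<forall>v\<in>U. adj u v \<longrightarrow> loc u = loc v \<or> hedge (loc u) (loc v)) \<and>
     (\<forall>u\<in>U. \<forall>v\<in>U. loc u = loc v \<longrightarrow> leg u = leg v \<longrightarrow> L u = L v \<longrightarrow> u = v)"
proof -
  \<comment> \<open>The root vertex plays the first tripod: it receives the node of the outermost
    region. The rest starts in subregion 0, whose corner 0 is this node and whose other corners are
    absent.\<close>
  define g0 where "g0 = Tri (\<lambda>_. None) []"
  have g0: "region_inv g0" by (simp add: g0_def parent_ok_def)
  have g1: "region_inv (subregion 0 g0)" by (rule ginv_sub[OF g0]) simp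
  define A :: "nat \<Rightarrow> 'v set" where "A k = (if k = 0 then {rt} else {})" for k
  define X where "X = U - {rt}"
  have tA: "touch adj Z (A k) \<Longrightarrow> k = 0" for Z k by (auto simp: touch_def A_def split: if_splits)
  have "region A X" unfolding region_def
  proof (intro conjI allI impI ballI)
    show "X \<subseteq> U" "rt \<notin> X" by (auto simp: X_def)
    show "A k \<subseteq> U" "conn adj (A k)" "A k \<inter> X = {}" for k using rt by (auto simp: A_def X_def)
    show "A i \<inter> A j = {}" if "i \<noteq> j" for i j using that by (auto simp: A_def)
    show "y \<in> X \<or> (\<exists>k<3. y \<in> A k)" if "x \<in> X" "adj x y" for x y
    proof (cases "y = rt")
      case True thus ?thesis by (intro disjI2 exI[of _ 0]) (simp add: A_def)
    next
      case False thus ?thesis using adj_U[OF that(2)] by (simp add: X_def)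
    qed
    show "touch adj (A i) (A j)" if "i \<noteq> j" "touch adj Z (A i)" "touch adj Z (A j)" for Z i j
      using tA[OF that(2)] tA[OF that(3)] that(1) by simp
    show "Z = Z'" if "\<forall>k<3. touch adj Z (A k) \<and> touch adj Z' (A k)" for Z Z'
      using that[rule_format, of 1] tA[of Z 1] by simp
  qed
  from region_placed[OF this g1] obtain loc leg where p: "placed A X (subregion 0 g0) loc leg" by blast
  have T: "terr (subregion 0 g0) (loc x)" "leg x < 3" if "x \<in> X" for x using p that unfolding placed_def by blast+
  have E: "loc u = loc v \<or> hedge (loc u) (loc v)" if "u \<in> X" "v \<in> X" "adj u v" for u v using p that unfolding placed_def by blast
  have C: "hadj (loc u) (region_node g0)" if "u \<in> X" "adj u rt" for u
  proof -
    have c: "\<forall>k<3. \<forall>v\<in>A k. \<forall>q. adj u v \<longrightarrow> region_corner (subregion 0 g0) k = Some q \<longrightarrow> hadj (loc u) q"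
      using p that(1) unfolding placed_def by blast
    have "region_corner (subregion 0 g0) 0 = Some (region_node g0)" unfolding gcor_sub by simp
    thus ?thesis using c[rule_format, of 0 rt "region_node g0"] that(2) by (simp add: A_def)
  qed
  have J: "u = v" if "u \<in> X" "v \<in> X" "loc u = loc v" "leg u = leg v" "L u = L v" for u v using p that unfolding placed_def by blast
  have nT: "loc x \<noteq> region_node g0" if "x \<in> X" for x
    using terr_sub(1)[OF g0, of 0] T(1)[OF that] by auto
  have as: "adj u v \<Longrightarrow> adj v u" for u v using symp_adj by (rule sympD)
  have irr: "\<not> adj u u" for u by (simp add: adj_def)
  let ?loc = "loc(rt := region_node g0)" and ?leg = "leg(rt := 0)"
  have UX: "u = rt \<or> u \<in> X" if "u \<in> U" for u using that by (auto simp: X_def)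
  have rX: "u \<noteq> rt" if "u \<in> X" for u using that by (auto simp: X_def)
  show ?thesis
  proof (intro exI[of _ ?loc] exI[of _ ?leg] conjI ballI impI)
    show "?leg u < 3" if "u \<in> U" for u using UX[OF that] T(2) by auto
    show "?loc u = ?loc v \<or> hedge (?loc u) (?loc v)" if uv: "u \<in> U" "v \<in> U" "adj u v" for u v
    proof -
      consider "u = rt" "v \<in> X" | "u \<in> X" "v = rt" | "u \<in> X" "v \<in> X" using UX[OF uv(1)] UX[OF uv(2)] uv(3) irr by blast
      thus ?thesis
      proof cases
        case 1 thus ?thesis using C[OF 1(2)] as[OF uv(3)] rX[OF 1(2)] by (simp add: hedge_def)
      next
        case 2 thus ?thesis using C[OF 2(1)] uv(3) rX[OF 2(1)] by (simp add: hedge_def)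
      next
        case 3 thus ?thesis using E[OF 3 uv(3)] rX[OF 3(1)] rX[OF 3(2)] by simp
      qed
    qed
    show "u = v" if uv: "u \<in> U" "v \<in> U" "?loc u = ?loc v" "?leg u = ?leg v" "L u = L v" for u v
    proof -
      consider "u = rt" "v = rt" | "u = rt" "v \<in> X" | "u \<in> X" "v = rt" | "u \<in> X" "v \<in> X" using UX[OF uv(1)] UX[OF uv(2)] by blast
      thus ?thesis
      proof cases
        case 2 thus ?thesis using nT[OF 2(2)] uv(3) rX[OF 2(2)] by simp
      next
        case 3 thus ?thesis using nT[OF 3(1)] uv(3) rX[OF 3(1)] by simp
      next
        case 4 thus ?thesis using J[OF 4] uv rX[OF 4(1)] rX[OF 4(2)] by simp
      qed simp
    qed
  qed
qed

end

section \<open>From plane drawings to the lattice\<close>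

definition fl :: "real \<Rightarrow> real^2 \<Rightarrow> cell" where "fl s p = (\<lfloor>s * p$1\<rfloor>, \<lfloor>s * p$2\<rfloor>)"

text \<open>Two by two cells are taken because nearby scaled points can have floors differing by 1
  per coordinate; their blocks still share a cell.\<close>

definition block :: "cell \<Rightarrow> cell set" where "block z = {fst z, fst z + 1} \<times> {snd z, snd z + 1}"

definition grid :: "real \<Rightarrow> (real^2) set \<Rightarrow> cell set" where "grid s K = (\<Union>p\<in>K. block (fl s p))"

lemma block_conn: "conn ladj (block z)"
proof (rule conn_star[OF symp_ladj, of z])
  show "z \<in> block z" by (cases z) (simp add: block_def)
  fix x assume x: "x \<in> block z"
  have m: "(k, l) \<in> block z \<longleftrightarrow> fst z \<le> k \<and> k \<le> fst z + 1 \<and> snd z \<le> l \<and> l \<le> snd z + 1" for k l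
    unfolding block_def mem_Times_iff fst_conv snd_conv insert_iff by (simp; presburger)
  have xb: "fst z \<le> fst x" "fst x \<le> fst z + 1" "snd z \<le> snd x" "snd x \<le> snd z + 1" using x m[of "fst x" "snd x"] by auto
  have "(restr ladj (block z))\<^sup>*\<^sup>* (fst z, snd z) (fst x, snd z)"
    by (rule restr_row) (use xb m in auto)
  moreover have "(restr ladj (block z))\<^sup>*\<^sup>* (fst x, snd z) (fst x, snd x)"
    by (rule restr_col) (use xb m in auto)
  ultimately show "(restr ladj (block z))\<^sup>*\<^sup>* z x" by (metis prod.collapse rtranclp_trans)
qed

text \<open>Being joined inside the grid is an equivalence relation that holds locally on
  \<open>K\<close>, hence globally when \<open>K\<close> is connected.\<close>

lemma grid_conn:
  assumes "connected K" "0 < s" shows "conn ladj (grid s K)"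
proof -
  let ?R = "\<lambda>p q. (restr ladj (grid s K))\<^sup>*\<^sup>* (fl s p) (fl s q)"
  have blk: "(restr ladj (grid s K))\<^sup>*\<^sup>* x y" if "x \<in> block (fl s p)" "y \<in> block (fl s p)" "p \<in> K" for x y p
    using block_conn[of "fl s p"] that restr_mono[of "block (fl s p)" "grid s K" ladj x y] by (auto simp: conn_def grid_def)
  have self: "fl s p \<in> block (fl s p)" for p by (simp add: block_def fl_def)
  have R: "?R p q" if pq: "p \<in> K" "q \<in> K" for p q
  proof (rule connected_equivalence_relation[OF assms(1) pq, of ?R])
    show "?R x y \<Longrightarrow> ?R y x" for x y by (rule restr_sym[OF symp_ladj])
    show "?R x y \<Longrightarrow> ?R y z \<Longrightarrow> ?R x z" for x y z by (rule rtranclp_trans)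
    fix a assume a: "a \<in> K"
    show "\<exists>T. openin (top_of_set K) T \<and> a \<in> T \<and> (\<forall>x\<in>T. ?R a x)"
    proof (intro exI[of _ "K \<inter> ball a (1/s)"] conjI ballI)
      show "openin (top_of_set K) (K \<inter> ball a (1/s))" by (simp add: openin_open_Int)
      show "a \<in> K \<inter> ball a (1/s)" using a assms(2) by simp
      fix x assume x: "x \<in> K \<inter> ball a (1/s)"
      have near: "\<bar>s * a$i - s * x$i\<bar> < 1" for i
      proof -
        have "\<bar>a$i - x$i\<bar> < 1/s" using x dist_vec_nth_le[of a i x] by (auto simp: dist_real_def)
        hence "s * \<bar>a$i - x$i\<bar> < 1" using assms(2) by (simp add: field_simps)
        moreover have "s * \<bar>a$i - x$i\<bar> = \<bar>s * a$i - s * x$i\<bar>" using assms(2) by (simp add: abs_mult flip: right_diff_distrib)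
        ultimately show ?thesis by simp
      qed
      have fl: "\<exists>k. k \<in> {\<lfloor>t\<rfloor>, \<lfloor>t\<rfloor>+1} \<and> k \<in> {\<lfloor>u\<rfloor>, \<lfloor>u\<rfloor>+1}" if "\<bar>t - u\<bar> < 1" for t u :: real
      proof -
        have "\<lfloor>t\<rfloor> \<le> \<lfloor>u\<rfloor> + 1" "\<lfloor>u\<rfloor> \<le> \<lfloor>t\<rfloor> + 1" using that by linarith+
        hence "\<lfloor>t\<rfloor> = \<lfloor>u\<rfloor> \<or> \<lfloor>t\<rfloor> = \<lfloor>u\<rfloor> + 1 \<or> \<lfloor>u\<rfloor> = \<lfloor>t\<rfloor> + 1" by linarith
        thus ?thesis by auto
      qed
      obtain i where i: "i \<in> {\<lfloor>s * a$1\<rfloor>, \<lfloor>s * a$1\<rfloor>+1}" "i \<in> {\<lfloor>s * x$1\<rfloor>, \<lfloor>s * x$1\<rfloor>+1}" using fl[OF near[of 1]] by blast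
      obtain j where j: "j \<in> {\<lfloor>s * a$2\<rfloor>, \<lfloor>s * a$2\<rfloor>+1}" "j \<in> {\<lfloor>s * x$2\<rfloor>, \<lfloor>s * x$2\<rfloor>+1}" using fl[OF near[of 2]] by blast
      have "(i,j) \<in> block (fl s a)" "(i,j) \<in> block (fl s x)" using i j by (auto simp: block_def fl_def)
      thus "?R a x" using blk[OF self _ a] blk[OF _ self, of _ x] x by (meson IntD1 rtranclp_trans)
    qed
  qed
  show ?thesis unfolding conn_def
  proof (intro ballI)
    fix x y assume "x \<in> grid s K" "y \<in> grid s K"
    then obtain p q where p: "p \<in> K" "x \<in> block (fl s p)" and q: "q \<in> K" "y \<in> block (fl s q)" by (auto simp: grid_def)
    show "(restr ladj (grid s K))\<^sup>*\<^sup>* x y"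
      using blk[OF p(2) self p(1)] R[OF p(1) q(1)] blk[OF self q(2,1)] by (meson rtranclp_trans)
  qed
qed

lemma block_near: "(i,j) \<in> block (fl s p) \<Longrightarrow> \<bar>s * p$1 - i\<bar> \<le> 1 \<and> \<bar>s * p$2 - j\<bar> \<le> 1"
  by (auto simp: block_def fl_def; linarith)

text \<open>A common cell is within 1 of both scaled points in each coordinate, so the points differ
  by at most \<open>2/s\<close> per coordinate and \<open>4/s\<close> in total.\<close>

lemma grid_disjoint:
  assumes "\<And>x y. x \<in> K \<Longrightarrow> y \<in> K' \<Longrightarrow> d \<le> dist x y" "4 / s < d" "0 < s"
  shows "grid s K \<inter> grid s K' = {}"
proof (rule ccontr)
  assume "grid s K \<inter> grid s K' \<noteq> {}"
  then obtain i j p q where p: "p \<in> K" "(i,j) \<in> block (fl s p)" and q: "q \<in> K'" "(i,j) \<in> block (fl s q)"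
    unfolding grid_def by fastforce
  have "\<bar>s * p$k - s * q$k\<bar> \<le> 2" for k
    using block_near[OF p(2)] block_near[OF q(2)] exhaust_2[of k] by (elim disjE) auto
  moreover have "\<bar>s * p$k - s * q$k\<bar> = s * \<bar>p$k - q$k\<bar>" for k using assms(3) by (simp add: abs_mult flip: right_diff_distrib)
  ultimately have c: "\<bar>p$k - q$k\<bar> \<le> 2 / s" for k using assms(3) by (simp add: field_simps)
  have "dist p q \<le> (\<Sum>k\<in>UNIV. \<bar>(p - q)$k\<bar>)" unfolding dist_norm by (rule norm_le_l1_cart)
  also have "\<dots> \<le> 4 / s" using c[of 1] c[of 2] by (simp add: sum_2)
  finally show False using assms(1)[OF p(1) q(1)] assms(2) by simp
qed

lemma uniform_separation:
  assumes "finite F" "\<And>K. K \<in> F \<Longrightarrow> compact (K :: (real^2) set)"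
  shows "\<exists>d>0. \<forall>K\<in>F. \<forall>K'\<in>F. K \<inter> K' = {} \<longrightarrow> (\<forall>x\<in>K. \<forall>y\<in>K'. d \<le> dist x y)"
proof -
  have "\<exists>d>0. K \<inter> K' = {} \<longrightarrow> (\<forall>x\<in>K. \<forall>y\<in>K'. d \<le> dist x y)" if "K \<in> F" "K' \<in> F" for K K'
    using separate_compact_closed[of K K'] assms(2) that compact_imp_closed by (metis zero_less_one)
  then obtain d where d: "\<And>K K'. K \<in> F \<Longrightarrow> K' \<in> F \<Longrightarrow> 0 < d K K'"
    "\<And>K K' x y. K \<in> F \<Longrightarrow> K' \<in> F \<Longrightarrow> K \<inter> K' = {} \<Longrightarrow> x \<in> K \<Longrightarrow> y \<in> K' \<Longrightarrow> d K K' \<le> dist x y" by metis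
  \<comment> \<open>The 1 keeps the minimum defined for an empty family.\<close>
  define D where "D = insert 1 ((\<lambda>(K,K'). d K K') ` (F \<times> F))"
  have fD: "finite D" using assms(1) by (simp add: D_def)
  have "0 < Min D" using fD d(1) by (auto simp: D_def)
  moreover have "Min D \<le> d K K'" if "K \<in> F" "K' \<in> F" for K K'
    by (rule Min_le[OF fD]) (use that in \<open>auto simp: D_def\<close>)
  ultimately show ?thesis using d(2) by (intro exI[of _ "Min D"]) (meson order_trans)
qed

text \<open>A link can overlap its end blobs in a complicated way. The end \<open>h e\<close>
  receives what is reachable from it outside the other blob; walking along the link, this part can
  be left only into \<open>B (t e)\<close>, which gives the contact.\<close>

lemma absorb_links:
  fixes B :: "'a \<Rightarrow> 'c set" and C :: "'a set \<Rightarrow> 'c set"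
  assumes r: "symp r" and E: "\<And>e. e \<in> E \<Longrightarrow> e \<subseteq> V \<and> card e = 2"
    and B: "\<And>v. v \<in> V \<Longrightarrow> conn r (B v)" "\<And>v. v \<in> V \<Longrightarrow> B v \<noteq> {}" "\<And>u v. u \<in> V \<Longrightarrow> v \<in> V \<Longrightarrow> u \<noteq> v \<Longrightarrow> B u \<inter> B v = {}"
    and C: "\<And>e. e \<in> E \<Longrightarrow> conn r (C e)" "\<And>e e'. e \<in> E \<Longrightarrow> e' \<in> E \<Longrightarrow> e \<noteq> e' \<Longrightarrow> C e \<inter> C e' = {}"
      "\<And>e v. e \<in> E \<Longrightarrow> v \<in> V \<Longrightarrow> v \<notin> e \<Longrightarrow> C e \<inter> B v = {}" "\<And>e v. e \<in> E \<Longrightarrow> v \<in> e \<Longrightarrow> C e \<inter> B v \<noteq> {}"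
  obtains B' where "\<And>v. v \<in> V \<Longrightarrow> conn r (B' v)" "\<And>v. B v \<subseteq> B' v" "\<And>u v. u \<in> V \<Longrightarrow> v \<in> V \<Longrightarrow> u \<noteq> v \<Longrightarrow> B' u \<inter> B' v = {}"
    "\<And>u v. {u,v} \<in> E \<Longrightarrow> u \<noteq> v \<Longrightarrow> touch r (B' u) (B' v)" "\<And>v. B' v \<subseteq> B v \<union> (\<Union>e\<in>E. C e)"
proof -
  have "\<exists>u v. e = {u,v} \<and> u \<noteq> v" if "e \<in> E" for e using E[OF that] by (auto simp: card_2_iff)
  then obtain h t where path_len: "\<And>e. e \<in> E \<Longrightarrow> e = {h e, t e} \<and> h e \<noteq> t e" by metis
  define W where "W e = C e - B (t e)" for e
  define Q where "Q e = {z. \<exists>a \<in> C e \<inter> B (h e). (restr r (W e))\<^sup>*\<^sup>* a z}" for e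
  define B' where "B' v = B v \<union> (\<Union>e\<in>{e\<in>E. h e = v}. Q e)" for v
  have hV: "h e \<in> V" "t e \<in> V" if "e \<in> E" for e using E[OF that] path_len[OF that] by blast+
  have aW: "C e \<inter> B (h e) \<subseteq> W e" if "e \<in> E" for e using B(3)[OF hV[OF that]] path_len[OF that] by (auto simp: W_def)
  have QW: "Q e \<subseteq> W e" if "e \<in> E" for e
  proof
    fix z assume "z \<in> Q e"
    then obtain a where a: "a \<in> C e \<inter> B (h e)" "(restr r (W e))\<^sup>*\<^sup>* a z" by (auto simp: Q_def)
    show "z \<in> W e" using a(2) aW[OF that] a(1) by (cases rule: rtranclp.cases) (auto simp: restr_def)
  qed
  have reach: "(restr r (B' (h e)))\<^sup>*\<^sup>* a z" if e: "e \<in> E" and a: "a \<in> C e \<inter> B (h e)" and p: "(restr r (W e))\<^sup>*\<^sup>* a z" for e a z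
    using p
  proof (induction rule: rtranclp_induct)
    case (step y z)
    have "y \<in> Q e" "z \<in> Q e" unfolding Q_def using a step(1,2) by (auto intro: rtranclp.rtrancl_into_rtrancl)
    hence "restr r (B' (h e)) y z" using step(2) e by (auto simp: restr_def B'_def)
    with step.IH show ?case by (rule rtranclp.rtrancl_into_rtrancl)
  qed simp
  show ?thesis
  proof (rule that[of B'])
    show "B v \<subseteq> B' v" for v by (auto simp: B'_def)
    show "B' v \<subseteq> B v \<union> (\<Union>e\<in>E. C e)" for v using QW by (fastforce simp: B'_def W_def)
    fix v assume v: "v \<in> V"
    obtain b where b: "b \<in> B v" using B(2)[OF v] by blast
    have bb: "(restr r (B' v))\<^sup>*\<^sup>* b x" if "x \<in> B v" for x
      using B(1)[OF v] b that restr_mono[of "B v" "B' v" r b x] by (auto simp: conn_def B'_def)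
    show "conn r (B' v)"
    proof (rule conn_star[OF r, of b])
      show "b \<in> B' v" using b by (simp add: B'_def)
      fix x assume "x \<in> B' v"
      then consider "x \<in> B v" | e where "e \<in> E" "h e = v" "x \<in> Q e" by (auto simp: B'_def)
      thus "(restr r (B' v))\<^sup>*\<^sup>* b x"
      proof cases
        case 1 thus ?thesis by (rule bb)
      next
        case (2 e)
        then obtain a where a: "a \<in> C e \<inter> B (h e)" "(restr r (W e))\<^sup>*\<^sup>* a x" by (auto simp: Q_def)
        thus ?thesis using reach[OF 2(1) a] bb[of a] 2(2) by (meson IntD2 rtranclp_trans)
      qed
    qed
    fix u assume u: "u \<in> V" and ne: "u \<noteq> v"
    have QB: "Q e \<inter> B w = {}" if "e \<in> E" "w \<in> V" "h e \<noteq> w" for e w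
    proof (cases "w \<in> e")
      case True
      hence "w = t e" using path_len[OF that(1)] that(3) by (metis insertE singletonD)
      thus ?thesis using QW[OF that(1)] by (auto simp: W_def)
    next
      case False
      thus ?thesis using C(3)[OF that(1,2)] QW[OF that(1)] by (auto simp: W_def)
    qed
    have QQ: "Q e \<inter> Q e' = {}" if "e \<in> E" "e' \<in> E" "h e \<noteq> h e'" for e e'
      using C(2)[OF that(1,2)] that(3) QW[OF that(1)] QW[OF that(2)] by (auto simp: W_def)
    show "B' u \<inter> B' v = {}"
    proof (rule ccontr)
      assume "B' u \<inter> B' v \<noteq> {}"
      then obtain x where x: "x \<in> B' u" "x \<in> B' v" by blast
      have "x \<in> B u \<or> (\<exists>e\<in>E. h e = u \<and> x \<in> Q e)" "x \<in> B v \<or> (\<exists>e\<in>E. h e = v \<and> x \<in> Q e)"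
        using x by (auto simp: B'_def)
      thus False using B(3)[OF u v ne] QB[of _ u] QB[of _ v] QQ ne u v by blast
    qed
  next
    have main: "touch r (B' (h e)) (B' (t e))" if e: "e \<in> E" for e
    proof -
      obtain a where a: "a \<in> C e \<inter> B (h e)" using C(4)[OF e, of "h e"] path_len[OF e] by blast
      obtain b where b: "b \<in> C e \<inter> B (t e)" using C(4)[OF e, of "t e"] path_len[OF e] by blast
      have aQ: "a \<in> Q e" using a by (auto simp: Q_def)
      have bQ: "b \<notin> Q e" using b QW[OF e] by (auto simp: W_def)
      obtain x y where xy: "x \<in> C e" "y \<in> C e" "r x y" "x \<in> Q e" "y \<notin> Q e"
        using conn_leaves[OF C(1)[OF e], of a b "Q e"] a b aQ bQ by blast
      have "y \<in> B (t e)"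
      proof (rule ccontr)
        assume "y \<notin> B (t e)"
        hence "restr r (W e) x y" using xy QW[OF e] by (auto simp: restr_def W_def)
        hence "y \<in> Q e" using xy(4) unfolding Q_def by (auto intro: rtranclp.rtrancl_into_rtrancl)
        thus False using xy by blast
      qed
      moreover have "x \<in> B' (h e)" using xy(4) e by (auto simp: B'_def)
      moreover have "B (t e) \<subseteq> B' (t e)" by (auto simp: B'_def)
      ultimately show ?thesis using xy(3) unfolding touch_def by blast
    qed
    fix u v assume e: "{u,v} \<in> E" and ne: "u \<noteq> v"
    have "(u = h {u,v} \<and> v = t {u,v}) \<or> (u = t {u,v} \<and> v = h {u,v})" using path_len[OF e] ne by (auto simp: doubleton_eq_iff)
    thus "touch r (B' u) (B' v)"
    proof (elim disjE conjE)
      assume "u = h {u,v}" "v = t {u,v}"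
      thus ?thesis using main[OF e] by metis
    next
      assume "u = t {u,v}" "v = h {u,v}"
      moreover have "touch r (B' (t {u,v})) (B' (h {u,v}))" using main[OF e] r unfolding touch_def symp_def by blast
      ultimately show ?thesis by metis
    qed
  qed
qed

text \<open>Rows and columns with index of absolute value at least \<open>R\<close> lie wholly
  outside the square, so two straight walks join \<open>(R,R)\<close> to any outside cell.\<close>

lemma outside_conn: "0 < R \<Longrightarrow> conn ladj {z. R \<le> \<bar>fst z\<bar> \<or> R \<le> \<bar>snd z\<bar>}" (is "_ \<Longrightarrow> conn ladj ?O")
proof -
  assume R: "0 < R"
  have row: "(restr ladj ?O)\<^sup>*\<^sup>* (i,j) (i',j)" if "R \<le> \<bar>j\<bar>" for i i' j by (rule restr_row') (use that in simp)
  have col: "(restr ladj ?O)\<^sup>*\<^sup>* (i,j) (i,j')" if "R \<le> \<bar>i\<bar>" for i j j' by (rule restr_col') (use that in simp)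
  have "(restr ladj ?O)\<^sup>*\<^sup>* (R,R) z" if "z \<in> ?O" for z
  proof -
    obtain i j where z: "z = (i,j)" by (cases z)
    show ?thesis
    proof (cases "R \<le> \<bar>i\<bar>")
      case True
      have "(restr ladj ?O)\<^sup>*\<^sup>* (R,R) (i,R)" by (rule row) simp
      also have "(restr ladj ?O)\<^sup>*\<^sup>* (i,R) (i,j)" by (rule col) fact
      finally show ?thesis by (simp add: z)
    next
      case False
      hence j: "R \<le> \<bar>j\<bar>" using that z by auto
      have "(restr ladj ?O)\<^sup>*\<^sup>* (R,R) (R,j)" by (rule col) simp
      also have "(restr ladj ?O)\<^sup>*\<^sup>* (R,j) (i,j)" by (rule row) fact
      finally show ?thesis by (simp add: z)
    qed
  qed
  thus ?thesis by (intro conn_star[OF symp_ladj, of "(R,R)"]) auto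
qed

text \<open>A plane drawing yields the blobs: the first third of each edge belongs to its end, and the middle third is the link.\<close>

lemma planar_blobs:
  assumes G: "simple_graph V E" and P: "planar V E"
  shows "\<exists>(B' :: 'a \<Rightarrow> cell set) (R :: int). (\<forall>v\<in>V. conn ladj (B' v) \<and> B' v \<noteq> {}) \<and>
    (\<forall>u\<in>V. \<forall>v\<in>V. u \<noteq> v \<longrightarrow> B' u \<inter> B' v = {}) \<and> (\<forall>u v. {u,v} \<in> E \<longrightarrow> u \<noteq> v \<longrightarrow> touch ladj (B' u) (B' v)) \<and>
    (\<forall>v\<in>V. \<forall>z\<in>B' v. \<bar>fst z\<bar> < R \<and> \<bar>snd z\<bar> < R) \<and> 0 < R"
proof -
  obtain pos :: "'a \<Rightarrow> real^2" and curve :: "'a set \<Rightarrow> real \<Rightarrow> real^2" where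
    inj: "inj_on pos V" and
    cv: "\<And>e. e \<in> E \<Longrightarrow> arc (curve e)" "\<And>e. e \<in> E \<Longrightarrow> {pathstart (curve e), pathfinish (curve e)} = pos ` e"
      "\<And>e. e \<in> E \<Longrightarrow> path_image (curve e) \<inter> pos ` V = pos ` e" and
    cr: "\<And>e e'. e \<in> E \<Longrightarrow> e' \<in> E \<Longrightarrow> e \<noteq> e' \<Longrightarrow> path_image (curve e) \<inter> path_image (curve e') \<subseteq> pos ` (e \<inter> e')"
    using P unfolding planar_def by metis
  have fV: "finite V" and E: "\<And>e. e \<in> E \<Longrightarrow> e \<subseteq> V \<and> card e = 2" using G by (auto simp: simple_graph_def)
  have fE: "finite E" by (rule finite_subset[of _ "Pow V"]) (use E fV in auto)
  \<comment> \<open>The curve may start at either end of the edge; this is the third of its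
    parameters next to \<open>v\<close>.\<close>
  define th where "th e v = (if curve e 0 = pos v then {0..1/3} else {2/3..1::real})" for e v
  define T where "T e v = curve e ` th e v" for e v
  define M where "M e = curve e ` {1/3..2/3}" for e
  \<comment> \<open>Inserting \<open>pos v\<close> gives an isolated vertex a nonempty blob.\<close>
  define K where "K v = insert (pos v) (\<Union>e\<in>{e\<in>E. v \<in> e}. T e v)" for v
  have cont: "continuous_on {0..1} (curve e)" and cinj: "inj_on (curve e) {0..1}" if "e \<in> E" for e
    using cv(1)[OF that] by (auto simp: arc_def path_def)
  have thsub: "th e v \<subseteq> {0..1}" for e v by (auto simp: th_def)
  have Tsub: "T e v \<subseteq> path_image (curve e)" for e v using thsub[of e v] by (auto simp: T_def path_image_def)
  have Msub: "M e \<subseteq> path_image (curve e)" for e by (auto simp: M_def path_image_def)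
  have ends: "{curve e 0, curve e 1} = pos ` e" if "e \<in> E" for e
    using cv(2)[OF that] by (simp add: pathstart_def pathfinish_def)
  have c01: "curve e 0 \<noteq> curve e 1" if "e \<in> E" for e using inj_onD[OF cinj[OF that], of 0 1] by auto
  have v01: "pos v = curve e 0 \<or> pos v = curve e 1" if "e \<in> E" "v \<in> e" for e v using ends[OF that(1)] that(2) by blast
  have posT: "pos v \<in> T e v" if "e \<in> E" "v \<in> e" for e v
    using v01[OF that]
  proof
    assume "pos v = curve e 0"
    thus ?thesis unfolding T_def by (intro image_eqI[of _ _ 0]) (simp_all add: th_def)
  next
    assume "pos v = curve e 1"
    thus ?thesis unfolding T_def using c01[OF that(1)] by (intro image_eqI[of _ _ 1]) (simp_all add: th_def)
  qed
  have posinj: "u = v" if "e \<in> E" "e' \<in> E" "u \<in> e" "v \<in> e'" "pos u = pos v" for e e' u v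
    using inj_onD[OF inj that(5)] E[OF that(1)] E[OF that(2)] that(3,4) by blast
  \<comment> \<open>Curves are injective, so an outer third contains no end but its own. As
    different curves meet only at common ends, blobs of different vertices cannot overlap.\<close>
  have T1: "w = u" if e: "e \<in> E" "w \<in> e" "u \<in> e" and w: "pos w \<in> T e u" for e u w
  proof -
    obtain x where x: "x \<in> th e u" "pos w = curve e x" using w by (auto simp: T_def)
    have x01: "x \<in> {0..1}" using x thsub by blast
    have "pos w = pos u"
      using v01[OF e(1,2)]
    proof
      assume "pos w = curve e 0"
      hence "x = 0" using inj_onD[OF cinj[OF e(1)], of x 0] x x01 by auto
      thus ?thesis using x by (auto simp: th_def split: if_splits)
    next
      assume "pos w = curve e 1"
      hence "x = 1" using inj_onD[OF cinj[OF e(1)], of x 1] x x01 by auto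
      hence "curve e 0 \<noteq> pos u" using x by (auto simp: th_def split: if_splits)
      thus ?thesis using v01[OF e(1,3)] \<open>pos w = curve e 1\<close> by auto
    qed
    thus ?thesis using posinj[OF e(1,1,2,3)] by simp
  qed
  have T2: "pos w \<notin> M e" if e: "e \<in> E" "w \<in> e" for e w
  proof
    assume "pos w \<in> M e"
    then obtain x where x: "x \<in> {1/3..2/3}" "pos w = curve e x" by (auto simp: M_def)
    from v01[OF e] show False
      using inj_onD[OF cinj[OF e(1)], of x 0] inj_onD[OF cinj[OF e(1)], of x 1] x by auto
  qed
  have TT: "T e u \<inter> T e v = {}" if e: "e \<in> E" "u \<in> e" "v \<in> e" "u \<noteq> v" for e u v
  proof (rule ccontr)
    assume "T e u \<inter> T e v \<noteq> {}"
    then obtain x y where xy: "x \<in> th e u" "y \<in> th e v" "curve e x = curve e y" by (auto simp: T_def)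
    have "x = y" using inj_onD[OF cinj[OF e(1)] xy(3)] xy thsub by blast
    moreover have "pos u \<noteq> pos v" using posinj[OF e(1,1,2,3)] e(4) by blast
    hence "(curve e 0 = pos u) \<noteq> (curve e 0 = pos v)" using v01[OF e(1,2)] v01[OF e(1,3)] by metis
    ultimately show False using xy by (auto simp: th_def split: if_splits)
  qed
  have TT': "T e u \<inter> T e' v = {}" if e: "e \<in> E" "e' \<in> E" "e \<noteq> e'" "u \<in> e" "v \<in> e'" "u \<noteq> v" for e e' u v
  proof (rule ccontr)
    assume "T e u \<inter> T e' v \<noteq> {}"
    then obtain p where p: "p \<in> T e u" "p \<in> T e' v" by blast
    then obtain w where w: "w \<in> e" "w \<in> e'" "p = pos w" using cr[OF e(1-3)] Tsub by blast
    show False using T1[OF e(1) w(1) e(4)] T1[OF e(2) w(2) e(5)] p w e(6) by auto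
  qed
  have posT': "v \<in> e" if "e \<in> E" "v \<in> V" "pos v \<in> path_image (curve e)" for e v
  proof -
    have "pos v \<in> pos ` e" using cv(3)[OF that(1)] that by blast
    then obtain w where "w \<in> e" "pos v = pos w" by blast
    thus ?thesis using inj_onD[OF inj, of v w] that(2) E[OF that(1)] by blast
  qed
  have KK: "K u \<inter> K v = {}" if u: "u \<in> V" "v \<in> V" "u \<noteq> v" for u v
  proof (rule ccontr)
    assume "K u \<inter> K v \<noteq> {}"
    then obtain p where p: "p \<in> K u" "p \<in> K v" by blast
    have uv: "pos u \<noteq> pos v" using inj_onD[OF inj _ u(1,2)] u(3) by blast
    have pT: "False" if "e \<in> E" "a \<in> e" "pos b \<in> T e a" "b \<in> V" "a \<noteq> b" for a b e
      using T1[OF that(1) posT'[OF that(1,4)] that(2,3)] that(3,5) Tsub by blast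
    consider "p = pos u" "p = pos v" | e where "p = pos u" "e \<in> E" "v \<in> e" "p \<in> T e v" | e where "p = pos v" "e \<in> E" "u \<in> e" "p \<in> T e u"
      | e e' where "e \<in> E" "u \<in> e" "p \<in> T e u" "e' \<in> E" "v \<in> e'" "p \<in> T e' v" using p unfolding K_def by blast
    thus False
    proof cases
      case 1 thus ?thesis using uv by simp
    next
      case 2 thus ?thesis using pT[of e v u] u by metis
    next
      case 3 thus ?thesis using pT[of e u v] u by metis
    next
      case (4 e e')
      show ?thesis
      proof (cases "e = e'")
        case True thus ?thesis using TT[of e u v] 4 u(3) by blast
      next
        case False thus ?thesis using TT'[of e e' u v] 4 u(3) by blast
      qed
    qed
  qed
  have MK: "M e \<inter> K v = {}" if e: "e \<in> E" "v \<in> V" "v \<notin> e" for e v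
  proof (rule ccontr)
    assume "M e \<inter> K v \<noteq> {}"
    then obtain p where p: "p \<in> M e" "p \<in> K v" by blast
    consider "p = pos v" | e' where "e' \<in> E" "v \<in> e'" "p \<in> T e' v" using p(2) unfolding K_def by blast
    thus False
    proof cases
      case 1 thus ?thesis using posT'[OF e(1,2)] p(1) Msub e(3) by blast
    next
      case (2 e')
      have "e \<noteq> e'" using 2 e by blast
      then obtain w where w: "w \<in> e" "w \<in> e'" "p = pos w" using cr[OF e(1) 2(1)] p(1) 2(3) Tsub Msub by blast
      have "w = v" using T1[OF 2(1) w(2) 2(2)] 2(3) w(3) by simp
      thus ?thesis using w e by simp
    qed
  qed
  have MM: "M e \<inter> M e' = {}" if ee: "e \<in> E" "e' \<in> E" "e \<noteq> e'" for e e'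
  proof (rule ccontr)
    assume "M e \<inter> M e' \<noteq> {}"
    then obtain p where p: "p \<in> M e" "p \<in> M e'" by blast
    then obtain w where "w \<in> e" "p = pos w" using cr[OF ee] Msub by blast
    thus False using T2[OF ee(1)] p(1) by simp
  qed
  have MKi: "M e \<inter> K v \<noteq> {}" if "e \<in> E" "v \<in> e" for e v
  proof -
    have "(if curve e 0 = pos v then curve e (1/3) else curve e (2/3)) \<in> M e \<inter> T e v"
      by (auto simp: M_def T_def th_def)
    thus ?thesis using that unfolding K_def by blast
  qed
  have cT: "compact (T e v)" "connected (T e v)" if "e \<in> E" for e v
  proof -
    have c: "continuous_on (th e v) (curve e)" using cont[OF that] thsub by (rule continuous_on_subset)
    show "compact (T e v)" "connected (T e v)" unfolding T_def
      by (rule compact_continuous_image[OF c], simp add: th_def) (rule connected_continuous_image[OF c], simp add: th_def)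
  qed
  have cM: "compact (M e)" "connected (M e)" if "e \<in> E" for e
  proof -
    have c: "continuous_on {1/3..2/3} (curve e)" by (rule continuous_on_subset[OF cont[OF that]]) auto
    show "compact (M e)" "connected (M e)" unfolding M_def
      by (rule compact_continuous_image[OF c], simp) (rule connected_continuous_image[OF c], simp)
  qed
  have cK: "compact (K v)" for v
    unfolding K_def using cT(1) fE by (intro compact_insert compact_UN) auto
  have kK: "connected (K v)" for v
  proof -
    have "K v = \<Union> (insert {pos v} ((\<lambda>e. T e v) ` {e\<in>E. v \<in> e}))" by (auto simp: K_def)
    moreover have "connected (\<Union> (insert {pos v} ((\<lambda>e. T e v) ` {e\<in>E. v \<in> e})))"
    proof (rule connected_Union)
      show "connected s" if "s \<in> insert {pos v} ((\<lambda>e. T e v) ` {e\<in>E. v \<in> e})" for s using that cT(2) by auto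
      have "pos v \<in> \<Inter> (insert {pos v} ((\<lambda>e. T e v) ` {e\<in>E. v \<in> e}))" using posT by auto
      thus "\<Inter> (insert {pos v} ((\<lambda>e. T e v) ` {e\<in>E. v \<in> e})) \<noteq> {}" by blast
    qed
    ultimately show ?thesis by simp
  qed
  have "\<exists>d>0. \<forall>L\<in>K ` V \<union> M ` E. \<forall>L'\<in>K ` V \<union> M ` E. L \<inter> L' = {} \<longrightarrow> (\<forall>x\<in>L. \<forall>y\<in>L'. d \<le> dist x y)"
    by (rule uniform_separation) (use fV fE cK cM in auto)
  then obtain d where d0: "0 < d" "\<forall>L\<in>K ` V \<union> M ` E. \<forall>L'\<in>K ` V \<union> M ` E. L \<inter> L' = {} \<longrightarrow> (\<forall>x\<in>L. \<forall>y\<in>L'. d \<le> dist x y)"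
    by (elim exE conjE)
  have d: "0 < d" "\<And>L L' x y. L \<in> K ` V \<union> M ` E \<Longrightarrow> L' \<in> K ` V \<union> M ` E \<Longrightarrow> L \<inter> L' = {} \<Longrightarrow> x \<in> L \<Longrightarrow> y \<in> L' \<Longrightarrow> d \<le> dist x y"
    by (rule d0(1)) (rule d0(2)[rule_format])
  define s where "s = 5 / d"
  have s: "0 < s" "4 / s < d" using d(1) by (auto simp: s_def field_simps)
  have sepg: "grid s L \<inter> grid s L' = {}" if "L \<in> K ` V \<union> M ` E" "L' \<in> K ` V \<union> M ` E" "L \<inter> L' = {}" for L L'
    by (rule grid_disjoint[OF d(2)[OF that] s(2,1)])
  have self: "fl s p \<in> grid s L" if "p \<in> L" for p L using that by (auto simp: grid_def block_def fl_def)
  obtain B' where B': "\<And>v. v \<in> V \<Longrightarrow> conn ladj (B' v)" "\<And>v. grid s (K v) \<subseteq> B' v" 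
    "\<And>u v. u \<in> V \<Longrightarrow> v \<in> V \<Longrightarrow> u \<noteq> v \<Longrightarrow> B' u \<inter> B' v = {}"
    "\<And>u v. {u,v} \<in> E \<Longrightarrow> u \<noteq> v \<Longrightarrow> touch ladj (B' u) (B' v)" "\<And>v. B' v \<subseteq> grid s (K v) \<union> (\<Union>e\<in>E. grid s (M e))"
  proof (rule absorb_links[OF symp_ladj E, where B = "\<lambda>v. grid s (K v)" and C = "\<lambda>e. grid s (M e)"])
    show "conn ladj (grid s (K v))" for v by (rule grid_conn[OF kK s(1)])
    show "grid s (K v) \<noteq> {}" for v using self[of "pos v" "K v"] by (auto simp: K_def)
    show "grid s (K u) \<inter> grid s (K v) = {}" if "u \<in> V" "v \<in> V" "u \<noteq> v" for u v by (rule sepg) (use that KK in auto)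
    show "conn ladj (grid s (M e))" if "e \<in> E" for e by (rule grid_conn[OF cM(2)[OF that] s(1)])
    show "grid s (M e) \<inter> grid s (M e') = {}" if "e \<in> E" "e' \<in> E" "e \<noteq> e'" for e e' by (rule sepg) (use that MM in auto)
    show "grid s (M e) \<inter> grid s (K v) = {}" if "e \<in> E" "v \<in> V" "v \<notin> e" for e v by (rule sepg) (use that MK in auto)
    show "grid s (M e) \<inter> grid s (K v) \<noteq> {}" if "e \<in> E" "v \<in> e" for e v using MKi[OF that] self by blast
  qed (assumption | rule that)+
  have "bounded ((\<Union>v\<in>V. K v) \<union> (\<Union>e\<in>E. M e))"
    using fV fE cK cM compact_imp_bounded by (intro bounded_Un[THEN iffD2] conjI bounded_UN) auto
  then obtain r where r: "\<And>p. p \<in> (\<Union>v\<in>V. K v) \<union> (\<Union>e\<in>E. M e) \<Longrightarrow> norm p \<le> r" by (auto simp: bounded_iff)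
  \<comment> \<open>Cells are within 1 of the scaled point; one more unit makes the bound
    strict.\<close>
  define R where "R = \<lceil>s * \<bar>r\<bar>\<rceil> + 2"
  have gb: "\<bar>fst z\<bar> < R \<and> \<bar>snd z\<bar> < R" if zL: "z \<in> grid s L" and rL: "\<And>p. p \<in> L \<Longrightarrow> norm p \<le> r" for z L
  proof -
    obtain p where p: "p \<in> L" "z \<in> block (fl s p)" using zL by (auto simp: grid_def)
    have "\<bar>s * p$k\<bar> \<le> s * \<bar>r\<bar>" for k
      using component_le_norm_cart[of p k] rL[OF p(1)] s(1) by (simp add: abs_mult)
    hence "\<bar>s * p$1\<bar> \<le> s * \<bar>r\<bar>" "\<bar>s * p$2\<bar> \<le> s * \<bar>r\<bar>" by blast+
    moreover have "\<bar>s * p$1 - fst z\<bar> \<le> 1 \<and> \<bar>s * p$2 - snd z\<bar> \<le> 1" using block_near[of "fst z" "snd z"] p(2) by simp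
    ultimately show ?thesis unfolding R_def by linarith
  qed
  show ?thesis
  proof (intro exI[of _ B'] exI[of _ R] conjI ballI allI impI)
    show "conn ladj (B' v)" if "v \<in> V" for v by (rule B'(1)[OF that])
    show "B' v \<noteq> {}" for v using B'(2)[of v] self[of "pos v" "K v"] by (auto simp: K_def)
    have bz: "\<bar>fst z\<bar> < R \<and> \<bar>snd z\<bar> < R" if "v \<in> V" "z \<in> B' v" for v z
    proof -
      have "z \<in> grid s (K v) \<or> (\<exists>e\<in>E. z \<in> grid s (M e))" using B'(5) that(2) by blast
      thus ?thesis
      proof
        assume "z \<in> grid s (K v)" thus ?thesis by (rule gb) (use r that in blast)
      next
        assume "\<exists>e\<in>E. z \<in> grid s (M e)"
        then obtain e where "e \<in> E" "z \<in> grid s (M e)" by blast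
        thus ?thesis using gb[of z "M e"] r by blast
      qed
    qed
    show "\<bar>fst z\<bar> < R" "\<bar>snd z\<bar> < R" if "v \<in> V" "z \<in> B' v" for v z using bz[OF that] by blast+
    have "0 \<le> s * \<bar>r\<bar>" using s by simp
    thus "0 < R" unfolding R_def by linarith
  qed (use B' in auto)
qed

text \<open>The blobs and the outside of a large square, named \<open>None\<close>, absorb the
  finitely many leftover cells. Extra adjacencies may arise, but a layout that respects more edges
  also serves for fewer.\<close>

theorem planar_quotient:
  assumes "simple_graph V E" "planar V E"
  obtains f :: "cell \<Rightarrow> 'a option" where "cell_quotient f" "Some ` V \<subseteq> range f" "None \<in> range f"
    "\<And>u v. {u,v} \<in> E \<Longrightarrow> u \<noteq> v \<Longrightarrow> cell_quotient.adj f (Some u) (Some v)"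
proof -
  obtain B :: "'a \<Rightarrow> cell set" and R :: int where B0: "\<forall>v\<in>V. conn ladj (B v) \<and> B v \<noteq> {}"
    "\<forall>u\<in>V. \<forall>v\<in>V. u \<noteq> v \<longrightarrow> B u \<inter> B v = {}" "\<forall>u v. {u,v} \<in> E \<longrightarrow> u \<noteq> v \<longrightarrow> touch ladj (B u) (B v)"
    "\<forall>v\<in>V. \<forall>z\<in>B v. \<bar>fst z\<bar> < R \<and> \<bar>snd z\<bar> < R" "0 < R"
    using planar_blobs[OF assms] by (elim exE conjE)
  have B: "\<And>v. v \<in> V \<Longrightarrow> conn ladj (B v)" "\<And>v. v \<in> V \<Longrightarrow> B v \<noteq> {}"
    "\<And>u v. u \<in> V \<Longrightarrow> v \<in> V \<Longrightarrow> u \<noteq> v \<Longrightarrow> B u \<inter> B v = {}"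
    "\<And>u v. {u,v} \<in> E \<Longrightarrow> u \<noteq> v \<Longrightarrow> touch ladj (B u) (B v)"
    "\<And>v z. v \<in> V \<Longrightarrow> z \<in> B v \<Longrightarrow> \<bar>fst z\<bar> < R \<and> \<bar>snd z\<bar> < R" "0 < R"
    using B0(1) apply simp using B0(1) apply simp using B0(2) apply simp using B0(3) apply simp using B0(4) apply simp by (rule B0(5))
  have EV: "u \<in> V" "v \<in> V" if "{u,v} \<in> E" for u v using assms(1) that by (auto simp: simple_graph_def)
  define Out where "Out = {z::cell. R \<le> \<bar>fst z\<bar> \<or> R \<le> \<bar>snd z\<bar>}"
  define P where "P i = (case i of None \<Rightarrow> Out | Some v \<Rightarrow> if v \<in> V then B v else {})" for i
  have R: "(R,0) \<in> Out" using B(6) by (simp add: Out_def)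
  have BO: "B v \<inter> Out = {}" if "v \<in> V" for v
  proof -
    have "z \<notin> Out" if "z \<in> B v" for z using B(5)[OF \<open>v \<in> V\<close> that] by (simp add: Out_def)
    thus ?thesis by blast
  qed
  have UNc: "conn ladj UNIV"
  proof -
    have "restr ladj UNIV = ladj" by (simp add: restr_def fun_eq_iff)
    thus ?thesis using ladj_connected by (simp add: conn_def)
  qed
  have "\<exists>Q. (\<forall>i. P i \<subseteq> Q i \<and> conn ladj (Q i)) \<and> (\<forall>i j. i \<noteq> j \<longrightarrow> Q i \<inter> Q j = {}) \<and> (\<Union>i. Q i) = UNIV \<and> (\<forall>i. P i = {} \<longrightarrow> Q i = {})"
  proof (rule absorb[OF symp_ladj UNc])
    show "P i \<subseteq> UNIV" for i by simp
    show "conn ladj (P i)" for i using B(1) outside_conn[OF B(6)] by (auto simp: P_def Out_def split: option.split)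
    show "P i \<inter> P j = {}" if "i \<noteq> j" for i j
      using that BO B(3) by (cases i; cases j) (auto simp: P_def Int_commute)
    have "UNIV - (\<Union>i. P i) \<subseteq> {-R..R} \<times> {-R..R}"
    proof
      fix z assume "z \<in> UNIV - (\<Union>i. P i)"
      hence "z \<notin> P None" by blast
      hence "\<bar>fst z\<bar> < R" "\<bar>snd z\<bar> < R" by (simp_all add: P_def Out_def)
      thus "z \<in> {-R..R} \<times> {-R..R}" by (cases z) auto
    qed
    thus "finite (UNIV - (\<Union>i. P i))" by (rule finite_subset) simp
    have "(R,0) \<in> P None" using R by (simp add: P_def)
    thus "(\<Union>i. P i) \<noteq> {}" by blast
  qed
  then obtain Q where Q0: "\<forall>i. P i \<subseteq> Q i \<and> conn ladj (Q i)" "\<forall>i j. i \<noteq> j \<longrightarrow> Q i \<inter> Q j = {}" "(\<Union>i. Q i) = UNIV"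
    "\<forall>i. P i = {} \<longrightarrow> Q i = {}" by (elim exE conjE)
  have Q: "\<And>i. P i \<subseteq> Q i" "\<And>i. conn ladj (Q i)" "\<And>i j. i \<noteq> j \<Longrightarrow> Q i \<inter> Q j = {}" "(\<Union>i. Q i) = UNIV"
    "\<And>i. P i = {} \<Longrightarrow> Q i = {}" using Q0 by simp_all
  define f where "f z = (SOME i. z \<in> Q i)" for z
  have fQ: "f z = i \<longleftrightarrow> z \<in> Q i" for z i
  proof -
    have "z \<in> (\<Union>i. Q i)" using Q(4) by simp
    hence "\<exists>i. z \<in> Q i" by blast
    hence "z \<in> Q (f z)" unfolding f_def by (rule someI_ex)
    thus ?thesis using Q(3)[of i "f z"] by blast
  qed
  have fO: "f z = None" if "z \<in> Out" for z unfolding fQ using Q(1)[of None] that by (auto simp: P_def)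
  have rng: "range f \<subseteq> insert None (Some ` V)"
  proof
    fix i assume "i \<in> range f"
    then obtain z where z: "z \<in> Q i" using fQ by blast
    show "i \<in> insert None (Some ` V)"
    proof (rule ccontr)
      assume "i \<notin> insert None (Some ` V)"
      hence "P i = {}" by (cases i) (auto simp: P_def)
      thus False using Q(5) z by blast
    qed
  qed
  have cq: "cell_quotient f"
  proof
    show "conn ladj (f -` {u})" for u
    proof -
      have "f -` {u} = Q u" using fQ by auto
      thus ?thesis using Q(2) by simp
    qed
    show "finite (range f)" by (rule finite_subset[OF rng]) (use assms(1) in \<open>simp add: simple_graph_def\<close>)
    \<comment> \<open>An edge between different fibres has an end in the square, and its index
      differs from either end by at most 1 per coordinate.\<close>
    let ?I = "{-R-1..R+1} \<times> {-R-1..R+1}"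
    have "{e. \<not> (\<exists>u. f ` ends e \<subseteq> {u})} \<subseteq> (\<lambda>(i,j). EH i j) ` ?I \<union> (\<lambda>(i,j). EV i j) ` ?I \<union> (\<lambda>(i,j). ED i j) ` ?I"
    proof
      fix e assume "e \<in> {e. \<not> (\<exists>u. f ` ends e \<subseteq> {u})}"
      hence "\<not> ends e \<subseteq> Out" using fO by blast
      then obtain z where z0: "z \<in> ends e" "z \<notin> Out" by blast
      have z: "z \<in> ends e" "\<bar>fst z\<bar> < R" "\<bar>snd z\<bar> < R" using z0 by (simp_all add: Out_def not_le)
      show "e \<in> (\<lambda>(i,j). EH i j) ` ?I \<union> (\<lambda>(i,j). EV i j) ` ?I \<union> (\<lambda>(i,j). ED i j) ` ?I"
      proof (cases e)
        case (EH i j)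
        hence "(i,j) \<in> ?I" using z by auto
        thus ?thesis using EH by force
      next
        case (EV i j)
        hence "(i,j) \<in> ?I" using z by auto
        thus ?thesis using EV by force
      next
        case (ED i j)
        hence "(i,j) \<in> ?I" using z by auto
        thus ?thesis using ED by force
      qed
    qed
    thus "finite {e. \<not> (\<exists>u. f ` ends e \<subseteq> {u})}" by (rule finite_subset) simp
  qed
  have fB: "f z = Some v" if "v \<in> V" "z \<in> B v" for v z unfolding fQ using Q(1)[of "Some v"] that by (auto simp: P_def)
  show ?thesis
  proof (rule that[OF cq])
    show "Some ` V \<subseteq> range f"
    proof
      fix i assume "i \<in> Some ` V"
      then obtain v where v: "v \<in> V" "i = Some v" by blast
      obtain z where "z \<in> B v" using B(2)[OF v(1)] by blast
      hence "f z = i" using fB v by simp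
      thus "i \<in> range f" by blast
    qed
    show "None \<in> range f" using fO[OF R] by (metis rangeI)
    fix u v assume uv: "{u,v} \<in> E" "u \<noteq> v"
    obtain x y where xy: "x \<in> B u" "y \<in> B v" "ladj x y" using B(4)[OF uv] by (auto simp: touch_def)
    have "f x = Some u" "f y = Some v" using fB xy EV[OF uv(1)] by blast+
    thus "cell_quotient.adj f (Some u) (Some v)" unfolding cell_quotient.adj_def[OF cq] using xy(3) uv(2) by blast
  qed
qed

section \<open>The track layout of a planar graph\<close>

lemma digits_unique:
  fixes a b :: nat
  assumes "a * k + i = b * k + j" "i < k" "j < k"
  shows "a = b \<and> i = j"
proof -
  have "(a * k + i) div k = a" "(b * k + j) div k = b" using assms(2,3) by simp_all
  thus ?thesis using assms(1) by simp
qed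

lemma digit_bound: "(a::nat) < n \<Longrightarrow> i < k \<Longrightarrow> a * k + i < n * k"
  using mult_le_mono1[of "Suc a" n k] by simp

text \<open>A mixed radix number with bases 3, 3, 5, 5 for layer mod 3, leg, type and level mod 5;
  their product is 225.\<close>

definition code :: "nat \<Rightarrow> nat \<Rightarrow> att \<Rightarrow> nat" where
  "code l g x = ((l mod 3 * 3 + g) * 5 + fst (trk x)) * 5 + snd (trk x)"

lemma trk_less: "fst (trk x) < 5 \<and> snd (trk x) < 5" by (simp add: trk_def tau_less)

lemma code_less: assumes "g < 3" shows "code l g x < 225"
proof -
  have "l mod 3 * 3 + g < 3 * 3" by (rule digit_bound) (use assms in simp_all)
  hence "(l mod 3 * 3 + g) * 5 + fst (trk x) < 3 * 3 * 5" by (rule digit_bound) (simp add: trk_less)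
  hence "code l g x < 3 * 3 * 5 * 5" unfolding code_def by (rule digit_bound) (simp add: trk_less)
  thus ?thesis by simp
qed

lemma code_eq:
  assumes "code l g x = code l' g' x'" "g < 3" "g' < 3"
  shows "l mod 3 = l' mod 3 \<and> g = g' \<and> trk x = trk x'"
proof -
  have 1: "(l mod 3 * 3 + g) * 5 + fst (trk x) = (l' mod 3 * 3 + g') * 5 + fst (trk x') \<and> snd (trk x) = snd (trk x')"
    by (rule digits_unique[OF assms(1)[unfolded code_def]]) (simp_all add: trk_less)
  have 2: "l mod 3 * 3 + g = l' mod 3 * 3 + g' \<and> fst (trk x) = fst (trk x')"
    by (rule digits_unique[OF conjunct1[OF 1]]) (simp_all add: trk_less)
  have "l mod 3 = l' mod 3 \<and> g = g'"
    by (rule digits_unique[OF conjunct1[OF 2]]) (simp_all add: assms)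
  thus ?thesis using 1 2 by (simp add: prod_eq_iff)
qed

text \<open>With \<open>x = a + 3i\<close> and \<open>b = y + 3j\<close> the last two bounds give
  \<open>3(i + j) \<le> 2\<close>. So three residues are enough to make crosswise ordered edges use
  the same pair of layers.\<close>

lemma mod3_eq:
  fixes a b x y :: nat
  assumes "a mod 3 = x mod 3" "b mod 3 = y mod 3" "a \<le> x" "y \<le> b"
    and "b \<le> Suc a" "x \<le> Suc y"
  shows "a = x" "b = y"
proof -
  have "3 dvd x - a" "3 dvd b - y" using assms(1-4) mod_eq_dvd_iff_nat by metis+
  then obtain i j where "x - a = 3 * i" "b - y = 3 * j" by (elim dvdE)
  hence "x = a + 3 * i" "b = y + 3 * j" using assms(3,4) by linarith+
  hence "i = 0 \<and> j = 0" using assms(5,6) by linarith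
  thus "a = x" "b = y" using \<open>x = a + 3 * i\<close> \<open>b = y + 3 * j\<close> by simp_all
qed

text \<open>Vertices carry a BFS depth \<open>l\<close>, a leg \<open>g\<close> and a position \<open>p\<close> in the network.\<close>

lemma layered_track_layout:
  fixes l g :: "'a \<Rightarrow> nat" and p :: "'a \<Rightarrow> att"
  assumes E: "\<forall>e\<in>E. e \<subseteq> V \<and> card e = 2"
    and adj: "\<And>u v. {u,v} \<in> E \<Longrightarrow> u \<noteq> v \<Longrightarrow> p u = p v \<or> hedge (p u) (p v)"
    and lip: "\<And>u v. {u,v} \<in> E \<Longrightarrow> u \<noteq> v \<Longrightarrow> l u \<le> Suc (l v)"
    and g: "\<And>v. v \<in> V \<Longrightarrow> g v < 3"
    and inj: "\<And>u v. u \<in> V \<Longrightarrow> v \<in> V \<Longrightarrow> p u = p v \<Longrightarrow> g u = g v \<Longrightarrow> l u = l v \<Longrightarrow> u = v"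
  shows "\<exists>tr ord. track_layout V E 225 tr ord"
proof -
  define tr where "tr v = code (l v) (g v) (p v)" for v
  \<comment> \<open>Putting the layer first supplies the inequalities of \<open>mod3_eq\<close> for
    a crossing; once layers agree, the order of the network decides.\<close>
  define below where "below x y \<longleftrightarrow> l x < l y \<or> l x = l y \<and> att_less (p x) (p y)" for x y
  define ord where "ord i = {(x,y). x \<in> V \<and> y \<in> V \<and> tr x = i \<and> tr y = i \<and> below x y}" for i
  have EV: "u \<in> V" "v \<in> V" if "{u,v} \<in> E" for u v using E that by blast+
  have tr_eq: "l u mod 3 = l v mod 3 \<and> g u = g v \<and> trk (p u) = trk (p v)" if "tr u = tr v" "u \<in> V" "v \<in> V" for u v
    by (rule code_eq[OF that(1)[unfolded tr_def] g[OF that(2)] g[OF that(3)]])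
  have layer_eq: "l u = l v" if "l u mod 3 = l v mod 3" "l u \<le> Suc (l v)" "l v \<le> Suc (l u)" for u v
    using that by presburger
  have sym: "{u,v} \<in> E \<Longrightarrow> {v,u} \<in> E" for u v by (simp add: insert_commute)
  have proper: "tr u \<noteq> tr v" if e: "{u,v} \<in> E" "u \<noteq> v" for u v
  proof
    assume "tr u = tr v"
    note q = tr_eq[OF this EV[OF e(1)]]
    hence l: "l u = l v" using layer_eq lip[OF e] lip[OF sym[OF e(1)]] e(2) by blast
    show False using adj[OF e]
    proof
      assume "p u = p v" thus False using inj[OF EV[OF e(1)]] q l e(2) by blast
    next
      assume "hedge (p u) (p v)" thus False using hedge_trk q by blast
    qed
  qed
  have irr: "\<not> below x x" for x by (simp add: below_def alt_irrefl)
  have below_trans: "below x z" if "below x y" "below y z" for x y z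
    using that alt_trans[of "p x" "p y" "p z"] unfolding below_def by auto
  have tot: "below x y \<or> below y x" if "tr x = tr y" "x \<in> V" "y \<in> V" "x \<noteq> y" for x y
    using tr_eq[OF that(1-3)] inj[OF that(2,3)] that(4) alt_total[of "p x" "p y"] unfolding below_def by linarith
  have A: "track_assignment V E 225 tr ord"
    unfolding track_assignment_def
  proof (intro conjI ballI allI impI)
    show "tr v < 225" if "v \<in> V" for v unfolding tr_def by (rule code_less[OF g[OF that]])
    show "tr u \<noteq> tr v" if e: "e \<in> E" "u \<in> e" "v \<in> e" "u \<noteq> v" for e u v
    proof -
      have "card e = 2" using E e(1) by blast
      then obtain a b where "e = {a,b}" by (auto simp: card_2_iff)
      hence "e = {u,v}" using e(2-4) by blast
      thus ?thesis using proper e(1,4) by blast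
    qed
    show "ord i \<subseteq> {v \<in> V. tr v = i} \<times> {v \<in> V. tr v = i}" for i by (auto simp: ord_def)
    show "strict_linear_order_on {v \<in> V. tr v = i} (ord i)" for i
      unfolding strict_linear_order_on_def
    proof (intro conjI)
      show "trans (ord i)" by (rule transI) (use below_trans in \<open>auto simp: ord_def\<close>)
      show "irrefl (ord i)" by (simp add: irrefl_def ord_def irr)
      show "total_on {v \<in> V. tr v = i} (ord i)" using tot by (auto simp: total_on_def ord_def)
    qed
  qed
  have X: False if e: "{u,v} \<in> E" "{x,y} \<in> E" and t: "tr u = tr x" "tr v = tr y" "tr u \<noteq> tr v"
      and b: "below u x" "below y v" for u v x y
  proof -
    have uv: "u \<noteq> v" and xy: "x \<noteq> y" using t by auto
    note V = EV[OF e(1)] EV[OF e(2)]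
    note q = tr_eq[OF t(1) V(1,3)] tr_eq[OF t(2) V(2,4)]
    have "l u \<le> l x" "l y \<le> l v" using b by (auto simp: below_def)
    moreover have "l u mod 3 = l x mod 3" "l v mod 3 = l y mod 3" using q by blast+
    ultimately have l: "l u = l x" "l v = l y"
      using mod3_eq[of "l u" "l x" "l v" "l y"] lip[OF sym[OF e(1)] uv[symmetric]] lip[OF e(2) xy] by blast+
    hence a: "att_less (p u) (p x)" "att_less (p y) (p v)" using b by (auto simp: below_def)
    show False
    \<comment> \<open>If one edge stays inside a node, equal tracks force the other to do so too, as
      an edge of the network changes its track. Then the node of \<open>u\<close> would be both
      before and after that of \<open>x\<close>.\<close>
    proof (cases "p u = p v \<or> p x = p y")
      case True
      have "p u = p v \<and> p x = p y"
        using True adj[OF e(1) uv] adj[OF e(2) xy] hedge_trk[of "p u" "p v"] hedge_trk[of "p x" "p y"] q by auto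
      thus False using a alt_trans[of "p u" "p x" "p u"] alt_irrefl by metis
    next
      case False
      hence "hedge (p u) (p v)" "hedge (p x) (p y)" using adj[OF e(1) uv] adj[OF e(2) xy] by blast+
      thus False using network_no_crossing q a by blast
    qed
  qed
  have "\<not> has_X_crossing E tr ord"
  proof
    assume "has_X_crossing E tr ord"
    then obtain u v x y where "{u, v} \<in> E" "{x, y} \<in> E" "tr u = tr x" "tr v = tr y" "tr u \<noteq> tr v"
      "(u, x) \<in> ord (tr u)" "(y, v) \<in> ord (tr v)" unfolding has_X_crossing_def by blast
    thus False using X[of u v x y] by (simp add: ord_def)
  qed
  thus ?thesis using A unfolding track_layout_def by blast
qed

section \<open>Breadth-first layering of the quotient graph\<close>

context cell_quotient begin

lemma bfs_layering:
  assumes rt: "rt \<in> U"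
  obtains L up where "\<And>u. u \<in> U \<Longrightarrow> u \<noteq> rt \<Longrightarrow> adj u (up u) \<and> L u = Suc (L (up u))"
    "\<And>u v. adj u v \<Longrightarrow> L u \<le> Suc (L v)"
proof -
  have reach: "\<exists>n. (adj ^^ n) rt u" if "u \<in> U" for u
  proof -
    have "(restr adj U)\<^sup>*\<^sup>* rt u" using conn_U rt that by (auto simp: conn_def)
    hence "adj\<^sup>*\<^sup>* rt u" by (rule rtranclp_mono[THEN predicate2D, rotated]) (auto simp: restr_def)
    thus ?thesis by (simp add: rtranclp_is_Sup_relpowp)
  qed
  define L where "L u = (LEAST n. (adj ^^ n) rt u)" for u
  have L: "(adj ^^ L u) rt u" if "u \<in> U" for u unfolding L_def by (rule LeastI_ex[OF reach[OF that]])
  have le: "L u \<le> n" if "(adj ^^ n) rt u" for u n unfolding L_def using that by (rule Least_le)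
  have lip: "L u \<le> Suc (L v)" if "adj u v" for u v
  proof (rule le)
    have "adj v u" using that symp_adj by (auto simp: symp_def)
    thus "(adj ^^ Suc (L v)) rt u" using L[of v] adj_U[OF that] by auto
  qed
  have "\<exists>v. adj u v \<and> L u = Suc (L v)" if u: "u \<in> U" "u \<noteq> rt" for u
  proof (cases "L u")
    case 0
    thus ?thesis using L[OF u(1)] u(2) by simp
  next
    case (Suc n)
    then obtain v where v: "(adj ^^ n) rt v" "adj v u" using L[OF u(1)] by auto
    have "adj u v" using v(2) symp_adj by (auto simp: symp_def)
    thus ?thesis using lip[of u v] le[OF v(1)] Suc by (intro exI[of _ v]) auto
  qed
  hence "\<forall>u. \<exists>v. u \<in> U \<longrightarrow> u \<noteq> rt \<longrightarrow> adj u v \<and> L u = Suc (L v)" by blast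
  then obtain up where up: "\<forall>u. u \<in> U \<longrightarrow> u \<noteq> rt \<longrightarrow> adj u (up u) \<and> L u = Suc (L (up u))" by (rule choice[THEN exE])
  show ?thesis by (rule that[of up L]) (use up lip in blast)+
qed

end

theorem theorem8:
  fixes V :: "'a set" and E :: "'a set set"
  assumes "simple_graph V E" and "planar V E"
  shows "track_number V E \<le> 225"
proof -
  obtain f :: "cell \<Rightarrow> 'a option" where f: "cell_quotient f" "Some ` V \<subseteq> range f" "None \<in> range f"
    "\<And>u v. {u,v} \<in> E \<Longrightarrow> u \<noteq> v \<Longrightarrow> cell_quotient.adj f (Some u) (Some v)"
    using planar_quotient[OF assms] by metis
  interpret cell_quotient f by (rule f(1))
  \<comment> \<open>The outside serves as the root: it is present even if the graph has no vertices,
    and the quotient is connected.\<close>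
  have N: "None \<in> U" using f(3) by (simp add: U_def)
  obtain L up where up: "\<And>u. u \<in> U \<Longrightarrow> u \<noteq> None \<Longrightarrow> adj u (up u) \<and> L u = Suc (L (up u))"
    and lip: "\<And>u v. adj u v \<Longrightarrow> L u \<le> Suc (L v)"
    using bfs_layering[OF N] by metis
  have ly: "layered f None L up" by unfold_locales (use N up in auto)
  obtain loc leg where leg: "\<forall>u\<in>U. leg u < (3::nat)"
    and hadj: "\<forall>u\<in>U. \<forall>v\<in>U. adj u v \<longrightarrow> loc u = loc v \<or> hedge (loc u) (loc v)"
    and inj: "\<forall>u\<in>U. \<forall>v\<in>U. loc u = loc v \<longrightarrow> leg u = leg v \<longrightarrow> L u = L v \<longrightarrow> u = v"
    using layered.network_map[OF ly] by (elim exE conjE)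
  have VU: "Some v \<in> U" if "v \<in> V" for v using f(2) that by (auto simp: U_def)
  have EV: "\<forall>e\<in>E. e \<subseteq> V \<and> card e = 2" using assms(1) by (simp add: simple_graph_def)
  have "\<exists>tr ord. track_layout V E 225 tr ord"
  proof (rule layered_track_layout[where p = "\<lambda>v. loc (Some v)" and l = "\<lambda>v. L (Some v)" and g = "\<lambda>v. leg (Some v)"])
    show "\<forall>e\<in>E. e \<subseteq> V \<and> card e = 2" by (rule EV)
    show "loc (Some u) = loc (Some v) \<or> hedge (loc (Some u)) (loc (Some v))" if "{u,v} \<in> E" "u \<noteq> v" for u v
      using hadj f(4)[OF that] adj_U by blast
    show "L (Some u) \<le> Suc (L (Some v))" if "{u,v} \<in> E" "u \<noteq> v" for u v by (rule lip[OF f(4)[OF that]])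
    show "leg (Some v) < 3" if "v \<in> V" for v using leg VU[OF that] by blast
    show "u = v" if "u \<in> V" "v \<in> V" "loc (Some u) = loc (Some v)" "leg (Some u) = leg (Some v)" "L (Some u) = L (Some v)" for u v
      using inj VU[OF that(1)] VU[OF that(2)] that(3-5) by blast
  qed
  thus ?thesis unfolding track_number_def by (rule Least_le)
qed

end
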